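(* Let $T$ be a complete first-order theory of linearly ordered structures. Then $T$ satisfies the strong linear binarity condition (SLB) if and only if $T$ is definitionally equivalent with $T^{ccel}$; equivalently, if and only if some (equivalently, every) model $\mathcal M\models T$ is definitionally equivalent with its ccel-reduct $\mathcal M^{ccel}$.
   Context: $L$ is a first-order language containing a binary symbol $<$, and $T$ is a complete $L$-theory with infinite models in which $<$ is a linear order. "Definable" means definable by an $L$-formula without parameters. An equivalence relation on a linearly ordered set is convex if all its classes are convex. For a model $\mathcal M=(M,<,\dots)$ of $T$, its ccel-reduct is $\mathcal M^{ccel}=(M,<,P_i,E_j)_{i\in I,j\in J}$, where the $P_i$ name all definable subsets of $M$ (in one variable) and the $E_j$ name all definable convex equivalence relations on $M$ (the language $L_T$ of these names being chosen uniformly from $L$ and $T$); $T^{ccel}$ is the complete theory of $\mathcal M^{ccel}$, which does not depend on the choice of $\mathcal M$. Two structures are definitionally equivalent if they have the same domain and the same definable sets (of tuples); two complete theories are definitionally equivalent if they have definitionally equivalent models. An initial part of $M$ is a set $C\subseteq M$ such that $c\in C$ and $d<c$ imply $d\in C$. $T$ satisfies (SLB) if for every model $M\models T$, every initial part $C\subset M$ and every automorphism $f$ of $M$ with $f(C)=C$, the map $g$ defined by $g(x)=f(x)$ for $x\in C$ and $g(x)=x$ for $x\notin C$ is an automorphism of $M$.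
   Formalization: Definitional equivalence of T with T^ccel is taken to mean models with the same domain, same definable sets and also the same order <; without the common order the claim is false. Models range over subsets of an arbitrary set at least as large as the set of L-formulas. *)

theory Defs
  imports Main "HOL-Library.Equipollence"
begin

section \<open>First-order languages, formulas and structures\<close>

datatype 'f tm = Var nat | Fn 'f "'f tm list"

datatype ('f, 'p) fm =
    Eq "'f tm" "'f tm"
  | Rel 'p "'f tm list"
  | Neg "('f, 'p) fm"
  | And "('f, 'p) fm" "('f, 'p) fm"
  | Exists nat "('f, 'p) fm"

text \<open>
  A symbol is a name together with an arity. Function symbols may be absent, and the arity 0 is
  allowed (constants).
\<close>

record ('f, 'p) lang =
  funs :: "('f \<times> nat) set"
  rels :: "('p \<times> nat) set"

primrec wf_tm :: "('f, 'p) lang \<Rightarrow> 'f tm \<Rightarrow> bool" where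
  "wf_tm L (Var n) \<longleftrightarrow> True"
| "wf_tm L (Fn f ts) \<longleftrightarrow> (f, length ts) \<in> funs L \<and> list_all (wf_tm L) ts"

primrec wf_fm :: "('f, 'p) lang \<Rightarrow> ('f, 'p) fm \<Rightarrow> bool" where
  "wf_fm L (Eq s t) \<longleftrightarrow> wf_tm L s \<and> wf_tm L t"
| "wf_fm L (Rel p ts) \<longleftrightarrow> (p, length ts) \<in> rels L \<and> list_all (wf_tm L) ts"
| "wf_fm L (Neg \<phi>) \<longleftrightarrow> wf_fm L \<phi>"
| "wf_fm L (And \<phi> \<psi>) \<longleftrightarrow> wf_fm L \<phi> \<and> wf_fm L \<psi>"
| "wf_fm L (Exists x \<phi>) \<longleftrightarrow> wf_fm L \<phi>"

primrec fv_tm :: "'f tm \<Rightarrow> nat set" where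
  "fv_tm (Var n) = {n}"
| "fv_tm (Fn f ts) = \<Union> (set (map fv_tm ts))"

primrec fv :: "('f, 'p) fm \<Rightarrow> nat set" where
  "fv (Eq s t) = fv_tm s \<union> fv_tm t"
| "fv (Rel p ts) = \<Union> (set (map fv_tm ts))"
| "fv (Neg \<phi>) = fv \<phi>"
| "fv (And \<phi> \<psi>) = fv \<phi> \<union> fv \<psi>"
| "fv (Exists x \<phi>) = fv \<phi> - {x}"

definition sentence :: "('f, 'p) lang \<Rightarrow> ('f, 'p) fm \<Rightarrow> bool" where
  "sentence L \<sigma> \<longleftrightarrow> wf_fm L \<sigma> \<and> fv \<sigma> = {}"

text \<open>
  The interpretations matter only on tuples from the universe whose length is the arity of a
  symbol of the language; elsewhere their values are junk.
\<close>

record ('f, 'p, 'm) struct =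
  univ :: "'m set"
  fint :: "'f \<Rightarrow> 'm list \<Rightarrow> 'm"
  rint :: "'p \<Rightarrow> 'm list \<Rightarrow> bool"

definition tuples :: "nat \<Rightarrow> 'm set \<Rightarrow> 'm list set" where
  "tuples n A = {xs. length xs = n \<and> set xs \<subseteq> A}"

definition is_struct :: "('f, 'p) lang \<Rightarrow> ('f, 'p, 'm) struct \<Rightarrow> bool" where
  "is_struct L M \<longleftrightarrow> univ M \<noteq> {} \<and>
     (\<forall>(f, n) \<in> funs L. \<forall>xs \<in> tuples n (univ M). fint M f xs \<in> univ M)"

primrec eval_tm :: "('f, 'p, 'm) struct \<Rightarrow> (nat \<Rightarrow> 'm) \<Rightarrow> 'f tm \<Rightarrow> 'm" where
  "eval_tm M e (Var n) = e n"
| "eval_tm M e (Fn f ts) = fint M f (map (eval_tm M e) ts)"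

primrec sat :: "('f, 'p, 'm) struct \<Rightarrow> (nat \<Rightarrow> 'm) \<Rightarrow> ('f, 'p) fm \<Rightarrow> bool" where
  "sat M e (Eq s t) \<longleftrightarrow> eval_tm M e s = eval_tm M e t"
| "sat M e (Rel p ts) \<longleftrightarrow> rint M p (map (eval_tm M e) ts)"
| "sat M e (Neg \<phi>) \<longleftrightarrow> \<not> sat M e \<phi>"
| "sat M e (And \<phi> \<psi>) \<longleftrightarrow> sat M e \<phi> \<and> sat M e \<psi>"
| "sat M e (Exists x \<phi>) \<longleftrightarrow> (\<exists>a \<in> univ M. sat M (e(x := a)) \<phi>)"

definition holds :: "('f, 'p, 'm) struct \<Rightarrow> ('f, 'p) fm \<Rightarrow> bool" where
  "holds M \<sigma> \<longleftrightarrow> (\<forall>e. range e \<subseteq> univ M \<longrightarrow> sat M e \<sigma>)"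

definition is_model :: "('f, 'p) lang \<Rightarrow> ('f, 'p) fm set \<Rightarrow> ('f, 'p, 'm) struct \<Rightarrow> bool" where
  "is_model L T M \<longleftrightarrow> is_struct L M \<and> (\<forall>\<sigma> \<in> T. holds M \<sigma>)"

definition theory_of :: "('f, 'p) lang \<Rightarrow> ('f, 'p, 'm) struct \<Rightarrow> ('f, 'p) fm set" where
  "theory_of L M = {\<sigma>. sentence L \<sigma> \<and> holds M \<sigma>}"

text \<open>
  HOL cannot quantify over structures on all sets at once, so notions that quantify over all
  models take the type \<open>'m\<close> in which the universes live as an argument. By the
  Loewenheim-Skolem theorem nothing is lost once \<open>'m\<close> has room for a set of the
  cardinality of the set of \<open>L\<close>-formulas, that is, for |L| plus aleph-zero many elements.
\<close>

definition complete_theory ::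
    "'m itself \<Rightarrow> ('f, 'p) lang \<Rightarrow> ('f, 'p) fm set \<Rightarrow> bool" where
  "complete_theory _ L T \<longleftrightarrow>
     (\<forall>\<sigma> \<in> T. sentence L \<sigma>) \<and>
     (\<exists>M :: ('f, 'p, 'm) struct. is_model L T M) \<and>
     (\<forall>\<sigma>. sentence L \<sigma> \<longrightarrow>
        (\<forall>M :: ('f, 'p, 'm) struct. is_model L T M \<longrightarrow> holds M \<sigma>) \<or>
        (\<forall>M :: ('f, 'p, 'm) struct. is_model L T M \<longrightarrow> holds M (Neg \<sigma>)))"

definition automorphism :: "('f, 'p) lang \<Rightarrow> ('f, 'p, 'm) struct \<Rightarrow> ('m \<Rightarrow> 'm) \<Rightarrow> bool" where
  "automorphism L M h \<longleftrightarrow>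
     bij_betw h (univ M) (univ M) \<and>
     (\<forall>(f, n) \<in> funs L. \<forall>xs \<in> tuples n (univ M). h (fint M f xs) = fint M f (map h xs)) \<and>
     (\<forall>(p, n) \<in> rels L. \<forall>xs \<in> tuples n (univ M). rint M p xs \<longleftrightarrow> rint M p (map h xs))"


section \<open>Definability and definitional equivalence\<close>

text \<open>
  The set defined by \<open>\<phi>\<close> in the variables \<open>0, \<dots>, n - 1\<close>; it is meaningful when
  \<open>fv \<phi> \<subseteq> {..<n}\<close>.
\<close>

definition defined_set :: "('f, 'p, 'm) struct \<Rightarrow> nat \<Rightarrow> ('f, 'p) fm \<Rightarrow> 'm list set" where
  "defined_set M n \<phi> = {xs \<in> tuples n (univ M). sat M (nth xs) \<phi>}"

definition definable :: "('f, 'p) lang \<Rightarrow> ('f, 'p, 'm) struct \<Rightarrow> nat \<Rightarrow> 'm list set \<Rightarrow> bool" where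
  "definable L M n D \<longleftrightarrow>
     (\<exists>\<phi>. wf_fm L \<phi> \<and> fv \<phi> \<subseteq> {..<n} \<and> D = defined_set M n \<phi>)"

definition def_equiv ::
    "('f, 'p) lang \<Rightarrow> ('f, 'p, 'm) struct \<Rightarrow> ('g, 'q) lang \<Rightarrow> ('g, 'q, 'm) struct \<Rightarrow> bool" where
  "def_equiv L M L' N \<longleftrightarrow>
     univ M = univ N \<and> (\<forall>n D. definable L M n D \<longleftrightarrow> definable L' N n D)"


section \<open>Linearly ordered structures\<close>

definition ord_rel :: "('f, 'p, 'm) struct \<Rightarrow> 'p \<Rightarrow> ('m \<times> 'm) set" where
  "ord_rel M lt = {(x, y). x \<in> univ M \<and> y \<in> univ M \<and> rint M lt [x, y]}"

definition lin_ordered :: "('f, 'p, 'm) struct \<Rightarrow> 'p \<Rightarrow> bool" where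
  "lin_ordered M lt \<longleftrightarrow> strict_linear_order_on (univ M) (ord_rel M lt)"

text \<open>
  Definitional equivalence of theories of linearly ordered structures. The two models are
  structures \<open>(M, <, \<dots>)\<close> on the same linearly ordered domain, not merely on the same set:
  if the second model could carry a different (definable) linear order, a theory could be
  equivalent in this sense to its ccel-theory without any of its models being definitionally
  equivalent to its ccel-reduct.
\<close>

definition def_equiv_theories ::
    "'m itself \<Rightarrow> ('f, 'p) lang \<Rightarrow> 'p \<Rightarrow> ('f, 'p) fm set
       \<Rightarrow> ('g, 'q) lang \<Rightarrow> 'q \<Rightarrow> ('g, 'q) fm set \<Rightarrow> bool" where
  "def_equiv_theories _ L lt T L' lt' T' \<longleftrightarrow>
     (\<exists>(M :: ('f, 'p, 'm) struct) (N :: ('g, 'q, 'm) struct).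
        is_model L T M \<and> is_model L' T' N \<and>
        ord_rel M lt = ord_rel N lt' \<and> def_equiv L M L' N)"

definition initial_part :: "('f, 'p, 'm) struct \<Rightarrow> 'p \<Rightarrow> 'm set \<Rightarrow> bool" where
  "initial_part M lt C \<longleftrightarrow>
     C \<subseteq> univ M \<and> (\<forall>c d. c \<in> C \<and> (d, c) \<in> ord_rel M lt \<longrightarrow> d \<in> C)"

definition SLB :: "'m itself \<Rightarrow> ('f, 'p) lang \<Rightarrow> 'p \<Rightarrow> ('f, 'p) fm set \<Rightarrow> bool" where
  "SLB _ L lt T \<longleftrightarrow>
     (\<forall>(M :: ('f, 'p, 'm) struct) C f.
        is_model L T M \<and> initial_part M lt C \<and> automorphism L M f \<and> f ` C = C
          \<longrightarrow> automorphism L M (\<lambda>x. if x \<in> C then f x else x))"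

definition convex_in :: "('f, 'p, 'm) struct \<Rightarrow> 'p \<Rightarrow> 'm set \<Rightarrow> bool" where
  "convex_in M lt X \<longleftrightarrow>
     (\<forall>x \<in> X. \<forall>z \<in> X. \<forall>y. (x, y) \<in> ord_rel M lt \<and> (y, z) \<in> ord_rel M lt \<longrightarrow> y \<in> X)"

definition convex_equiv :: "('f, 'p, 'm) struct \<Rightarrow> 'p \<Rightarrow> ('m \<times> 'm) set \<Rightarrow> bool" where
  "convex_equiv M lt r \<longleftrightarrow> equiv (univ M) r \<and> (\<forall>X \<in> univ M // r. convex_in M lt X)"


section \<open>The ccel-reduct and the ccel-theory\<close>

text \<open>
  The definable sets and the definable convex equivalence relations are named by the formulas
  that define them; sets with several definitions have several names.
\<close>

datatype ('f, 'p) ccel_sym = Less | PSet "('f, 'p) fm" | CEq "('f, 'p) fm"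

definition ccel_lang ::
    "'m itself \<Rightarrow> ('f, 'p) lang \<Rightarrow> 'p \<Rightarrow> ('f, 'p) fm set \<Rightarrow> ('f, ('f, 'p) ccel_sym) lang" where
  "ccel_lang _ L lt T =
     \<lparr> funs = {},
       rels = {(Less, 2)}
         \<union> {(PSet \<phi>, 1) | \<phi>. wf_fm L \<phi> \<and> fv \<phi> \<subseteq> {..<1}}
         \<union> {(CEq \<psi>, 2) | \<psi>. wf_fm L \<psi> \<and> fv \<psi> \<subseteq> {..<2} \<and>
              (\<forall>M :: ('f, 'p, 'm) struct. is_model L T M \<longrightarrow>
                 convex_equiv M lt {(x, y). [x, y] \<in> defined_set M 2 \<psi>})} \<rparr>"

definition ccel_reduct ::
    "'p \<Rightarrow> ('f, 'p, 'm) struct \<Rightarrow> ('f, ('f, 'p) ccel_sym, 'm) struct" where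
  "ccel_reduct lt M =
     \<lparr> univ = univ M,
       fint = fint M,
       rint = (\<lambda>s xs. case s of
           Less \<Rightarrow> rint M lt xs
         | PSet \<phi> \<Rightarrow> xs \<in> defined_set M 1 \<phi>
         | CEq \<psi> \<Rightarrow> xs \<in> defined_set M 2 \<psi>) \<rparr>"

text \<open>For a complete theory the choice of the model is irrelevant.\<close>

definition ccel_theory ::
    "'m itself \<Rightarrow> ('f, 'p) lang \<Rightarrow> 'p \<Rightarrow> ('f, 'p) fm set \<Rightarrow> ('f, ('f, 'p) ccel_sym) fm set" where
  "ccel_theory ty L lt T =
     theory_of (ccel_lang ty L lt T)
       (ccel_reduct lt (SOME M :: ('f, 'p, 'm) struct. is_model L T M))"

end

theory Submission
  imports Defs
begin

text \<open>
  Gluing an automorphism that preserves an initial part with the identity always preserves the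
  definable sets and the definable convex equivalence relations, whence (SLB) if all definable
  sets come from these.

  Conversely, assume (SLB), and work with types of tuples in elementary extensions carrying
  automorphisms; since (SLB) speaks only about models on the given type, all extensions are taken
  there, by ultrapowers followed by Loewenheim-Skolem. Gluing with the identity yields for
  increasing tuples: (i) \<open>tp(c, b) = tp(c, b')\<close> implies \<open>tp(a, b) = tp(a, b')\<close> for
  \<open>a < c\<close>; (ii) if \<open>a < a' < b' < b\<close> and \<open>tp(a, b) = tp(a', b')\<close>, then \<open>(a, b)\<close>,
  \<open>(a', b)\<close> and \<open>(a, b')\<close> have the same type. By (i), types of tuples are determined by
  those of pairs. By (ii), the realisations above \<open>a\<close> of a type over \<open>a\<close> are convex among those
  of its restriction to the empty set. So if \<open>b < b'\<close> have the same type but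
  \<open>tp(a, b) \<noteq> tp(a, b')\<close>, then a cut definable from \<open>a\<close> lies between \<open>b\<close> and \<open>b'\<close>. The cuts
  defined in the same way from the elements satisfying a suitable formula \<open>\<pi>\<close> of \<open>tp(a)\<close> give
  a definable convex equivalence relation \<open>E\<close> with only finitely many classes meeting the interval
  from \<open>a\<close> to \<open>b\<close>: otherwise compactness yields two elements of the same type over \<open>a\<close>
  separated by the cut of a realisation of \<open>tp(a)\<close>, against (i) and (ii). Counting the classes of
  \<open>E\<close> between \<open>a\<close> and \<open>b\<close> distinguishes \<open>(a, b)\<close> from \<open>(a, b')\<close> in the ccel-reduct, and
  compactness makes every formula a boolean combination of formulas of the reduct.
\<close>

section \<open>Renaming and derived connectives\<close>

text \<open>The cut between \<open>b\<close> and \<open>b'\<close> is defined with the parameter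
  \<open>a\<close>, but the reduct only has relations definable without parameters. Replacing
  \<open>a\<close> by a formula \<open>\<pi>\<close> removes the parameter at a price: the cuts of
  all other elements satisfying \<open>\<pi>\<close> come in as well. If they cut the interval up to
  \<open>b\<close> into infinitely many pieces, no finite count could tell \<open>b\<close> from
  \<open>b'\<close>. Finiteness up to \<open>b\<close> is therefore the crux: it lets the count
  register the one additional cut, that of \<open>a\<close> itself.

  A given model may be rigid. Equality of types becomes an automorphism only in an elementary
  extension; (SLB) is applied there and the conclusion is pulled back along the embedding.

  In the other direction two points need care. A convex equivalence relation might relate elements
  on different sides of the initial part, where the glued map acts differently on the two. And a
  model of the ccel-theory that is definitionally equivalent to a model \<open>M\<close> of
  \<open>T\<close> need not be the reduct of \<open>M\<close>: the same relations may occur in it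
  under other names.\<close>

lemma finite_fv_tm: "finite (fv_tm t)"
  by (induction t) auto

lemma finite_fv: "finite (fv \<phi>)"
  by (induction \<phi>) (auto simp: finite_fv_tm)

lemma eval_tm_cong: "(\<And>n. n \<in> fv_tm t \<Longrightarrow> e n = e' n) \<Longrightarrow> eval_tm M e t = eval_tm M e' t"
proof (induction t)
  case (Fn f ts)
  then have "map (eval_tm M e) ts = map (eval_tm M e') ts" by auto
  then show ?case by (simp only: eval_tm.simps)
qed auto

lemma sat_cong: "(\<And>n. n \<in> fv \<phi> \<Longrightarrow> e n = e' n) \<Longrightarrow> sat M e \<phi> = sat M e' \<phi>"
proof (induction \<phi> arbitrary: e e')
  case (Eq s t)
  then show ?case using eval_tm_cong[of s e e' M] eval_tm_cong[of t e e' M] by auto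
next
  case (Rel p ts)
  then have "map (eval_tm M e) ts = map (eval_tm M e') ts"
    by (auto intro!: eval_tm_cong)
  then show ?case by (simp only: sat.simps)
next
  case (Neg \<phi>)
  show ?case using Neg.IH[of e e'] Neg.prems by simp
next
  case (And \<phi> \<psi>)
  show ?case using And.IH[of e e'] And.prems by simp
next
  case (Exists x \<phi>)
  have "sat M (e(x := a)) \<phi> = sat M (e'(x := a)) \<phi>" for a
    using Exists.prems by (intro Exists.IH) auto
  then show ?case by simp
qed

lemma eval_tm_in_univ:
  "is_struct L M \<Longrightarrow> wf_tm L t \<Longrightarrow> e ` fv_tm t \<subseteq> univ M \<Longrightarrow> eval_tm M e t \<in> univ M"
proof (induction t)
  case (Fn f ts)
  then have "map (eval_tm M e) ts \<in> tuples (length ts) (univ M)"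
    by (fastforce simp: tuples_def list_all_iff)
  with Fn.prems show ?case by (fastforce simp: is_struct_def)
qed auto

primrec ren_tm :: "(nat \<Rightarrow> nat) \<Rightarrow> 'f tm \<Rightarrow> 'f tm" where
  "ren_tm s (Var n) = Var (s n)"
| "ren_tm s (Fn f ts) = Fn f (map (ren_tm s) ts)"

definition fresh :: "nat set \<Rightarrow> nat" where
  "fresh A = Suc (Max (insert 0 A))"

lemma fresh: "finite A \<Longrightarrow> n \<in> A \<Longrightarrow> n < fresh A"
  by (simp add: fresh_def less_Suc_eq_le)

text \<open>Renamings may identify variables, so capture has to be avoided: a bound variable is
  moved above the images of all free ones.\<close>

primrec ren :: "(nat \<Rightarrow> nat) \<Rightarrow> ('f, 'p) fm \<Rightarrow> ('f, 'p) fm" where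
  "ren s (Eq t u) = Eq (ren_tm s t) (ren_tm s u)"
| "ren s (Rel p ts) = Rel p (map (ren_tm s) ts)"
| "ren s (Neg \<phi>) = Neg (ren s \<phi>)"
| "ren s (And \<phi> \<psi>) = And (ren s \<phi>) (ren s \<psi>)"
| "ren s (Exists x \<phi>) = Exists (fresh (s ` fv \<phi>)) (ren (s(x := fresh (s ` fv \<phi>))) \<phi>)"

lemma fv_ren_tm: "fv_tm (ren_tm s t) = s ` fv_tm t"
  by (induction t) auto

lemma fv_ren [simp]: "fv (ren s \<phi>) = s ` fv \<phi>"
proof (induction \<phi> arbitrary: s)
  case (Exists x \<phi>)
  have "s n \<noteq> fresh (s ` fv \<phi>)" if "n \<in> fv \<phi>" for n
    using fresh[of "s ` fv \<phi>" "s n"] that finite_fv[of \<phi>] by auto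
  then show ?case using Exists by (auto simp: image_iff split: if_splits)
qed (auto simp: fv_ren_tm)

lemma wf_ren_tm: "wf_tm L (ren_tm s t) = wf_tm L t"
  by (induction t) (auto simp: list_all_iff)

lemma wf_ren [simp]: "wf_fm L (ren s \<phi>) = wf_fm L \<phi>"
  by (induction \<phi> arbitrary: s) (auto simp: wf_ren_tm list_all_iff)

lemma eval_ren_tm: "eval_tm M e (ren_tm s t) = eval_tm M (\<lambda>n. e (s n)) t"
proof (induction t)
  case (Fn f ts)
  then have "map (eval_tm M e \<circ> ren_tm s) ts = map (eval_tm M (\<lambda>n. e (s n))) ts" by simp
  then show ?case by (simp del: map_eq_conv)
qed auto

lemma sat_ren [simp]: "sat M e (ren s \<phi>) = sat M (\<lambda>n. e (s n)) \<phi>"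
proof (induction \<phi> arbitrary: e s)
  case (Rel p ts)
  have "map (eval_tm M e \<circ> ren_tm s) ts = map (eval_tm M (\<lambda>n. e (s n))) ts" by (auto simp: eval_ren_tm)
  then show ?case by (simp del: map_eq_conv)
next
  case (Exists x \<phi>)
  let ?y = "fresh (s ` fv \<phi>)"
  have "s n \<noteq> ?y" if "n \<in> fv \<phi>" for n
    using fresh[of "s ` fv \<phi>" "s n"] that finite_fv[of \<phi>] by auto
  then have "sat M (\<lambda>n. (e(?y := a)) ((s(x := ?y)) n)) \<phi> = sat M ((\<lambda>n. e (s n))(x := a)) \<phi>" for a
    by (intro sat_cong) auto
  then show ?case unfolding ren.simps sat.simps Exists.IH by (rule bex_cong[OF refl])
qed (auto simp: eval_ren_tm)

definition Iff :: "('f, 'p) fm \<Rightarrow> ('f, 'p) fm \<Rightarrow> ('f, 'p) fm" where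
  "Iff \<phi> \<psi> = And (Neg (And \<phi> (Neg \<psi>))) (Neg (And \<psi> (Neg \<phi>)))"

definition Imp :: "('f, 'p) fm \<Rightarrow> ('f, 'p) fm \<Rightarrow> ('f, 'p) fm" where
  "Imp \<phi> \<psi> = Neg (And \<phi> (Neg \<psi>))"

definition All :: "nat \<Rightarrow> ('f, 'p) fm \<Rightarrow> ('f, 'p) fm" where
  "All x \<phi> = Neg (Exists x (Neg \<phi>))"

text \<open>A closed truth, so that an empty conjunction contributes no free variables.\<close>

definition TT :: "('f, 'p) fm" where
  "TT = All 0 (Eq (Var 0) (Var 0))"

lemma sat_Iff [simp]: "sat M e (Iff \<phi> \<psi>) \<longleftrightarrow> (sat M e \<phi> \<longleftrightarrow> sat M e \<psi>)"
  by (auto simp: Iff_def)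

lemma sat_Imp [simp]: "sat M e (Imp \<phi> \<psi>) \<longleftrightarrow> (sat M e \<phi> \<longrightarrow> sat M e \<psi>)"
  by (auto simp: Imp_def)

lemma sat_All [simp]: "sat M e (All x \<phi>) \<longleftrightarrow> (\<forall>a\<in>univ M. sat M (e(x := a)) \<phi>)"
  by (auto simp: All_def)

lemma sat_TT [simp]: "sat M e TT"
  by (simp add: TT_def)

lemma wf_derived [simp]:
  "wf_fm L (Iff \<phi> \<psi>) \<longleftrightarrow> wf_fm L \<phi> \<and> wf_fm L \<psi>"
  "wf_fm L (Imp \<phi> \<psi>) \<longleftrightarrow> wf_fm L \<phi> \<and> wf_fm L \<psi>"
  "wf_fm L (All x \<phi>) \<longleftrightarrow> wf_fm L \<phi>"
  "wf_fm L TT"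
  by (auto simp: Iff_def Imp_def All_def TT_def)

lemma fv_derived [simp]:
  "fv (Iff \<phi> \<psi>) = fv \<phi> \<union> fv \<psi>"
  "fv (Imp \<phi> \<psi>) = fv \<phi> \<union> fv \<psi>"
  "fv (All x \<phi>) = fv \<phi> - {x}"
  "fv TT = {}"
  by (auto simp: Iff_def Imp_def All_def TT_def)

definition Exs :: "nat list \<Rightarrow> ('f, 'p) fm \<Rightarrow> ('f, 'p) fm" where
  "Exs xs \<phi> = foldr Exists xs \<phi>"

lemma wf_Exs [simp]: "wf_fm L (Exs xs \<phi>) = wf_fm L \<phi>"
  by (induction xs) (auto simp: Exs_def)

lemma fv_Exs [simp]: "fv (Exs xs \<phi>) = fv \<phi> - set xs"
  by (induction xs) (auto simp: Exs_def)

lemma sat_Exs: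
  "sat M e (Exs xs \<phi>) \<longleftrightarrow>
     (\<exists>e'. (\<forall>n. n \<notin> set xs \<longrightarrow> e' n = e n) \<and> (\<forall>n\<in>set xs. e' n \<in> univ M) \<and> sat M e' \<phi>)"
proof (induction xs arbitrary: e)
  case Nil
  have "(\<forall>n. e' n = e n) \<longleftrightarrow> e' = e" for e' :: "nat \<Rightarrow> 'c" by auto
  then show ?case by (simp add: Exs_def)
next
  case (Cons x xs)
  have "sat M e (Exs (x # xs) \<phi>) \<longleftrightarrow> (\<exists>a\<in>univ M. \<exists>e'. (\<forall>n. n \<notin> set xs \<longrightarrow> e' n = (e(x := a)) n) \<and>
      (\<forall>n\<in>set xs. e' n \<in> univ M) \<and> sat M e' \<phi>)"
    using Cons by (simp add: Exs_def)
  also have "\<dots> \<longleftrightarrow> (\<exists>e'. (\<forall>n. n \<notin> set (x # xs) \<longrightarrow> e' n = e n) \<and>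
      (\<forall>n\<in>set (x # xs). e' n \<in> univ M) \<and> sat M e' \<phi>)" (is "?l \<longleftrightarrow> ?r")
  proof
    assume ?l
    then obtain a e' where *: "a \<in> univ M" "\<forall>n. n \<notin> set xs \<longrightarrow> e' n = (e(x := a)) n"
      "\<forall>n\<in>set xs. e' n \<in> univ M" "sat M e' \<phi>" by blast
    then have "e' x \<in> univ M" by (cases "x \<in> set xs") auto
    with * show ?r by (intro exI[of _ e']) auto
  next
    assume ?r
    then obtain e' where *: "\<forall>n. n \<notin> set (x # xs) \<longrightarrow> e' n = e n"
      "\<forall>n\<in>set (x # xs). e' n \<in> univ M" "sat M e' \<phi>" by blast
    then show ?l by (intro bexI[of _ "e' x"] exI[of _ e']) auto
  qed
  finally show ?case .
qed

definition Conj :: "('f, 'p) fm list \<Rightarrow> ('f, 'p) fm" where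
  "Conj \<phi>s = foldr And \<phi>s TT"

lemma sat_Conj [simp]: "sat M e (Conj \<phi>s) \<longleftrightarrow> (\<forall>\<phi>\<in>set \<phi>s. sat M e \<phi>)"
  by (induction \<phi>s) (auto simp: Conj_def)

lemma wf_Conj [simp]: "wf_fm L (Conj \<phi>s) \<longleftrightarrow> (\<forall>\<phi>\<in>set \<phi>s. wf_fm L \<phi>)"
  by (induction \<phi>s) (auto simp: Conj_def)

lemma fv_Conj [simp]: "fv (Conj \<phi>s) = (\<Union>\<phi>\<in>set \<phi>s. fv \<phi>)"
  by (induction \<phi>s) (auto simp: Conj_def)

text \<open>
  Variables are labelled by elements of an arbitrary type, which then play the role of new
  constants: \<open>(\<phi>, v)\<close> is evaluated under an assignment \<open>\<nu>\<close> of the labels by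
  \<open>sat M (\<lambda>n. \<nu> (v n)) \<phi>\<close>.
\<close>

lemma finite_labelled_conj:
  assumes "finite S" "\<And>\<phi> v. (\<phi>, v) \<in> S \<Longrightarrow> wf_fm L \<phi>"
  shows "\<exists>\<Phi> (u :: nat \<Rightarrow> 'c). wf_fm L \<Phi> \<and>
     (\<forall>(M :: ('f, 'p, 'm) struct) \<nu>. sat M (\<lambda>n. \<nu> (u n)) \<Phi> \<longleftrightarrow> (\<forall>(\<phi>, v)\<in>S. sat M (\<lambda>n. \<nu> (v n)) \<phi>)) \<and>
     u ` fv \<Phi> \<subseteq> (\<Union>(\<phi>, v)\<in>S. v ` fv \<phi>)"
  using assms
proof (induction S)
  case empty
  show ?case by (intro exI[of _ TT]) auto
next
  case (insert p S)
  obtain \<phi> v where p: "p = (\<phi>, v)" by (cases p)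
  have "\<exists>\<Phi> (u :: nat \<Rightarrow> 'c). wf_fm L \<Phi> \<and>
     (\<forall>(M :: ('f, 'p, 'm) struct) \<nu>. sat M (\<lambda>n. \<nu> (u n)) \<Phi> \<longleftrightarrow> (\<forall>(\<phi>, v)\<in>S. sat M (\<lambda>n. \<nu> (v n)) \<phi>)) \<and>
     u ` fv \<Phi> \<subseteq> (\<Union>(\<phi>, v)\<in>S. v ` fv \<phi>)"
    using insert.prems by (intro insert.IH) blast
  then obtain \<Phi> and u :: "nat \<Rightarrow> 'c" where IH: "wf_fm L \<Phi>"
    "\<forall>(M :: ('f, 'p, 'm) struct) \<nu>. sat M (\<lambda>n. \<nu> (u n)) \<Phi> \<longleftrightarrow> (\<forall>(\<phi>, v)\<in>S. sat M (\<lambda>n. \<nu> (v n)) \<phi>)"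
    "u ` fv \<Phi> \<subseteq> (\<Union>(\<phi>, v)\<in>S. v ` fv \<phi>)" by (elim exE conjE) 
  \<comment> \<open>Even variables carry \<open>\<phi>\<close> and odd ones \<open>\<Phi>\<close>,
    so two labellings that disagree on a variable merge without a clash.\<close>
  let ?w = "\<lambda>n. if even n then v (n div 2) else u (n div 2)"
  let ?\<Psi> = "And (ren (\<lambda>n. 2 * n) \<phi>) (ren (\<lambda>n. 2 * n + 1) \<Phi>)"
  have w: "?w \<circ> (\<lambda>n. 2 * n) = v" "?w \<circ> (\<lambda>n. 2 * n + 1) = u" by (simp_all add: fun_eq_iff)
  have "sat M (\<lambda>n. \<nu> (?w n)) ?\<Psi> \<longleftrightarrow> (\<forall>(\<phi>, v)\<in>insert p S. sat M (\<lambda>n. \<nu> (v n)) \<phi>)"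
    for M :: "('f, 'p, 'm) struct" and \<nu>
  proof -
    have "sat M (\<lambda>n. \<nu> (?w n)) ?\<Psi> \<longleftrightarrow> sat M (\<lambda>n. \<nu> (v n)) \<phi> \<and> sat M (\<lambda>n. \<nu> (u n)) \<Phi>"
      by simp
    also have "sat M (\<lambda>n. \<nu> (u n)) \<Phi> \<longleftrightarrow> (\<forall>(\<phi>, v)\<in>S. sat M (\<lambda>n. \<nu> (v n)) \<phi>)"
      by (rule IH(2)[rule_format])
    finally show ?thesis by (simp add: p)
  qed
  moreover have "wf_fm L ?\<Psi>" using IH(1) insert.prems p by auto
  moreover have "?w ` fv ?\<Psi> \<subseteq> (\<Union>(\<phi>, v)\<in>insert p S. v ` fv \<phi>)"
  proof -
    have "?w ` fv ?\<Psi> = v ` fv \<phi> \<union> u ` fv \<Phi>"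
      unfolding fv.simps fv_ren image_Un image_comp w ..
    moreover have "(\<Union>(\<phi>, v)\<in>insert p S. v ` fv \<phi>) = v ` fv \<phi> \<union> (\<Union>(\<phi>, v)\<in>S. v ` fv \<phi>)"
      by (simp add: p)
    ultimately show ?thesis using IH(3) by (simp only: Un_mono order_refl)
  qed
  ultimately show ?case by (intro exI[of _ ?\<Psi>] exI[of _ ?w] conjI allI)
qed

section \<open>Ultrapowers\<close>

text \<open>The two clauses are what the induction for \<open>Los\<close> uses at \<open>And\<close>
  and \<open>Neg\<close>. Upward closure and the absence of the empty set follow from them.\<close>

definition ultra :: "'i set set \<Rightarrow> bool" where
  "ultra U \<longleftrightarrow> (\<forall>A B. A \<inter> B \<in> U \<longleftrightarrow> A \<in> U \<and> B \<in> U) \<and> (\<forall>A. - A \<in> U \<longleftrightarrow> A \<notin> U)"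

definition fip :: "'i set set \<Rightarrow> bool" where
  "fip G \<longleftrightarrow> (\<forall>F. finite F \<and> F \<subseteq> G \<longrightarrow> \<Inter>F \<noteq> {})"

text \<open>A maximal family with the finite intersection property is an ultrafilter. Zorn's lemma
  applies because finitely many members of the union of a chain already lie in one member of the
  chain.\<close>

lemma ultra_exists:
  assumes "fip G"
  obtains U where "G \<subseteq> U" "ultra U"
proof -
  let ?C = "{H. G \<subseteq> H \<and> fip H}"
  have "\<exists>M\<in>?C. \<forall>X\<in>?C. M \<subseteq> X \<longrightarrow> X = M"
  proof (rule subset_Zorn_nonempty)
    show "?C \<noteq> {}" using assms by auto
  next
    fix C assume C: "C \<noteq> {}" "subset.chain ?C C"
    have "fip (\<Union>C)"
      unfolding fip_def
    proof (intro allI impI)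
      fix F assume F: "finite F \<and> F \<subseteq> \<Union>C"
      then obtain H where "H \<in> C" "F \<subseteq> H"
        using C finite_subset_Union_chain[of F C ?C] by auto
      then show "\<Inter>F \<noteq> {}" using C F by (auto simp: subset.chain_def fip_def)
    qed
    moreover obtain H where "H \<in> C" "G \<subseteq> H" using C by (auto simp: subset.chain_def)
    ultimately show "\<Union>C \<in> ?C" by auto
  qed
  then obtain U where "U \<in> ?C" and max': "\<forall>X\<in>?C. U \<subseteq> X \<longrightarrow> X = U" by (rule bexE)
  then have U: "G \<subseteq> U" "fip U" by auto
  have max: "X = U" if "G \<subseteq> X" "fip X" "U \<subseteq> X" for X using max' that by simp
  \<comment> \<open>Maximality in usable form: a set that meets all finite intersections of members
    of \<open>U\<close> could be adjoined, so it already belongs to \<open>U\<close>.\<close>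
  have mem: "A \<in> U" if "\<And>F. finite F \<Longrightarrow> F \<subseteq> U \<Longrightarrow> A \<inter> \<Inter>F \<noteq> {}" for A
  proof -
    have "\<Inter>F \<noteq> {}" if F: "finite F" "F \<subseteq> insert A U" for F
    proof -
      have "A \<inter> \<Inter>(F - {A}) \<noteq> {}" using F \<open>\<And>F. finite F \<Longrightarrow> F \<subseteq> U \<Longrightarrow> A \<inter> \<Inter>F \<noteq> {}\<close>[of "F - {A}"] by auto
      then show ?thesis by auto
    qed
    then have "fip (insert A U)" unfolding fip_def by simp
    with U have "insert A U = U" by (intro max) auto
    then show ?thesis by auto
  qed
  have fin: "\<Inter>F \<noteq> {}" if "finite F" "F \<subseteq> U" for F using U that by (auto simp: fip_def)
  have int: "A \<inter> B \<in> U" if "A \<in> U" "B \<in> U" for A B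
  proof (rule mem)
    fix F assume "finite F" "F \<subseteq> U"
    with fin[of "insert A (insert B F)"] that show "A \<inter> B \<inter> \<Inter>F \<noteq> {}" by (auto simp: Int_assoc)
  qed
  have up: "B \<in> U" if "A \<in> U" "A \<subseteq> B" for A B
  proof (rule mem)
    fix F assume "finite F" "F \<subseteq> U"
    with fin[of "insert A F"] that show "B \<inter> \<Inter>F \<noteq> {}" by auto
  qed
  have Int_mem: "\<Inter>F \<in> U" if "finite F" "F \<subseteq> U" for F
  proof (rule mem)
    fix F' assume "finite F'" "F' \<subseteq> U"
    with fin[of "F \<union> F'"] that show "\<Inter>F \<inter> \<Inter>F' \<noteq> {}" by auto
  qed
  have "- A \<in> U \<longleftrightarrow> A \<notin> U" for A
  proof
    assume "- A \<in> U"
    then show "A \<notin> U" using fin[of "{A, - A}"] by fastforce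
  next
    assume "A \<notin> U"
    with mem[of A] have "\<exists>F. finite F \<and> F \<subseteq> U \<and> A \<inter> \<Inter>F = {}" by fast
    then obtain F where F: "finite F" "F \<subseteq> U" "A \<inter> \<Inter>F = {}" by fast
    then have "\<Inter>F \<subseteq> - A" by blast
    with Int_mem[OF F(1,2)] show "- A \<in> U" by (rule up)
  qed
  moreover have "A \<inter> B \<in> U \<longleftrightarrow> A \<in> U \<and> B \<in> U" for A B
    using int[of A B] up[of "A \<inter> B" A] up[of "A \<inter> B" B] by (meson inf_le1 inf_le2)
  ultimately have "ultra U" unfolding ultra_def by auto
  with U(1) show thesis by (rule that)
qed

locale ultrapower =
  fixes L :: "('f, 'p) lang" and M :: "('f, 'p, 'm) struct" and U :: "'i set set"
  assumes str: "is_struct L M" and ultra: "ultra U"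
begin

lemma U_int: "A \<in> U \<Longrightarrow> B \<in> U \<Longrightarrow> A \<inter> B \<in> U"
  using ultra by (auto simp: ultra_def)

lemma U_up: "A \<in> U \<Longrightarrow> A \<subseteq> B \<Longrightarrow> B \<in> U"
  using ultra unfolding ultra_def by (metis Int_absorb2)

lemma U_UNIV: "UNIV \<in> U"
  using ultra U_up[of "{}" UNIV] unfolding ultra_def by (metis Compl_UNIV_eq subset_UNIV)

lemma U_compl: "- A \<in> U \<longleftrightarrow> A \<notin> U"
  using ultra by (auto simp: ultra_def)

lemma U_cong: "{i. P i = Q i} \<in> U \<Longrightarrow> {i. P i} \<in> U \<longleftrightarrow> {i. Q i} \<in> U"
proof -
  assume *: "{i. P i = Q i} \<in> U"
  show ?thesis
  proof
    assume "{i. P i} \<in> U" from U_int[OF * this] show "{i. Q i} \<in> U" by (rule U_up) auto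
  next
    assume "{i. Q i} \<in> U" from U_int[OF * this] show "{i. P i} \<in> U" by (rule U_up) auto
  qed
qed

lemma U_list:
  assumes "\<And>x. x \<in> set xs \<Longrightarrow> {i. P x i} \<in> U"
  shows "{i. \<forall>x\<in>set xs. P x i} \<in> U"
  using assms
proof (induction xs)
  case (Cons x xs)
  then have "{i. P x i} \<inter> {i. \<forall>x\<in>set xs. P x i} \<in> U" by (intro U_int) auto
  then show ?case by (rule U_up) auto
qed (auto simp: U_UNIV)

text \<open>A choice from the class of \<open>g\<close> modulo \<open>U\<close>. Chosen functions
  instead of classes keep the ultrapower on a plain function type and turn equality modulo
  \<open>U\<close> into ordinary equality.\<close>

definition rep :: "('i \<Rightarrow> 'm) \<Rightarrow> 'i \<Rightarrow> 'm" where
  "rep g = (SOME h. range h \<subseteq> univ M \<and> {i. g i = h i} \<in> U)"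

definition Up :: "('f, 'p, 'i \<Rightarrow> 'm) struct" where
  "Up = \<lparr> univ = {rep g | g. range g \<subseteq> univ M},
          fint = (\<lambda>f xs. rep (\<lambda>i. fint M f (map (\<lambda>x. x i) xs))),
          rint = (\<lambda>p xs. {i. rint M p (map (\<lambda>x. x i) xs)} \<in> U) \<rparr>"

lemma rep: "range g \<subseteq> univ M \<Longrightarrow> range (rep g) \<subseteq> univ M \<and> {i. g i = rep g i} \<in> U"
  unfolding rep_def by (rule someI[of _ g]) (auto simp: U_UNIV)

lemma rep_eqI: "{i. g i = h i} \<in> U \<Longrightarrow> rep g = rep h"
proof -
  assume *: "{i. g i = h i} \<in> U"
  have "{i. g i = k i} \<in> U \<longleftrightarrow> {i. h i = k i} \<in> U" for k
    by (rule U_cong, rule U_up[OF *]) auto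
  then show ?thesis unfolding rep_def by simp
qed

lemma rep_rep: "range g \<subseteq> univ M \<Longrightarrow> rep (rep g) = rep g"
  using rep[of g] by (intro rep_eqI[symmetric]) auto

lemma univ_Up: "x \<in> univ Up \<longleftrightarrow> range x \<subseteq> univ M \<and> rep x = x"
proof
  assume "x \<in> univ Up"
  then obtain g where "range g \<subseteq> univ M" "x = rep g" by (auto simp: Up_def)
  then show "range x \<subseteq> univ M \<and> rep x = x" using rep[of g] rep_rep[of g] by simp
next
  assume "range x \<subseteq> univ M \<and> rep x = x"
  then have "x = rep x" "range x \<subseteq> univ M" by auto
  then show "x \<in> univ Up" unfolding Up_def by auto
qed

lemma rep_in_Up: "range g \<subseteq> univ M \<Longrightarrow> rep g \<in> univ Up"
  by (auto simp: Up_def)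

lemma Up_eqI: "x \<in> univ Up \<Longrightarrow> y \<in> univ Up \<Longrightarrow> {i. x i = y i} \<in> U \<longleftrightarrow> x = y"
  using rep_eqI[of x y] by (auto simp: univ_Up U_UNIV)

lemma rep_at: "range g \<subseteq> univ M \<Longrightarrow> {i. rep g i = g i} \<in> U"
  using rep[of g] by (simp add: eq_commute)

lemma struct_Up: "is_struct L Up"
  unfolding is_struct_def
proof (intro conjI ballI)
  obtain a where "a \<in> univ M" using str by (auto simp: is_struct_def)
  then have "rep (\<lambda>_. a) \<in> univ Up" by (intro rep_in_Up) auto
  then show "univ Up \<noteq> {}" by auto
next
  fix fn assume fn: "fn \<in> funs L"
  obtain f n where f: "fn = (f, n)" by (cases fn)
  have "fint Up f xs \<in> univ Up" if "xs \<in> tuples n (univ Up)" for xs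
  proof -
    have "map (\<lambda>x. x i) xs \<in> tuples n (univ M)" for i
      using that by (fastforce simp: tuples_def univ_Up)
    then have "range (\<lambda>i. fint M f (map (\<lambda>x. x i) xs)) \<subseteq> univ M"
      using str fn f by (fastforce simp: is_struct_def)
    then show ?thesis using rep_in_Up by (simp add: Up_def)
  qed
  with f show "case fn of (f, n) \<Rightarrow> \<forall>xs\<in>tuples n (univ Up). fint Up f xs \<in> univ Up" by simp
qed

lemma eval_Up:
  assumes "range e \<subseteq> univ Up" "wf_tm L t"
  shows "{i. eval_tm Up e t i = eval_tm M (\<lambda>n. e n i) t} \<in> U"
  using assms(2)
proof (induction t)
  case (Var n) then show ?case by (simp add: U_UNIV)
next
  case (Fn f ts)
  let ?g = "\<lambda>i. fint M f (map (\<lambda>x. x i) (map (eval_tm Up e) ts))"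
  have 1: "{i. \<forall>t\<in>set ts. eval_tm Up e t i = eval_tm M (\<lambda>n. e n i) t} \<in> U"
    using Fn by (intro U_list) (auto simp: list_all_iff)
  have "eval_tm Up e t \<in> univ Up" if "t \<in> set ts" for t
    using that Fn.prems assms(1) by (intro eval_tm_in_univ[OF struct_Up]) (auto simp: list_all_iff)
  then have "map (\<lambda>x. x i) (map (eval_tm Up e) ts) \<in> tuples (length ts) (univ M)" for i
    by (fastforce simp: tuples_def univ_Up)
  then have "range ?g \<subseteq> univ M"
    using str Fn.prems by (fastforce simp: is_struct_def)
  from U_int[OF 1 rep_at[OF this]] show ?case
  proof (rule U_up, safe)
    fix i assume *: "\<forall>t\<in>set ts. eval_tm Up e t i = eval_tm M (\<lambda>n. e n i) t" "rep ?g i = ?g i"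
    have "eval_tm Up e (Fn f ts) i = rep ?g i" by (simp add: Up_def)
    also have "\<dots> = ?g i" by (rule *(2))
    also have "map (\<lambda>x. x i) (map (eval_tm Up e) ts) = map (eval_tm M (\<lambda>n. e n i)) ts"
      using *(1) by simp
    finally show "eval_tm Up e (Fn f ts) i = eval_tm M (\<lambda>n. e n i) (Fn f ts)"
      by simp
  qed
qed

theorem Los:
  assumes "range e \<subseteq> univ Up" "wf_fm L \<phi>"
  shows "sat Up e \<phi> \<longleftrightarrow> {i. sat M (\<lambda>n. e n i) \<phi>} \<in> U"
  using assms
proof (induction \<phi> arbitrary: e)
  case (Eq s t)
  have s: "eval_tm Up e s \<in> univ Up" "eval_tm Up e t \<in> univ Up"
    using Eq by (auto intro!: eval_tm_in_univ[OF struct_Up])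
  have "{i. eval_tm Up e s i = eval_tm M (\<lambda>n. e n i) s} \<inter> {i. eval_tm Up e t i = eval_tm M (\<lambda>n. e n i) t} \<in> U"
    using Eq by (intro U_int eval_Up) auto
  then have "{i. eval_tm Up e s i = eval_tm Up e t i} \<in> U \<longleftrightarrow> {i. sat M (\<lambda>n. e n i) (Eq s t)} \<in> U"
    by (intro U_cong, elim U_up) auto
  then show ?case using Up_eqI[OF s] by simp
next
  case (Rel p ts)
  have "{i. \<forall>t\<in>set ts. eval_tm Up e t i = eval_tm M (\<lambda>n. e n i) t} \<in> U"
    using Rel by (intro U_list eval_Up) (auto simp: list_all_iff)
  then have "{i. rint M p (map (\<lambda>x. x i) (map (eval_tm Up e) ts))} \<in> U \<longleftrightarrow>
      {i. sat M (\<lambda>n. e n i) (Rel p ts)} \<in> U"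
  proof (intro U_cong, elim U_up, intro subsetI CollectI)
    fix i assume "i \<in> {i. \<forall>t\<in>set ts. eval_tm Up e t i = eval_tm M (\<lambda>n. e n i) t}"
    then have "map (\<lambda>x. x i) (map (eval_tm Up e) ts) = map (eval_tm M (\<lambda>n. e n i)) ts" by simp
    then show "rint M p (map (\<lambda>x. x i) (map (eval_tm Up e) ts)) = sat M (\<lambda>n. e n i) (Rel p ts)"
      by (simp del: map_map)
  qed
  then show ?case by (simp add: Up_def)
next
  case (Neg \<phi>)
  then show ?case using U_compl[of "{i. sat M (\<lambda>n. e n i) \<phi>}"] by (simp add: Collect_neg_eq)
next
  case (And \<phi> \<psi>)
  then show ?case using ultra by (simp add: Collect_conj_eq ultra_def)
next
  case (Exists x \<phi>)
  have IH: "sat Up (e(x := a)) \<phi> \<longleftrightarrow> {i. sat M ((\<lambda>n. e n i)(x := a i)) \<phi>} \<in> U" if "a \<in> univ Up" for a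
  proof -
    have "(\<lambda>n. (e(x := a)) n i) = (\<lambda>n. e n i)(x := a i)" for i by auto
    then have eq: "{i. sat M (\<lambda>n. (e(x := a)) n i) \<phi>} = {i. sat M ((\<lambda>n. e n i)(x := a i)) \<phi>}"
      by (simp only:)
    have "range (e(x := a)) \<subseteq> univ Up" using Exists.prems(1) that by (auto simp: image_subset_iff)
    moreover have "wf_fm L \<phi>" using Exists.prems(2) by simp
    ultimately have "sat Up (e(x := a)) \<phi> \<longleftrightarrow> {i. sat M (\<lambda>n. (e(x := a)) n i) \<phi>} \<in> U"
      by (rule Exists.IH)
    then show ?thesis unfolding eq .
  qed
  show ?case
  proof
    assume "sat Up e (Exists x \<phi>)"
    then obtain a where a: "a \<in> univ Up" "sat Up (e(x := a)) \<phi>" by auto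
    from a(2) have "{i. sat M ((\<lambda>n. e n i)(x := a i)) \<phi>} \<in> U" unfolding IH[OF a(1)] .
    then show "{i. sat M (\<lambda>n. e n i) (Exists x \<phi>)} \<in> U"
      by (rule U_up) (use a in \<open>auto simp: univ_Up\<close>)
  next
    assume A: "{i. sat M (\<lambda>n. e n i) (Exists x \<phi>)} \<in> U"
    obtain a0 where a0: "a0 \<in> univ M" using str by (auto simp: is_struct_def)
    \<comment> \<open>The default \<open>a0\<close> only keeps \<open>g\<close> inside the universe;
      the indices without a witness form a set outside \<open>U\<close>.\<close>
    define g where "g i = (if sat M (\<lambda>n. e n i) (Exists x \<phi>)
        then SOME a. a \<in> univ M \<and> sat M ((\<lambda>n. e n i)(x := a)) \<phi> else a0)" for i
    have g: "g i \<in> univ M \<and> (sat M (\<lambda>n. e n i) (Exists x \<phi>) \<longrightarrow> sat M ((\<lambda>n. e n i)(x := g i)) \<phi>)" for i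
    proof (cases "sat M (\<lambda>n. e n i) (Exists x \<phi>)")
      case True
      then have "\<exists>a. a \<in> univ M \<and> sat M ((\<lambda>n. e n i)(x := a)) \<phi>" by auto
      from someI_ex[OF this] True show ?thesis by (simp add: g_def)
    qed (use a0 in \<open>simp add: g_def\<close>)
    then have r: "range g \<subseteq> univ M" by auto
    have "{i. sat M ((\<lambda>n. e n i)(x := rep g i)) \<phi>} \<in> U"
      using U_int[OF A rep_at[OF r]]
    proof (rule U_up, intro subsetI CollectI)
      fix i assume "i \<in> {i. sat M (\<lambda>n. e n i) (Exists x \<phi>)} \<inter> {i. rep g i = g i}"
      then have "rep g i = g i" "sat M (\<lambda>n. e n i) (Exists x \<phi>)" by blast+
      with g[of i] show "sat M ((\<lambda>n. e n i)(x := rep g i)) \<phi>" by (simp only: simp_thms)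
    qed
    then have "sat Up (e(x := rep g)) \<phi>" unfolding IH[OF rep_in_Up[OF r]] .
    then show "sat Up e (Exists x \<phi>)" unfolding sat.simps using rep_in_Up[OF r] by (rule bexI)
  qed
qed

end

section \<open>Downward Loewenheim-Skolem\<close>

lemma lepoll_iff_card_of: "A \<lesssim> B \<longleftrightarrow> (card_of A, card_of B) \<in> ordLeq"
  unfolding lepoll_def by (rule card_of_ordLeq)

lemma Times_lepoll_infinite:
  assumes "infinite C" "A \<lesssim> C" "B \<lesssim> C"
  shows "A \<times> B \<lesssim> C"
  using card_of_Times_ordLeq_infinite_Field[of "card_of C" A B] assms
  by (simp add: lepoll_iff_card_of Field_card_of card_of_card_order_on)

lemma Un_lepoll_infinite:
  assumes "infinite C" "A \<lesssim> C" "B \<lesssim> C"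
  shows "A \<union> B \<lesssim> C"
  using card_of_Un_ordLeq_infinite_Field[of "card_of C" A B] assms
  by (simp add: lepoll_iff_card_of Field_card_of card_of_card_order_on)

lemma UN_nat_lepoll_infinite:
  assumes "infinite C" "\<And>n :: nat. A n \<lesssim> C"
  shows "(\<Union>n. A n) \<lesssim> C"
proof -
  have "(card_of (UNIV :: nat set), card_of C) \<in> ordLeq" using assms(1) by (simp add: infinite_iff_card_of_nat)
  moreover have "(card_of (A n), card_of C) \<in> ordLeq" for n using assms(2)[of n] by (simp add: lepoll_iff_card_of)
  ultimately have "(card_of (\<Union>n\<in>UNIV. A n), card_of C) \<in> ordLeq"
    by (intro card_of_UNION_ordLeq_infinite[OF assms(1)]) auto
  then show ?thesis by (simp add: lepoll_iff_card_of)
qed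

lemma lists_lepoll_infinite:
  assumes "infinite C" "A \<lesssim> C"
  shows "lists A \<lesssim> C"
proof -
  let ?l = "\<lambda>n. {xs \<in> lists A. length xs = n}"
  have l: "?l n \<lesssim> C" for n
  proof (induction n)
    case 0
    have l0: "?l 0 = {[]}" by auto
    show ?case unfolding l0 using assms(1) by (simp add: finite_lepoll_infinite)
  next
    case (Suc n)
    have "?l (Suc n) \<subseteq> (\<lambda>(x, xs). x # xs) ` (A \<times> ?l n)"
      by (auto simp: length_Suc_conv image_iff)
    then have "?l (Suc n) \<lesssim> A \<times> ?l n" by (rule subset_image_lepoll)
    also have "A \<times> ?l n \<lesssim> C" using assms Suc by (rule Times_lepoll_infinite)
    finally show ?case .
  qed
  have "(\<Union>n. ?l n) \<lesssim> C" using assms(1) l by (rule UN_nat_lepoll_infinite)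
  moreover have "(\<Union>n. ?l n) = lists A" by auto
  ultimately show ?thesis by simp
qed

text \<open>Whatever the language, the equations \<open>Eq (Var n) (Var n)\<close> are infinitely
  many formulas.\<close>

lemma large_infinite:
  fixes L :: "('f, 'p) lang"
  assumes "{\<phi>. wf_fm L \<phi>} \<lesssim> C"
  shows "infinite C"
proof -
  have "(UNIV :: nat set) \<lesssim> {\<phi>. wf_fm L \<phi>}"
    unfolding lepoll_def by (rule exI[of _ "\<lambda>n. Eq (Var n) (Var n)"]) (auto simp: inj_on_def)
  with assms show ?thesis using lepoll_trans infinite_le_lepoll by blast
qed

text \<open>Truth in the substructure could differ only at quantifiers, where \<open>tv\<close>
  supplies the witness. Closure under a function symbol is the instance of \<open>tv\<close> for the
  graph of the function.\<close>

lemma Tarski_Vaught: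
  assumes str: "is_struct L W" and S: "S \<subseteq> univ W" "S \<noteq> {}"
    and tv: "\<And>\<phi> x e. wf_fm L \<phi> \<Longrightarrow> range e \<subseteq> S \<Longrightarrow> \<exists>a\<in>univ W. sat W (e(x := a)) \<phi> \<Longrightarrow>
               \<exists>a\<in>S. sat W (e(x := a)) \<phi>"
  shows "is_struct L (W\<lparr>univ := S\<rparr>)"
    and "wf_fm L \<phi> \<Longrightarrow> range e \<subseteq> S \<Longrightarrow> sat (W\<lparr>univ := S\<rparr>) e \<phi> = sat W e \<phi>"
proof -
  have "fint W f xs \<in> S" if f: "(f, n) \<in> funs L" "xs \<in> tuples n S" for f n xs
  proof -
    obtain s where s: "s \<in> S" using S by auto
    let ?e = "\<lambda>i. if i < n then xs ! i else s"
    let ?\<phi> = "Eq (Fn f (map Var [0..<n])) (Var n) :: ('a, 'b) fm"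
    have "fint W f xs \<in> univ W" using str f S by (fastforce simp: is_struct_def tuples_def)
    moreover have xs: "map (\<lambda>i. if i = n then a else ?e i) [0..<n] = xs" for a
      using f by (intro nth_equalityI) (auto simp: tuples_def)
    ultimately have "\<exists>a\<in>univ W. sat W (?e(n := a)) ?\<phi>"
      by (intro bexI[of _ "fint W f xs"]) (auto simp: comp_def fun_upd_def)
    moreover have "range ?e \<subseteq> S" using f s by (auto simp: tuples_def)
    ultimately have "\<exists>a\<in>S. sat W (?e(n := a)) ?\<phi>"
      using f by (intro tv) (auto simp: list_all_iff)
    then show ?thesis using xs by (auto simp: comp_def fun_upd_def)
  qed
  then show "is_struct L (W\<lparr>univ := S\<rparr>)" using S by (auto simp: is_struct_def)
  have ev: "eval_tm (W\<lparr>univ := S\<rparr>) e t = eval_tm W e t" for e t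
  proof (induction t)
    case (Fn f ts)
    then have "map (eval_tm (W\<lparr>univ := S\<rparr>) e) ts = map (eval_tm W e) ts" by simp
    then show ?case by (simp del: map_eq_conv)
  qed simp
  then have evs: "eval_tm (W\<lparr>univ := S\<rparr>) e = eval_tm W e" for e by auto
  show "sat (W\<lparr>univ := S\<rparr>) e \<phi> = sat W e \<phi>" if "wf_fm L \<phi>" "range e \<subseteq> S"
    using that
  proof (induction \<phi> arbitrary: e)
    case (Exists x \<phi>)
    have IH: "sat (W\<lparr>univ := S\<rparr>) (e(x := a)) \<phi> = sat W (e(x := a)) \<phi>" if "a \<in> S" for a
      using Exists.prems that by (intro Exists.IH) auto
    have "(\<exists>a\<in>S. sat W (e(x := a)) \<phi>) \<longleftrightarrow> (\<exists>a\<in>univ W. sat W (e(x := a)) \<phi>)"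
      using tv[of \<phi> e x] Exists.prems S by auto
    then show ?case using IH by simp
  qed (simp_all add: evs)
qed

text \<open>Close \<open>A\<close> under chosen witnesses in countably many rounds. A formula sees
  only finitely many values of an assignment, so finite lists of parameters suffice, and this keeps
  every round within the cardinality of \<open>'m\<close>.\<close>

lemma Loewenheim_Skolem:
  fixes L :: "('f, 'p) lang" and W :: "('f, 'p, 'a) struct"
  assumes str: "is_struct L W" and A: "A \<subseteq> univ W" "A \<lesssim> (UNIV :: 'm set)"
    and large: "{\<phi>. wf_fm L \<phi>} \<lesssim> (UNIV :: 'm set)"
  shows "\<exists>S. A \<subseteq> S \<and> S \<subseteq> univ W \<and> S \<lesssim> (UNIV :: 'm set) \<and> is_struct L (W\<lparr>univ := S\<rparr>) \<and>
    (\<forall>\<phi> e. wf_fm L \<phi> \<and> range e \<subseteq> S \<longrightarrow> sat (W\<lparr>univ := S\<rparr>) e \<phi> = sat W e \<phi>)"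
proof -
  let ?m = "UNIV :: 'm set"
  have inf: "infinite ?m" using large_infinite[OF large] .
  obtain s where s: "s \<in> univ W" using str by (auto simp: is_struct_def)
  \<comment> \<open>Lists are completed to assignments by the fixed element \<open>s\<close>; the
    list used for a formula will cover all its free variables.\<close>
  define env where "env xs = (\<lambda>n. if n < length xs then xs ! n else s)" for xs
  define wit where "wit = (\<lambda>(\<phi>, x, xs). SOME a. a \<in> univ W \<and>
      ((\<exists>a\<in>univ W. sat W ((env xs)(x := a)) \<phi>) \<longrightarrow> sat W ((env xs)(x := a)) \<phi>))"
  have wit: "wit (\<phi>, x, xs) \<in> univ W \<and> ((\<exists>a\<in>univ W. sat W ((env xs)(x := a)) \<phi>) \<longrightarrow>
      sat W ((env xs)(x := wit (\<phi>, x, xs))) \<phi>)" for \<phi> x xs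
    unfolding wit_def prod.case by (rule someI_ex) (use s in blast)
  define stp where "stp B = B \<union> wit ` ({\<phi>. wf_fm L \<phi>} \<times> (UNIV :: nat set) \<times> lists B)" for B
  define H where "H n = (stp ^^ n) (insert s A)" for n
  have H0: "H 0 = insert s A" and HS: "H (Suc n) = stp (H n)" for n by (simp_all add: H_def)
  have card: "H n \<lesssim> ?m" for n
  proof (induction n)
    case 0
    have "{s} \<union> A \<lesssim> ?m"
      using finite_lepoll_infinite[OF inf, of "{s}"] A(2) by (intro Un_lepoll_infinite[OF inf]) auto
    then show ?case by (simp add: H0)
  next
    case (Suc n)
    have nat: "(UNIV :: nat set) \<lesssim> ?m" using inf infinite_le_lepoll by blast
    have "{\<phi>. wf_fm L \<phi>} \<times> (UNIV :: nat set) \<times> lists (H n) \<lesssim> ?m"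
      by (intro Times_lepoll_infinite[OF inf] large nat lists_lepoll_infinite[OF inf] Suc)
    then have "wit ` ({\<phi>. wf_fm L \<phi>} \<times> (UNIV :: nat set) \<times> lists (H n)) \<lesssim> ?m"
      using image_lepoll lepoll_trans by blast
    then show ?case unfolding HS stp_def by (intro Un_lepoll_infinite[OF inf] Suc)
  qed
  let ?S = "\<Union>n. H n"
  have sub: "H n \<subseteq> univ W" for n
  proof (induction n)
    case 0 then show ?case using s A by (simp add: H0)
  next
    case (Suc n)
    then show ?case using wit unfolding HS stp_def by auto
  qed
  have mono: "H m \<subseteq> H n" if "m \<le> n" for m n
    using that by (rule lift_Suc_mono_le[rotated]) (auto simp: HS stp_def)
  have tv: "\<exists>a\<in>?S. sat W (e(x := a)) \<phi>"
    if "wf_fm L \<phi>" "range e \<subseteq> ?S" "\<exists>a\<in>univ W. sat W (e(x := a)) \<phi>" for \<phi> x e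
  proof -
    define k where "k = fresh (fv \<phi>)"
    define xs where "xs = map e [0..<k]"
    have "\<exists>n. set ys \<subseteq> H n" if "set ys \<subseteq> ?S" for ys
      using that
    proof (induction ys)
      case (Cons y ys)
      then obtain n m where "y \<in> H n" "set ys \<subseteq> H m" by auto
      then have "set (y # ys) \<subseteq> H (max n m)" using mono[of n "max n m"] mono[of m "max n m"] by auto
      then show ?case by blast
    qed simp
    moreover have "set xs \<subseteq> ?S" using that(2) by (auto simp: xs_def)
    ultimately obtain n where n: "set xs \<subseteq> H n" by blast
    have eq: "sat W (e(x := a)) \<phi> = sat W ((env xs)(x := a)) \<phi>" for a
      by (rule sat_cong) (auto simp: env_def xs_def k_def dest: fresh[OF finite_fv])
    have "wit (\<phi>, x, xs) \<in> H (Suc n)"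
      using that(1) n unfolding HS stp_def by (intro UnI2 imageI) auto
    moreover have "sat W (e(x := wit (\<phi>, x, xs))) \<phi>"
      using wit[of \<phi> x xs] that(3) unfolding eq by blast
    ultimately show ?thesis by blast
  qed
  have "?S \<subseteq> univ W" "?S \<noteq> {}" using sub H0 by blast+
  note TV = Tarski_Vaught[OF str this tv]
  have "A \<subseteq> ?S" using H0 by blast
  moreover have "?S \<lesssim> ?m" using card by (rule UN_nat_lepoll_infinite[OF inf])
  ultimately show ?thesis using TV \<open>?S \<subseteq> univ W\<close> by (intro exI[of _ ?S]) simp
qed

section \<open>Elementary embeddings\<close>

text \<open>The universes may lie in different types and \<open>j\<close> need not be an inclusion,
  since extensions are built on one type and then moved to another.\<close>

definition elem :: "('f, 'p) lang \<Rightarrow> ('f, 'p, 'a) struct \<Rightarrow> ('f, 'p, 'b) struct \<Rightarrow> ('a \<Rightarrow> 'b) \<Rightarrow> bool" where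
  "elem L M N j \<longleftrightarrow> j ` univ M \<subseteq> univ N \<and>
     (\<forall>\<phi> e. wf_fm L \<phi> \<and> range e \<subseteq> univ M \<longrightarrow> sat M e \<phi> = sat N (\<lambda>n. j (e n)) \<phi>)"

lemma isomorphism_elem:
  assumes str: "is_struct L M" and inj: "inj_on h (univ M)" and img: "h ` univ M = univ N"
    and fint: "\<And>f n xs. (f, n) \<in> funs L \<Longrightarrow> xs \<in> tuples n (univ M) \<Longrightarrow> h (fint M f xs) = fint N f (map h xs)"
    and rint: "\<And>p n xs. (p, n) \<in> rels L \<Longrightarrow> xs \<in> tuples n (univ M) \<Longrightarrow> rint M p xs = rint N p (map h xs)"
  shows "elem L M N h"
  unfolding elem_def
proof (intro conjI allI impI)
  show "h ` univ M \<subseteq> univ N" using img by simp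
  have ev: "eval_tm N (\<lambda>n. h (e n)) t = h (eval_tm M e t)" if "range e \<subseteq> univ M" "wf_tm L t" for e t
    using that(2)
  proof (induction t)
    case (Fn g ts)
    have "map (eval_tm N (\<lambda>n. h (e n))) ts = map h (map (eval_tm M e) ts)"
      using Fn by (auto simp: list_all_iff)
    moreover have "map (eval_tm M e) ts \<in> tuples (length ts) (univ M)"
      using Fn.prems that(1) by (auto simp: tuples_def list_all_iff intro!: eval_tm_in_univ[OF str])
    ultimately show ?case
      using fint[of g "length ts" "map (eval_tm M e) ts"] Fn.prems by (simp del: map_map)
  qed simp
  fix \<phi> and e :: "nat \<Rightarrow> 'c" assume "wf_fm L \<phi> \<and> range e \<subseteq> univ M"
  then show "sat M e \<phi> = sat N (\<lambda>n. h (e n)) \<phi>"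
  proof (induction \<phi> arbitrary: e)
    case (Eq s t)
    then have "eval_tm M e s \<in> univ M" "eval_tm M e t \<in> univ M"
      by (auto intro!: eval_tm_in_univ[OF str])
    then show ?case using Eq ev inj by (simp add: inj_on_eq_iff)
  next
    case (Rel p ts)
    have "map (eval_tm N (\<lambda>n. h (e n))) ts = map h (map (eval_tm M e) ts)"
      using Rel ev by (auto simp: list_all_iff)
    moreover have "map (eval_tm M e) ts \<in> tuples (length ts) (univ M)"
      using Rel by (auto simp: tuples_def list_all_iff intro!: eval_tm_in_univ[OF str])
    ultimately show ?case
      using rint[of p "length ts" "map (eval_tm M e) ts"] Rel.prems by (simp del: map_map)
  next
    case (Neg \<phi>)
    then show ?case by simp
  next
    case (And \<phi> \<psi>)
    then show ?case by simp
  next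
    case (Exists x \<phi>)
    have "sat M (e(x := a)) \<phi> = sat N ((\<lambda>n. h (e n))(x := h a)) \<phi>" if "a \<in> univ M" for a
    proof -
      have "wf_fm L \<phi> \<and> range (e(x := a)) \<subseteq> univ M" using Exists.prems that by auto
      then have "sat M (e(x := a)) \<phi> = sat N (\<lambda>n. h ((e(x := a)) n)) \<phi>" by (rule Exists.IH)
      moreover have "(\<lambda>n. h ((e(x := a)) n)) = (\<lambda>n. h (e n))(x := h a)" by auto
      ultimately show ?thesis by (simp only:)
    qed
    then have "(\<exists>a\<in>univ M. sat M (e(x := a)) \<phi>) \<longleftrightarrow> (\<exists>a\<in>h ` univ M. sat N ((\<lambda>n. h (e n))(x := a)) \<phi>)"
      by simp
    then show ?case unfolding img by simp
  qed
qed

definition transport :: "('a \<Rightarrow> 'b) \<Rightarrow> ('f, 'p, 'a) struct \<Rightarrow> ('f, 'p, 'b) struct" where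
  "transport h M = \<lparr> univ = h ` univ M,
     fint = (\<lambda>f xs. h (fint M f (map (inv_into (univ M) h) xs))),
     rint = (\<lambda>p xs. rint M p (map (inv_into (univ M) h) xs)) \<rparr>"

lemma transport_simps [simp]:
  "univ (transport h M) = h ` univ M"
  "fint (transport h M) f xs = h (fint M f (map (inv_into (univ M) h) xs))"
  "rint (transport h M) p xs = rint M p (map (inv_into (univ M) h) xs)"
  by (simp_all add: transport_def)

lemma transport:
  assumes str: "is_struct L M" and inj: "inj_on h (univ M)"
  shows "is_struct L (transport h M)" "elem L M (transport h M) h"
proof -
  have id: "map (inv_into (univ M) h) (map h xs) = xs" if "set xs \<subseteq> univ M" for xs
    using that inj by (induction xs) auto
  have "fint (transport h M) f ys \<in> h ` univ M"
    if "(f, n) \<in> funs L" "ys \<in> tuples n (h ` univ M)" for f n ys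
  proof -
    have "map (inv_into (univ M) h) ys \<in> tuples n (univ M)"
      using that(2) by (auto simp: tuples_def intro!: inv_into_into)
    then show ?thesis using str that(1) by (fastforce simp: is_struct_def)
  qed
  then show "is_struct L (transport h M)" using str by (auto simp: is_struct_def)
  show "elem L M (transport h M) h"
    by (rule isomorphism_elem[OF str inj]) (simp_all add: id tuples_def del: map_map)
qed

lemma elem_in: "elem L M N j \<Longrightarrow> x \<in> univ M \<Longrightarrow> j x \<in> univ N"
  by (auto simp: elem_def)

lemma elem_sat:
  assumes "elem L M N j" "wf_fm L \<phi>" "e ` fv \<phi> \<subseteq> univ M" "univ M \<noteq> {}"
  shows "sat M e \<phi> = sat N (\<lambda>n. j (e n)) \<phi>"
proof -
  obtain a where a: "a \<in> univ M" using assms(4) by auto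
  let ?e = "\<lambda>n. if n \<in> fv \<phi> then e n else a"
  have "sat M e \<phi> = sat M ?e \<phi>" by (rule sat_cong) simp
  also have "\<dots> = sat N (\<lambda>n. j (?e n)) \<phi>"
    using assms a by (auto simp: elem_def image_subset_iff)
  also have "\<dots> = sat N (\<lambda>n. j (e n)) \<phi>" by (rule sat_cong) simp
  finally show ?thesis .
qed

lemma elem_trans:
  assumes "elem L M N j" "elem L N K k"
  shows "elem L M K (k \<circ> j)"
  unfolding elem_def
proof (intro conjI allI impI)
  show "(k \<circ> j) ` univ M \<subseteq> univ K" using elem_in[OF assms(1)] elem_in[OF assms(2)] by auto
  fix \<phi> and e :: "nat \<Rightarrow> 'c" assume *: "wf_fm L \<phi> \<and> range e \<subseteq> univ M"
  then have "range (\<lambda>n. j (e n)) \<subseteq> univ N" using assms(1) by (auto simp: elem_def)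
  then show "sat M e \<phi> = sat K (\<lambda>n. (k \<circ> j) (e n)) \<phi>" using * assms by (simp add: elem_def)
qed

lemma elem_inj:
  assumes "elem L M N j"
  shows "inj_on j (univ M)"
proof (rule inj_onI)
  fix x y assume *: "x \<in> univ M" "y \<in> univ M" "j x = j y"
  let ?e = "\<lambda>n :: nat. if n = 0 then x else y"
  have "sat M ?e (Eq (Var 0) (Var 1)) = sat N (\<lambda>n. j (?e n)) (Eq (Var 0) (Var 1))"
    using * by (intro elem_sat[OF assms]) auto
  with * show "x = y" by simp
qed

lemma elem_holds:
  assumes "elem L M N j" "sentence L \<sigma>" "is_struct L M" "is_struct L N"
  shows "holds M \<sigma> \<longleftrightarrow> holds N \<sigma>"
proof -
  have c: "sat K e \<sigma> = sat K e' \<sigma>" for K :: "('a, 'b, 'z) struct" and e e'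
    using assms(2) by (intro sat_cong) (simp add: sentence_def)
  obtain a where a: "a \<in> univ M" using assms(3) by (auto simp: is_struct_def)
  then have ja: "j a \<in> univ N" using assms(1) by (auto simp: elem_def)
  have "holds M \<sigma> \<longleftrightarrow> sat M (\<lambda>_. a) \<sigma>"
  proof
    assume "holds M \<sigma>" then show "sat M (\<lambda>_. a) \<sigma>" using a by (simp add: holds_def image_subset_iff)
  qed (auto simp: holds_def elim: iffD1[OF c])
  also have "\<dots> \<longleftrightarrow> sat N (\<lambda>_. j a) \<sigma>"
    using assms a by (intro elem_sat) (auto simp: sentence_def)
  also have "\<dots> \<longleftrightarrow> holds N \<sigma>"
  proof
    assume "holds N \<sigma>" then show "sat N (\<lambda>_. j a) \<sigma>" using ja by (simp add: holds_def image_subset_iff)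
  qed (auto simp: holds_def elim: iffD1[OF c])
  finally show ?thesis .
qed

text \<open>\<open>Los\<close> concerns chosen representatives. Arbitrary families can be used as
  well, because the finitely many that matter for a formula agree with their representatives on a
  common set in \<open>U\<close>.\<close>

lemma (in ultrapower) Los_rep:
  assumes "\<And>n. range (g n) \<subseteq> univ M" "wf_fm L \<phi>"
  shows "sat Up (\<lambda>n. rep (g n)) \<phi> \<longleftrightarrow> {i. sat M (\<lambda>n. g n i) \<phi>} \<in> U"
proof -
  have "range (\<lambda>n. rep (g n)) \<subseteq> univ Up" using rep_in_Up assms(1) by auto
  note Los[OF this assms(2)]
  also have "{i. sat M (\<lambda>n. rep (g n) i) \<phi>} \<in> U \<longleftrightarrow> {i. sat M (\<lambda>n. g n i) \<phi>} \<in> U"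
  proof (rule U_cong)
    obtain ns where ns: "set ns = fv \<phi>" using finite_list[OF finite_fv] by blast
    have "{i. \<forall>n\<in>set ns. rep (g n) i = g n i} \<in> U"
      using rep_at assms(1) by (intro U_list) auto
    then show "{i. sat M (\<lambda>n. rep (g n) i) \<phi> = sat M (\<lambda>n. g n i) \<phi>} \<in> U"
    proof (rule U_up, intro subsetI CollectI)
      fix i assume "i \<in> {i. \<forall>n\<in>set ns. rep (g n) i = g n i}"
      then show "sat M (\<lambda>n. rep (g n) i) \<phi> = sat M (\<lambda>n. g n i) \<phi>"
        using ns by (intro sat_cong) auto
    qed
  qed
  finally show ?thesis .
qed

text \<open>
  Compactness over the elementary diagram of \<open>M\<close>: labels \<open>Inl x\<close> name the elements of
  \<open>M\<close>, labels \<open>Inr c\<close> are new constants.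
\<close>

theorem realize:
  fixes L :: "('f, 'p) lang" and M :: "('f, 'p, 'u) struct"
    and \<Sigma> :: "(('f, 'p) fm \<times> (nat \<Rightarrow> 'u + 'c)) set"
  assumes str: "is_struct L M"
    and large: "{\<phi>. wf_fm L \<phi>} \<lesssim> (UNIV :: 'm set)"
    and small: "univ M \<lesssim> (UNIV :: 'm set)" "(UNIV :: 'c set) \<lesssim> (UNIV :: 'm set)"
    and wf: "\<And>\<phi> v. (\<phi>, v) \<in> \<Sigma> \<Longrightarrow> wf_fm L \<phi> \<and> range v \<subseteq> Inl ` univ M \<union> range Inr"
    and fin: "\<And>S. finite S \<Longrightarrow> S \<subseteq> \<Sigma> \<Longrightarrow>
       \<exists>\<nu>. range \<nu> \<subseteq> univ M \<and> (\<forall>(\<phi>, v)\<in>S. sat M (\<lambda>n. case_sum id \<nu> (v n)) \<phi>)"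
  obtains N :: "('f, 'p, 'm) struct" and j \<nu> where "is_struct L N" "elem L M N j"
    "range \<nu> \<subseteq> univ N" "\<And>\<phi> v. (\<phi>, v) \<in> \<Sigma> \<Longrightarrow> sat N (\<lambda>n. case_sum j \<nu> (v n)) \<phi>"
proof -
  \<comment> \<open>The indices are sets of conditions. With every \<open>at \<sigma>\<close> in the
    ultrafilter, almost every index is a finite set containing a given condition, and so its
    assignment satisfies that condition.\<close>
  define at where "at \<sigma> = {S. finite S \<and> S \<subseteq> \<Sigma> \<and> \<sigma> \<in> S}" for \<sigma>
  have "fip (at ` \<Sigma>)"
    unfolding fip_def
  proof (intro allI impI)
    fix F assume "finite F \<and> F \<subseteq> at ` \<Sigma>"
    then obtain S where "finite S" "S \<subseteq> \<Sigma>" "F = at ` S" by (metis finite_subset_image)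
    then have "S \<in> \<Inter>F" by (auto simp: at_def)
    then show "\<Inter>F \<noteq> {}" by auto
  qed
  then obtain U where U: "at ` \<Sigma> \<subseteq> U" "ultra U" by (rule ultra_exists)
  interpret ultrapower L M U using str U(2) by unfold_locales
  obtain a where a: "a \<in> univ M" using str by (auto simp: is_struct_def)
  have "\<exists>\<nu>. range \<nu> \<subseteq> univ M \<and> (finite S \<and> S \<subseteq> \<Sigma> \<longrightarrow>
      (\<forall>(\<phi>, v)\<in>S. sat M (\<lambda>n. case_sum id \<nu> (v n)) \<phi>))" for S
  proof (cases "finite S \<and> S \<subseteq> \<Sigma>")
    case True
    with fin[of S] show ?thesis by blast
  next
    case False
    with a show ?thesis by (intro exI[of _ "\<lambda>_. a"]) auto
  qed
  from choice[OF allI[OF this]] obtain asg where "\<forall>S. range (asg S) \<subseteq> univ M \<and>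
      (finite S \<and> S \<subseteq> \<Sigma> \<longrightarrow> (\<forall>(\<phi>, v)\<in>S. sat M (\<lambda>n. case_sum id (asg S) (v n)) \<phi>))" ..
  then have asg: "range (asg S) \<subseteq> univ M \<and>
      (finite S \<and> S \<subseteq> \<Sigma> \<longrightarrow> (\<forall>(\<phi>, v)\<in>S. sat M (\<lambda>n. case_sum id (asg S) (v n)) \<phi>))" for S
    by (rule spec)
  then have asg_in: "asg S c \<in> univ M" for S c by (meson range_subsetD)
  define diag where "diag x = rep (\<lambda>_. x)" for x
  define new where "new c = rep (\<lambda>S. asg S c)" for c
  have diag: "diag x \<in> univ Up" if "x \<in> univ M" for x
    unfolding diag_def using that by (intro rep_in_Up) auto
  have new: "new c \<in> univ Up" for c
    unfolding new_def using asg_in by (intro rep_in_Up) auto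
  have Up_diag: "sat M e \<phi> = sat Up (\<lambda>n. diag (e n)) \<phi>" if "wf_fm L \<phi>" "range e \<subseteq> univ M" for \<phi> e
  proof -
    have "sat Up (\<lambda>n. diag (e n)) \<phi> \<longleftrightarrow> {i. sat M e \<phi>} \<in> U"
      unfolding diag_def using that by (intro Los_rep) auto
    also have "\<dots> \<longleftrightarrow> sat M e \<phi>" using U_UNIV U_compl[of UNIV] by auto
    finally show ?thesis ..
  qed
  have Up_sat: "sat Up (\<lambda>n. case_sum diag new (v n)) \<phi>" if \<sigma>: "(\<phi>, v) \<in> \<Sigma>" for \<phi> v
  proof -
    let ?g = "\<lambda>n S. case_sum id (asg S) (v n)"
    have v: "v n \<in> Inl ` univ M \<union> range Inr" for n using wf[OF \<sigma>] by auto
    have "range (?g n) \<subseteq> univ M" for n using v[of n] asg_in by auto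
    with wf[OF \<sigma>] have "sat Up (\<lambda>n. rep (?g n)) \<phi> \<longleftrightarrow> {S. sat M (\<lambda>n. ?g n S) \<phi>} \<in> U"
      by (intro Los_rep) auto
    moreover have "{S. sat M (\<lambda>n. ?g n S) \<phi>} \<in> U"
    proof (rule U_up)
      show "at (\<phi>, v) \<in> U" using U \<sigma> by auto
      show "at (\<phi>, v) \<subseteq> {S. sat M (\<lambda>n. ?g n S) \<phi>}" using asg by (force simp: at_def)
    qed
    moreover have "rep (?g n) = case_sum diag new (v n)" for n
      by (cases "v n") (auto simp: diag_def new_def)
    ultimately show ?thesis by simp
  qed
  \<comment> \<open>The ultrapower is in general too large for \<open>'m\<close>. An elementary
    substructure that contains the old elements and the new constants is small enough, and it is
    copied to \<open>'m\<close>.\<close>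
  let ?A = "diag ` univ M \<union> range new"
  have inf: "infinite (UNIV :: 'm set)" using large_infinite[OF large] .
  have "diag ` univ M \<lesssim> (UNIV :: 'm set)" "range new \<lesssim> (UNIV :: 'm set)"
    using image_lepoll small lepoll_trans by blast+
  then have "?A \<lesssim> (UNIV :: 'm set)" by (rule Un_lepoll_infinite[OF inf])
  moreover have "?A \<subseteq> univ Up" using diag new by auto
  ultimately have "\<exists>S. ?A \<subseteq> S \<and> S \<subseteq> univ Up \<and> S \<lesssim> (UNIV :: 'm set) \<and> is_struct L (Up\<lparr>univ := S\<rparr>) \<and>
    (\<forall>\<phi> e. wf_fm L \<phi> \<and> range e \<subseteq> S \<longrightarrow> sat (Up\<lparr>univ := S\<rparr>) e \<phi> = sat Up e \<phi>)"
    by (intro Loewenheim_Skolem struct_Up large)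
  then obtain S where S: "?A \<subseteq> S" "S \<lesssim> (UNIV :: 'm set)" "is_struct L (Up\<lparr>univ := S\<rparr>)"
    and S_sat: "\<And>\<phi> e. wf_fm L \<phi> \<Longrightarrow> range e \<subseteq> S \<Longrightarrow> sat (Up\<lparr>univ := S\<rparr>) e \<phi> = sat Up e \<phi>"
    by (elim exE conjE) auto
  obtain h :: "_ \<Rightarrow> 'm" where h: "inj_on h S" using S(2) unfolding lepoll_def by auto
  let ?W = "Up\<lparr>univ := S\<rparr>"
  have h': "inj_on h (univ ?W)" using h by simp
  note T = transport[OF S(3) h']
  have T_sat: "sat Up e \<phi> = sat (transport h ?W) (\<lambda>n. h (e n)) \<phi>" if "wf_fm L \<phi>" "range e \<subseteq> S" for \<phi> e
    using T(2) S_sat[OF that] that by (simp add: elem_def)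
  show thesis
  proof (rule that)
    show "is_struct L (transport h ?W)" by (rule T)
    show "elem L M (transport h ?W) (\<lambda>x. h (diag x))"
      unfolding elem_def
    proof (intro conjI allI impI)
      show "(\<lambda>x. h (diag x)) ` univ M \<subseteq> univ (transport h ?W)" using S(1) by auto
      fix \<phi> and e :: "nat \<Rightarrow> 'u" assume *: "wf_fm L \<phi> \<and> range e \<subseteq> univ M"
      then have "range (\<lambda>n. diag (e n)) \<subseteq> S" using S(1) by auto
      then show "sat M e \<phi> = sat (transport h ?W) (\<lambda>n. h (diag (e n))) \<phi>"
        using * Up_diag T_sat by simp
    qed
    show "range (\<lambda>c. h (new c)) \<subseteq> univ (transport h ?W)" using S(1) by auto
    fix \<phi> v assume \<sigma>: "(\<phi>, v) \<in> \<Sigma>"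
    have v: "v n \<in> Inl ` univ M \<union> range Inr" for n using wf[OF \<sigma>] by auto
    have "case_sum diag new (v n) \<in> S" for n using v[of n] S(1) by auto
    then have "range (\<lambda>n. case_sum diag new (v n)) \<subseteq> S" by auto
    moreover have "wf_fm L \<phi>" using wf[OF \<sigma>] by simp
    ultimately have "sat (transport h ?W) (\<lambda>n. h (case_sum diag new (v n))) \<phi>"
      using T_sat Up_sat[OF \<sigma>] by blast
    moreover have "h (case_sum diag new (v n)) = case_sum (\<lambda>x. h (diag x)) (\<lambda>c. h (new c)) (v n)" for n
      by (cases "v n") auto
    ultimately show "sat (transport h ?W) (\<lambda>n. case_sum (\<lambda>x. h (diag x)) (\<lambda>c. h (new c)) (v n)) \<phi>"
      by simp
  qed
qed

lemma elem_fint: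
  assumes "elem L M N j" "is_struct L M" "(f, n) \<in> funs L" "xs \<in> tuples n (univ M)"
  shows "j (fint M f xs) = fint N f (map j xs)"
proof -
  let ?\<phi> = "Eq (Fn f (map Var [0..<n])) (Var n) :: ('a, 'b) fm"
  let ?e = "\<lambda>i. if i < n then xs ! i else fint M f xs"
  have ne: "univ M \<noteq> {}" "fint M f xs \<in> univ M" "length xs = n"
    using assms(2-4) by (auto simp: is_struct_def tuples_def)
  have "sat M ?e ?\<phi> = sat N (\<lambda>i. j (?e i)) ?\<phi>"
    using assms ne by (intro elem_sat[OF assms(1)]) (auto simp: list_all_iff tuples_def)
  moreover have "map ?e [0..<n] = xs" using ne by (intro nth_equalityI) auto
  moreover have "map (\<lambda>i. j (?e i)) [0..<n] = map j xs" using ne by (intro nth_equalityI) auto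
  ultimately show ?thesis by (simp add: comp_def)
qed

lemma elem_rint:
  assumes "elem L M N j" "is_struct L M" "(p, n) \<in> rels L" "xs \<in> tuples n (univ M)"
  shows "rint M p xs = rint N p (map j xs)"
proof -
  let ?\<phi> = "Rel p (map Var [0..<n]) :: ('a, 'b) fm"
  obtain a where a: "a \<in> univ M" using assms(2) by (auto simp: is_struct_def)
  let ?e = "\<lambda>i. if i < n then xs ! i else a"
  have len: "length xs = n" using assms(4) by (auto simp: tuples_def)
  have "sat M ?e ?\<phi> = sat N (\<lambda>i. j (?e i)) ?\<phi>"
    using assms a len by (intro elem_sat[OF assms(1)]) (auto simp: list_all_iff tuples_def)
  moreover have "map ?e [0..<n] = xs" using len by (intro nth_equalityI) auto
  moreover have "map (\<lambda>i. j (?e i)) [0..<n] = map j xs" using len by (intro nth_equalityI) auto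
  ultimately show ?thesis by (simp add: comp_def)
qed

lemma elem_refl: "elem L M M id"
  by (auto simp: elem_def)

lemma elem_cong:
  assumes "elem L M N j" "\<And>x. x \<in> univ M \<Longrightarrow> j x = k x"
  shows "elem L M N k"
  unfolding elem_def
proof (intro conjI allI impI)
  show "k ` univ M \<subseteq> univ N" using elem_in[OF assms(1)] assms(2) by fastforce
  fix \<phi> and e :: "nat \<Rightarrow> 'c" assume *: "wf_fm L \<phi> \<and> range e \<subseteq> univ M"
  then have "(\<lambda>n. j (e n)) = (\<lambda>n. k (e n))" using assms(2) by (auto simp: image_subset_iff)
  then show "sat M e \<phi> = sat N (\<lambda>n. k (e n)) \<phi>" using * assms(1) by (simp add: elem_def)
qed

text \<open>The stages are literally included in one another, so the limit is a plain union. A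
  symbol is evaluated at the first stage containing its arguments; elementarity makes every later
  stage give the same value.\<close>

lemma elementary_chain:
  fixes C :: "nat \<Rightarrow> ('f, 'p, 'a) struct"
  assumes str: "\<And>n. is_struct L (C n)" and el: "\<And>n. elem L (C n) (C (Suc n)) id"
  obtains N where "univ N = (\<Union>n. univ (C n))" "is_struct L N" "\<And>n. elem L (C n) N id"
proof -
  have el_le: "elem L (C m) (C n) id" if "m \<le> n" for m n
    using that
  proof (induction rule: dec_induct)
    case (step k)
    show ?case using elem_trans[OF step.IH el[of k]] by simp
  qed (rule elem_refl)
  then have mono: "univ (C m) \<subseteq> univ (C n)" if "m \<le> n" for m n
    using that elem_in by fastforce
  define st where "st xs = (LEAST n. set xs \<subseteq> univ (C n))" for xs
  have st: "set xs \<subseteq> univ (C (st xs))" "st xs \<le> n" if "set xs \<subseteq> univ (C n)" for xs n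
    unfolding st_def using that by (auto intro: LeastI2 Least_le)
  define N where "N = \<lparr>univ = (\<Union>n. univ (C n)), fint = (\<lambda>f xs. fint (C (st xs)) f xs),
    rint = (\<lambda>p xs. rint (C (st xs)) p xs)\<rparr>"
  have fint: "fint N f xs = fint (C n) f xs" if "(f, length xs) \<in> funs L" "set xs \<subseteq> univ (C n)" for f xs n
    using elem_fint[OF el_le[OF st(2)[OF that(2)]] str that(1)] st(1)[OF that(2)]
    by (simp add: N_def tuples_def)
  have rint: "rint N p xs = rint (C n) p xs" if "(p, length xs) \<in> rels L" "set xs \<subseteq> univ (C n)" for p xs n
    using elem_rint[OF el_le[OF st(2)[OF that(2)]] str that(1)] st(1)[OF that(2)]
    by (simp add: N_def tuples_def)
  have fin: "\<exists>n. A \<subseteq> univ (C n)" if "finite A" "A \<subseteq> univ N" for A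
    using that
  proof (induction A rule: finite_induct)
    case (insert x A)
    then obtain m n where "A \<subseteq> univ (C m)" "x \<in> univ (C n)" by (auto simp: N_def)
    then have "insert x A \<subseteq> univ (C (max m n))" using mono[of m "max m n"] mono[of n "max m n"] by auto
    then show ?case ..
  qed simp
  have strN: "is_struct L N"
    unfolding is_struct_def
  proof safe
    assume "univ N = {}"
    moreover have "univ (C 0) \<noteq> {}" using str by (simp add: is_struct_def)
    ultimately show False by (auto simp: N_def)
  next
    fix f n xs assume *: "(f, n) \<in> funs L" "xs \<in> tuples n (univ N)"
    then obtain m where m: "set xs \<subseteq> univ (C m)" using fin[of "set xs"] by (auto simp: tuples_def)
    then have "fint (C m) f xs \<in> univ (C m)" using str[of m] * by (fastforce simp: is_struct_def tuples_def)
    then show "fint N f xs \<in> univ N" using fint[of f xs m] * m by (auto simp: tuples_def N_def)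
  qed
  have ev: "eval_tm N e t = eval_tm (C n) e t" if "wf_tm L t" "range e \<subseteq> univ (C n)" for e t n
    using that(1)
  proof (induction t)
    case (Fn f ts)
    then have "map (eval_tm N e) ts = map (eval_tm (C n) e) ts" by (simp add: list_all_iff)
    moreover have "set (map (eval_tm (C n) e) ts) \<subseteq> univ (C n)"
      using Fn.prems that by (auto simp: list_all_iff intro!: eval_tm_in_univ[OF str])
    ultimately show ?case using Fn.prems fint[of f "map (eval_tm (C n) e) ts" n] by (simp del: map_eq_conv)
  qed simp
  have sat: "sat (C n) e \<phi> = sat N e \<phi>" if "wf_fm L \<phi>" "range e \<subseteq> univ (C n)" for e \<phi> n
    using that
  proof (induction \<phi> arbitrary: e n)
    case (Eq s t)
    then show ?case using ev[of s e n] ev[of t e n] by simp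
  next
    case (Rel p ts)
    then have "map (eval_tm N e) ts = map (eval_tm (C n) e) ts"
      using ev[of _ e n] by (simp add: list_all_iff)
    moreover have "set (map (eval_tm (C n) e) ts) \<subseteq> univ (C n)"
      using Rel by (auto simp: list_all_iff intro!: eval_tm_in_univ[OF str])
    ultimately show ?case using Rel.prems rint[of p "map (eval_tm (C n) e) ts" n]
      by (simp del: map_eq_conv)
  next
    case (Neg \<phi>)
    then show ?case by simp
  next
    case (And \<phi> \<psi>)
    then show ?case by simp
  next
    case (Exists x \<phi>)
    have wf: "wf_fm L \<phi>" using Exists.prems by simp
    show ?case
    proof
      assume "sat (C n) e (Exists x \<phi>)"
      then obtain a where a: "a \<in> univ (C n)" "sat (C n) (e(x := a)) \<phi>" by auto
      have "range (e(x := a)) \<subseteq> univ (C n)" using Exists.prems(2) a(1) by auto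
      with a have "sat N (e(x := a)) \<phi>" using Exists.IH[OF wf] by blast
      moreover have "a \<in> univ N" using a(1) by (auto simp: N_def)
      ultimately show "sat N e (Exists x \<phi>)" by auto
    next
      assume "sat N e (Exists x \<phi>)"
      then obtain a where a: "a \<in> univ N" "sat N (e(x := a)) \<phi>" by auto
      then obtain m where m: "a \<in> univ (C m)" by (auto simp: N_def)
      \<comment> \<open>The witness may appear only at a later stage. The existential statement
        holds there and returns to stage \<open>n\<close> by elementarity between the two
        stages.\<close>
      let ?k = "max m n"
      have "range (e(x := a)) \<subseteq> univ (C ?k)"
        using Exists.prems(2) m mono[of m ?k] mono[of n ?k] by auto
      with a have "sat (C ?k) (e(x := a)) \<phi>" using Exists.IH[OF wf] by blast
      moreover have "a \<in> univ (C ?k)" using m mono[of m ?k] by auto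
      ultimately have "sat (C ?k) e (Exists x \<phi>)" by auto
      then show "sat (C n) e (Exists x \<phi>)"
        using el_le[of n ?k] Exists.prems by (simp add: elem_def del: sat.simps)
    qed
  qed
  show thesis
  proof (rule that)
    show "univ N = (\<Union>n. univ (C n))" by (simp add: N_def)
    show "elem L (C n) N id" for n using sat by (auto simp: elem_def N_def)
  qed (rule strN)
qed

section \<open>Automorphisms of elementary extensions\<close>

text \<open>Partial elementary maps are treated as graphs, so that back and forth are symmetric.\<close>

definition pel :: "('f, 'p) lang \<Rightarrow> ('f, 'p, 'a) struct \<Rightarrow> ('a \<times> 'a) set \<Rightarrow> bool" where
  "pel L M g \<longleftrightarrow> g \<subseteq> univ M \<times> univ M \<and>
     (\<forall>\<phi> e e'. wf_fm L \<phi> \<and> (\<forall>n\<in>fv \<phi>. (e n, e' n) \<in> g) \<longrightarrow> sat M e \<phi> = sat M e' \<phi>)"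

lemma pel_sat: "pel L M g \<Longrightarrow> wf_fm L \<phi> \<Longrightarrow> (\<And>n. n \<in> fv \<phi> \<Longrightarrow> (e n, e' n) \<in> g) \<Longrightarrow> sat M e \<phi> = sat M e' \<phi>"
  unfolding pel_def by blast

lemma pel_converse: "pel L M g \<Longrightarrow> pel L M (g\<inverse>)"
  unfolding pel_def by (simp add: converse_subset_swap) blast

lemma pel_eq_iff:
  assumes "pel L M g" "(x, x') \<in> g" "(y, y') \<in> g"
  shows "x = y \<longleftrightarrow> x' = y'"
  using pel_sat[OF assms(1), of "Eq (Var 0) (Var 1)" "\<lambda>n. if n = 0 then x else y" "\<lambda>n. if n = 0 then x' else y'"]
    assms(2,3) by auto

lemma pel_elem:
  assumes "pel L M g" "elem L M N j" "univ M \<noteq> {}"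
  shows "pel L N (map_prod j j ` g)"
  unfolding pel_def
proof (intro conjI allI impI)
  show "map_prod j j ` g \<subseteq> univ N \<times> univ N"
    using assms(1) elem_in[OF assms(2)] by (auto simp: pel_def)
  fix \<phi> e e' assume *: "wf_fm L \<phi> \<and> (\<forall>n\<in>fv \<phi>. (e n, e' n) \<in> map_prod j j ` g)"
  then have "\<forall>n\<in>fv \<phi>. \<exists>x y. (x, y) \<in> g \<and> e n = j x \<and> e' n = j y" by fastforce
  then obtain d d' where d: "\<And>n. n \<in> fv \<phi> \<Longrightarrow> (d n, d' n) \<in> g \<and> e n = j (d n) \<and> e' n = j (d' n)"
    by metis
  then have dM: "d ` fv \<phi> \<subseteq> univ M" "d' ` fv \<phi> \<subseteq> univ M" using assms(1) unfolding pel_def by blast+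
  have "sat N e \<phi> = sat N (\<lambda>n. j (d n)) \<phi>" by (rule sat_cong) (use d in auto)
  also have "\<dots> = sat M d \<phi>" using elem_sat[OF assms(2)] * dM assms(3) by blast
  also have "\<dots> = sat M d' \<phi>" using pel_sat[OF assms(1)] * d by blast
  also have "\<dots> = sat N (\<lambda>n. j (d' n)) \<phi>" using elem_sat[OF assms(2)] * dM assms(3) by blast
  also have "\<dots> = sat N e' \<phi>" by (rule sat_cong) (use d in auto)
  finally show "sat N e \<phi> = sat N e' \<phi>" .
qed

text \<open>Quantifying existentially over the elements outside the domain of \<open>g\<close> turns
  the finitely many facts in \<open>S\<close> into one formula about the domain. \<open>g\<close>
  transports this formula, and its witnesses become the values of the remaining elements.\<close>

lemma pel_finite:
  fixes M :: "('f, 'p, 'a) struct"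
  assumes str: "is_struct L M" and g: "pel L M g" and fin: "finite S"
    and S: "\<And>\<phi> u. (\<phi>, u) \<in> S \<Longrightarrow> wf_fm L \<phi> \<and> range u \<subseteq> univ M \<and> sat M u \<phi>"
  obtains \<nu> where "range \<nu> \<subseteq> univ M" "\<And>x y. (x, y) \<in> g \<Longrightarrow> \<nu> x = y"
    "\<And>\<phi> u. (\<phi>, u) \<in> S \<Longrightarrow> sat M (\<lambda>n. \<nu> (u n)) \<phi>"
proof -
  obtain a where a: "a \<in> univ M" using str by (auto simp: is_struct_def)
  have "\<exists>\<Phi> u. wf_fm L \<Phi> \<and>
     (\<forall>(M :: ('f, 'p, 'a) struct) \<nu>. sat M (\<lambda>n. \<nu> (u n)) \<Phi> \<longleftrightarrow> (\<forall>(\<phi>, v)\<in>S. sat M (\<lambda>n. \<nu> (v n)) \<phi>)) \<and>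
     u ` fv \<Phi> \<subseteq> (\<Union>(\<phi>, v)\<in>S. v ` fv \<phi>)"
    by (rule finite_labelled_conj[OF fin]) (use S in blast)
  then obtain \<Phi> u where wf: "wf_fm L \<Phi>"
    and \<Phi>: "\<forall>(M :: ('f, 'p, 'a) struct) \<nu>. sat M (\<lambda>n. \<nu> (u n)) \<Phi> \<longleftrightarrow> (\<forall>(\<phi>, v)\<in>S. sat M (\<lambda>n. \<nu> (v n)) \<phi>)"
    and u: "u ` fv \<Phi> \<subseteq> (\<Union>(\<phi>, v)\<in>S. v ` fv \<phi>)" by (elim exE conjE)
  have uM: "u n \<in> univ M" if "n \<in> fv \<Phi>" for n
  proof -
    have "u n \<in> (\<Union>(\<phi>, v)\<in>S. v ` fv \<phi>)" using that by (intro subsetD[OF u] imageI)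
    then obtain \<phi> v m where "(\<phi>, v) \<in> S" "u n = v m" by auto
    then show ?thesis using S[of \<phi> v] by auto
  qed
  \<comment> \<open>Distinct free variables of \<open>\<Psi>\<close> carry distinct labels.\<close>
  define s where "s n = (LEAST m. u m = u n)" for n
  define \<Psi> where "\<Psi> = ren s \<Phi>"
  have us: "u (s n) = u n" for n unfolding s_def by (rule LeastI) (rule refl)
  have s_eq: "s m = s n" if "u m = u n" for m n using that by (simp add: s_def)
  have s_id: "s n = n" if n: "n \<in> fv \<Psi>" for n
  proof -
    obtain m where "n = s m" using n by (auto simp: \<Psi>_def)
    then show ?thesis using s_eq[OF us[of m]] by simp
  qed
  have \<Psi>: "sat M (\<lambda>n. \<nu> (u n)) \<Psi> \<longleftrightarrow> (\<forall>(\<phi>, v)\<in>S. sat M (\<lambda>n. \<nu> (v n)) \<phi>)" for \<nu>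
  proof -
    have "sat M (\<lambda>n. \<nu> (u n)) \<Psi> \<longleftrightarrow> sat M (\<lambda>n. \<nu> (u n)) \<Phi>" by (simp add: \<Psi>_def us)
    also have "\<dots> \<longleftrightarrow> (\<forall>(\<phi>, v)\<in>S. sat M (\<lambda>n. \<nu> (v n)) \<phi>)" by (rule \<Phi>[rule_format])
    finally show ?thesis .
  qed
  have "sat M u \<Psi>" using \<Psi>[of "\<lambda>x. x"] S by auto
  let ?A = "Domain g"
  define f where "f x = (SOME y. (x, y) \<in> g)" for x
  have f: "(x, f x) \<in> g" if "x \<in> ?A" for x using that someI_ex[of "\<lambda>y. (x, y) \<in> g"] by (auto simp: f_def)
  have fM: "f x \<in> univ M" if "x \<in> ?A" for x using f[OF that] g by (auto simp: pel_def)
  obtain xs where xs: "set xs = {n \<in> fv \<Psi>. u n \<notin> ?A}"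
    using finite_list[of "{n \<in> fv \<Psi>. u n \<notin> ?A}"] finite_fv[of \<Psi>] by auto
  have "u n \<in> univ M" if "n \<in> set xs" for n using that xs uM us by (auto simp: \<Psi>_def)
  with \<open>sat M u \<Psi>\<close> have "sat M u (Exs xs \<Psi>)" unfolding sat_Exs by blast
  moreover have "sat M u (Exs xs \<Psi>) = sat M (\<lambda>n. f (u n)) (Exs xs \<Psi>)"
    using wf xs by (intro pel_sat[OF g] f) (auto simp: \<Psi>_def)
  ultimately have "sat M (\<lambda>n. f (u n)) (Exs xs \<Psi>)" by blast
  then obtain e where e: "\<And>n. n \<notin> set xs \<Longrightarrow> e n = f (u n)" "\<And>n. n \<in> set xs \<Longrightarrow> e n \<in> univ M"
    "sat M e \<Psi>" unfolding sat_Exs by blast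
  \<comment> \<open>The inner choice is unambiguous since distinct variables of
    \<open>\<Psi>\<close> carry distinct labels; \<open>a\<close> is a default for elements that
    occur nowhere.\<close>
  define \<nu> where "\<nu> x = (if x \<in> ?A then f x else if x \<in> u ` fv \<Psi> then e (SOME n. n \<in> fv \<Psi> \<and> u n = x) else a)" for x
  have \<nu>u: "\<nu> (u n) = e n" if n: "n \<in> fv \<Psi>" for n
  proof (cases "u n \<in> ?A")
    case True
    then have "n \<notin> set xs" by (simp add: xs)
    then have en: "e n = f (u n)" by (rule e(1))
    have "\<nu> (u n) = f (u n)" unfolding \<nu>_def by (rule if_P) (rule True)
    then show ?thesis unfolding en .
  next
    case False
    have "(SOME m. m \<in> fv \<Psi> \<and> u m = u n) = n"
    proof (rule some_equality)
      fix m assume m: "m \<in> fv \<Psi> \<and> u m = u n"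
      then have "s m = s n" by (intro s_eq) simp
      moreover have "s m = m" using m by (intro s_id) simp
      ultimately show "m = n" using s_id[OF n] by simp
    qed (use n in simp)
    then show ?thesis using False n by (simp add: \<nu>_def)
  qed
  have "\<nu> x \<in> univ M" for x
  proof -
    consider "x \<in> ?A" | n where "x \<notin> ?A" "n \<in> fv \<Psi>" "x = u n" | "x \<notin> ?A" "x \<notin> u ` fv \<Psi>" by blast
    then show ?thesis
    proof cases
      case 1
      from fM[OF this] this show ?thesis by (simp add: \<nu>_def)
    next
      case 2
      then have "n \<in> set xs" by (simp add: xs)
      from e(2)[OF this] show ?thesis using \<nu>u[OF 2(2)] 2(3) by simp
    next
      case 3 then show ?thesis using a by (simp add: \<nu>_def)
    qed
  qed
  moreover have "\<nu> x = y" if "(x, y) \<in> g" for x y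
  proof -
    have "x \<in> ?A" using that by auto
    then show ?thesis using pel_eq_iff[OF g f[of x] that] by (simp add: \<nu>_def)
  qed
  moreover have "sat M (\<lambda>n. \<nu> (u n)) \<Psi>"
    using e(3) \<nu>u sat_cong[of \<Psi> "\<lambda>n. \<nu> (u n)" e M] by simp
  then have "sat M (\<lambda>n. \<nu> (v n)) \<phi>" if "(\<phi>, v) \<in> S" for \<phi> v using \<Psi>[of \<nu>] that by blast
  ultimately show thesis by (intro that[of \<nu>]) auto
qed

lemma pel_automorphism:
  assumes str: "is_struct L N" and G: "pel L N G" "Domain G = univ N" "Range G = univ N"
  obtains F where "automorphism L N F" "\<And>x y. (x, y) \<in> G \<Longrightarrow> F x = y"
proof -
  define F where "F x = (SOME y. (x, y) \<in> G)" for x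
  have F: "(x, F x) \<in> G" if "x \<in> univ N" for x
    using that someI_ex[of "\<lambda>y. (x, y) \<in> G"] G(2) by (auto simp: F_def)
  have sub: "G \<subseteq> univ N \<times> univ N" using G(1) by (simp add: pel_def)
  have FN: "F x \<in> univ N" if "x \<in> univ N" for x using F[OF that] sub by auto
  have F_eq: "F x = y" if "(x, y) \<in> G" for x y
  proof -
    have "x \<in> univ N" using that sub by auto
    then show ?thesis using pel_eq_iff[OF G(1) F[of x] that] by simp
  qed
  have "bij_betw F (univ N) (univ N)"
    unfolding bij_betw_def
  proof
    show "inj_on F (univ N)" using pel_eq_iff[OF G(1)] F by (meson inj_onI)
    show "F ` univ N = univ N"
    proof
      show "univ N \<subseteq> F ` univ N"
      proof
        fix y assume "y \<in> univ N"
        then obtain x where "(x, y) \<in> G" using G(3) by auto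
        then show "y \<in> F ` univ N" using F_eq sub by (intro image_eqI[of _ _ x]) auto
      qed
    qed (use FN in auto)
  qed
  moreover have "F (fint N f xs) = fint N f (map F xs)" if f: "(f, n) \<in> funs L" "xs \<in> tuples n (univ N)" for f n xs
  proof -
    let ?\<phi> = "Eq (Fn f (map Var [0..<n])) (Var n) :: ('a, 'b) fm"
    let ?e = "\<lambda>i. if i < n then xs ! i else fint N f xs"
    have len: "length xs = n" and val: "fint N f xs \<in> univ N"
      using f str by (fastforce simp: tuples_def is_struct_def)+
    have "?e i \<in> univ N" for i using f val by (auto simp: tuples_def)
    then have "sat N ?e ?\<phi> = sat N (\<lambda>i. F (?e i)) ?\<phi>"
      using f by (intro pel_sat[OF G(1)] F) (auto simp: list_all_iff)
    moreover have "map ?e [0..<n] = xs" using len by (intro nth_equalityI) auto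
    moreover have "map (\<lambda>i. F (?e i)) [0..<n] = map F xs" using len by (intro nth_equalityI) auto
    ultimately show ?thesis by (simp add: comp_def)
  qed
  moreover have "rint N p xs = rint N p (map F xs)" if f: "(p, n) \<in> rels L" "xs \<in> tuples n (univ N)" for p n xs
  proof -
    let ?\<phi> = "Rel p (map Var [0..<n]) :: ('a, 'b) fm"
    have len: "length xs = n" using f by (simp add: tuples_def)
    have "sat N (nth xs) ?\<phi> = sat N (\<lambda>i. F (xs ! i)) ?\<phi>"
      using f by (intro pel_sat[OF G(1)] F) (auto simp: list_all_iff tuples_def)
    moreover have "map (nth xs) [0..<n] = xs" using len by (intro nth_equalityI) auto
    moreover have "map (\<lambda>i. F (xs ! i)) [0..<n] = map F xs" using len by (intro nth_equalityI) auto
    ultimately show ?thesis by (simp add: comp_def)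
  qed
  ultimately have "automorphism L N F" by (auto simp: automorphism_def)
  then show thesis using F_eq that by blast
qed

text \<open>Elements are tagged with levels: the added ones get level \<open>Suc k\<close> and
  cannot collide with old ones. So \<open>M\<close> is literally contained in \<open>M'\<close>, as
  \<open>elementary_chain\<close> requires.\<close>

lemma pel_forth:
  fixes L :: "('f, 'p) lang" and M :: "('f, 'p, nat \<times> 'm) struct"
  assumes large: "{\<phi>. wf_fm L \<phi>} \<lesssim> (UNIV :: 'm set)"
    and str: "is_struct L M" and lev: "univ M \<subseteq> {..k} \<times> UNIV" and g: "pel L M g"
  obtains M' :: "('f, 'p, nat \<times> 'm) struct" and g'
  where "is_struct L M'" "elem L M M' id" "univ M' \<subseteq> {..Suc k} \<times> UNIV" "pel L M' g'"
    "g \<subseteq> g'" "univ M \<subseteq> Domain g'"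
proof -
  obtain a where a: "a \<in> univ M" using str by (auto simp: is_struct_def)
  have gM: "g \<subseteq> univ M \<times> univ M" using g by (simp add: pel_def)
  let ?A = "Domain g"
  define f where "f x = (SOME y. (x, y) \<in> g)" for x
  have f: "(x, f x) \<in> g" if "x \<in> ?A" for x using that someI_ex[of "\<lambda>y. (x, y) \<in> g"] by (auto simp: f_def)
  have f_eq: "f x = y" if "(x, y) \<in> g" for x y
  proof -
    have "x \<in> ?A" using that by auto
    then show ?thesis using pel_eq_iff[OF g f[of x] that] by simp
  qed
  \<comment> \<open>An element of the domain of \<open>g\<close> is named by its prescribed image,
    any other element by a new constant. Realising the diagram of \<open>M\<close> under these names
    yields images for all of \<open>M\<close>.\<close>
  define lab :: "nat \<times> 'm \<Rightarrow> nat \<times> 'm + nat \<times> 'm" where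
    "lab x = (if x \<in> ?A then Inl (f x) else Inr x)" for x
  define \<Sigma>0 where "\<Sigma>0 = {(\<phi>, u). wf_fm L \<phi> \<and> range u \<subseteq> univ M \<and> sat M u \<phi>}"
  define F where "F = (\<lambda>(\<phi> :: ('f, 'p) fm, u :: nat \<Rightarrow> nat \<times> 'm). (\<phi>, \<lambda>n. lab (u n)))"
  have inf: "infinite (UNIV :: 'm set)" using large_infinite[OF large] .
  then have "(UNIV :: nat set) \<lesssim> (UNIV :: 'm set)" by (simp add: infinite_le_lepoll)
  then have sm: "(UNIV :: (nat \<times> 'm) set) \<lesssim> (UNIV :: 'm set)"
    using Times_lepoll_infinite[OF inf, of "UNIV :: nat set" "UNIV :: 'm set"] by simp
  have sm': "univ M \<lesssim> (UNIV :: 'm set)" by (rule lepoll_trans[OF subset_imp_lepoll[OF subset_UNIV] sm])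
  have fM: "f x \<in> univ M" if "x \<in> ?A" for x using f[OF that] gM by auto
  have labM: "lab x \<in> Inl ` univ M \<union> range Inr" for x
    by (simp add: lab_def fM del: Domain_iff)
  have wf\<Sigma>: "wf_fm L \<phi> \<and> range v \<subseteq> Inl ` univ M \<union> range Inr" if mem: "(\<phi>, v) \<in> F ` \<Sigma>0" for \<phi> v
  proof -
    obtain \<sigma> where \<sigma>: "(\<phi>, v) = F \<sigma>" "\<sigma> \<in> \<Sigma>0" using mem by (rule imageE)
    obtain \<psi> u where "\<sigma> = (\<psi>, u)" by (cases \<sigma>)
    with \<sigma> have u: "v = (\<lambda>n. lab (u n))" "wf_fm L \<phi>" by (simp_all add: F_def \<Sigma>0_def)
    show ?thesis unfolding u(1) by (intro conjI u(2) image_subsetI labM)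
  qed
  have fin\<Sigma>: "\<exists>\<nu>. range \<nu> \<subseteq> univ M \<and> (\<forall>(\<phi>, v)\<in>S. sat M (\<lambda>n. case_sum id \<nu> (v n)) \<phi>)"
    if S: "finite S" "S \<subseteq> F ` \<Sigma>0" for S
  proof -
    from finite_subset_image[OF S] obtain S0 where S0: "finite S0" "S0 \<subseteq> \<Sigma>0" "S = F ` S0" by auto
    have "wf_fm L \<phi> \<and> range u \<subseteq> univ M \<and> sat M u \<phi>" if "(\<phi>, u) \<in> S0" for \<phi> u
      using that S0(2) by (auto simp: \<Sigma>0_def)
    then obtain \<nu> where \<nu>: "range \<nu> \<subseteq> univ M" "\<And>x y. (x, y) \<in> g \<Longrightarrow> \<nu> x = y"
      "\<And>\<phi> u. (\<phi>, u) \<in> S0 \<Longrightarrow> sat M (\<lambda>n. \<nu> (u n)) \<phi>" using pel_finite[OF str g S0(1)] by blast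
    have "case_sum id \<nu> (lab x) = \<nu> x" for x using \<nu>(2)[OF f] by (auto simp: lab_def)
    then have "(\<lambda>n. case_sum id \<nu> (lab (u n))) = (\<lambda>n. \<nu> (u n))" for u :: "nat \<Rightarrow> nat \<times> 'm"
      by (rule ext)
    with \<nu>(3) have "\<forall>(\<phi>, v)\<in>S. sat M (\<lambda>n. case_sum id \<nu> (v n)) \<phi>" by (auto simp: S0(3) F_def)
    with \<nu>(1) show ?thesis by blast
  qed
  obtain N :: "('f, 'p, 'm) struct" and j \<nu> where N: "is_struct L N" "elem L M N j" "range \<nu> \<subseteq> univ N"
    and N_sat: "\<And>\<phi> v. (\<phi>, v) \<in> F ` \<Sigma>0 \<Longrightarrow> sat N (\<lambda>n. case_sum j \<nu> (v n)) \<phi>"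
    using realize[OF str large sm' sm, of "F ` \<Sigma>0", OF wf\<Sigma> fin\<Sigma>] by blast
  \<comment> \<open>Old elements return to their original place; all others are put on the new
    level.\<close>
  define h where "h y = (if y \<in> j ` univ M then inv_into (univ M) j y else (Suc k, y))" for y
  have hj: "h (j x) = x" if "x \<in> univ M" for x
    using that elem_inj[OF N(2)] by (simp add: h_def)
  have "h y \<in> univ M" if "y \<in> j ` univ M" for y using that hj by auto
  then have h_old: "fst (h y) \<le> k" if "y \<in> j ` univ M" for y using that lev by fastforce
  have h_new: "fst (h y) = Suc k" if "y \<notin> j ` univ M" for y using that by (simp add: h_def)
  have h_inj: "inj_on h (univ N)"
  proof (rule inj_onI)
    fix x y assume xy: "h x = h y"
    show "x = y"
    proof (cases "x \<in> j ` univ M \<longleftrightarrow> y \<in> j ` univ M")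
      case True
      show ?thesis
      proof (cases "x \<in> j ` univ M")
        case x: True
        with True obtain x' y' where "x = j x'" "x' \<in> univ M" "y = j y'" "y' \<in> univ M" by auto
        with xy hj show ?thesis by simp
      qed (use True xy in \<open>simp add: h_def\<close>)
    next
      case False
      then have "fst (h x) \<le> k \<and> fst (h y) = Suc k \<or> fst (h y) \<le> k \<and> fst (h x) = Suc k"
        using h_old h_new by blast
      with xy show ?thesis by auto
    qed
  qed
  let ?M = "transport h N"
  note T = transport[OF N(1) h_inj]
  have el: "elem L M ?M id"
    by (rule elem_cong[OF elem_trans[OF N(2) T(2)]]) (simp add: hj)
  define K where "K x = h (case_sum j \<nu> (lab x))" for x
  have NK: "case_sum j \<nu> (lab x) \<in> univ N" for x
    using labM[of x] N(3) elem_in[OF N(2)] by auto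
  then have KM: "K x \<in> univ ?M" for x by (simp add: K_def)
  have K_f: "K x = f x" if "x \<in> ?A" for x
    using that hj[OF fM[OF that]] by (simp add: K_def lab_def)
  have K1: "sat ?M (\<lambda>n. K (u n)) \<phi>" if "wf_fm L \<phi>" "range u \<subseteq> univ M" "sat M u \<phi>" for \<phi> u
  proof -
    have "sat N (\<lambda>n. case_sum j \<nu> (lab (u n))) \<phi>"
      using that by (intro N_sat image_eqI[of _ _ "(\<phi>, u)"]) (auto simp: F_def \<Sigma>0_def)
    moreover have "range (\<lambda>n. case_sum j \<nu> (lab (u n))) \<subseteq> univ N"
      by (intro image_subsetI NK)
    with T(2) that(1) have "sat N (\<lambda>n. case_sum j \<nu> (lab (u n))) \<phi> = sat ?M (\<lambda>n. h (case_sum j \<nu> (lab (u n)))) \<phi>"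
      unfolding elem_def by blast
    ultimately show ?thesis unfolding K_def by blast
  qed
  have K: "sat ?M (\<lambda>n. K (u n)) \<phi> = sat M u \<phi>" if "wf_fm L \<phi>" "range u \<subseteq> univ M" for \<phi> u
    using K1[OF that] K1[of "Neg \<phi>" u] that by auto
  let ?g = "{(x, K x) | x. x \<in> univ M}"
  have "pel L ?M ?g"
    unfolding pel_def
  proof (intro conjI allI impI)
    show "?g \<subseteq> univ ?M \<times> univ ?M" using KM elem_in[OF el] by auto
    fix \<phi> e e' assume *: "wf_fm L \<phi> \<and> (\<forall>n\<in>fv \<phi>. (e n, e' n) \<in> ?g)"
    let ?u = "\<lambda>n. if n \<in> fv \<phi> then e n else a"
    have u: "range ?u \<subseteq> univ M" using * a by auto
    have "sat ?M e \<phi> = sat ?M ?u \<phi>" by (rule sat_cong) simp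
    also have "\<dots> = sat M ?u \<phi>" using el * u by (simp add: elem_def)
    also have "\<dots> = sat ?M (\<lambda>n. K (?u n)) \<phi>" using K * u by simp
    also have "\<dots> = sat ?M e' \<phi>" by (rule sat_cong) (use * in auto)
    finally show "sat ?M e \<phi> = sat ?M e' \<phi>" .
  qed
  moreover have "univ ?M \<subseteq> {..Suc k} \<times> UNIV"
  proof
    fix y assume "y \<in> univ ?M"
    then obtain z where z: "y = h z" by auto
    show "y \<in> {..Suc k} \<times> UNIV"
    proof (cases "z \<in> j ` univ M")
      case True
      with h_old z show ?thesis by (cases y) fastforce
    qed (simp add: z h_def)
  qed
  moreover have "g \<subseteq> ?g"
  proof
    fix p assume p: "p \<in> g"
    obtain x y where xy: "p = (x, y)" by (cases p)
    have "x \<in> ?A" "x \<in> univ M" using p xy gM by auto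
    then have "K x = y" using K_f f_eq p xy by simp
    then show "p \<in> ?g" using xy \<open>x \<in> univ M\<close> by blast
  qed
  moreover have "univ M \<subseteq> Domain ?g" by auto
  ultimately show thesis using T(1) el that by blast
qed

text \<open>Equality of types over the empty set, for two tuples of one structure. Equality over
  parameters is expressed by repeating the parameters in both tuples, as in
  \<open>tp L M [a, b] [a, b']\<close>.\<close>

definition tp :: "('f, 'p) lang \<Rightarrow> ('f, 'p, 'a) struct \<Rightarrow> 'a list \<Rightarrow> 'a list \<Rightarrow> bool" where
  "tp L M xs ys \<longleftrightarrow> length xs = length ys \<and>
     (\<forall>\<phi>. wf_fm L \<phi> \<and> fv \<phi> \<subseteq> {..<length xs} \<longrightarrow> sat M (nth xs) \<phi> = sat M (nth ys) \<phi>)"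

text \<open>A formula whose variables are matched by pairs of the zip becomes a formula about the
  whole tuples once each variable is renamed to a position.\<close>

lemma tp_pel:
  assumes "tp L M xs ys" "set xs \<subseteq> univ M" "set ys \<subseteq> univ M"
  shows "pel L M (set (zip xs ys))"
  unfolding pel_def
proof (intro conjI allI impI)
  show "set (zip xs ys) \<subseteq> univ M \<times> univ M" using assms(2,3) by (auto dest: set_zip_leftD set_zip_rightD)
  fix \<phi> e e' assume *: "wf_fm L \<phi> \<and> (\<forall>n\<in>fv \<phi>. (e n, e' n) \<in> set (zip xs ys))"
  then have "\<forall>n\<in>fv \<phi>. \<exists>i. i < length xs \<and> e n = xs ! i \<and> e' n = ys ! i" by (auto simp: set_zip)
  then obtain s where s: "\<And>n. n \<in> fv \<phi> \<Longrightarrow> s n < length xs \<and> e n = xs ! s n \<and> e' n = ys ! s n" by metis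
  have "sat M e \<phi> = sat M (\<lambda>n. xs ! s n) \<phi>" by (rule sat_cong) (use s in auto)
  also have "\<dots> = sat M (nth xs) (ren s \<phi>)" by simp
  also have "\<dots> = sat M (nth ys) (ren s \<phi>)"
  proof -
    have "fv (ren s \<phi>) \<subseteq> {..<length xs}" using s by auto
    moreover have "wf_fm L (ren s \<phi>)" using * by simp
    ultimately show ?thesis using assms(1) unfolding tp_def by blast
  qed
  also have "\<dots> = sat M (\<lambda>n. ys ! s n) \<phi>" by simp
  also have "\<dots> = sat M e' \<phi>" by (rule sat_cong) (use s in auto)
  finally show "sat M e \<phi> = sat M e' \<phi>" .
qed

text \<open>Back and forth along a chain of extensions: \<open>pel_forth\<close> puts the current
  universe into the domain and, applied to the converse graph, into the range. The union of all
  graphs is then total and onto on the union of the structures.\<close>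

theorem extend_to_automorphism:
  fixes L :: "('f, 'p) lang" and M :: "('f, 'p, 'm) struct"
  assumes large: "{\<phi>. wf_fm L \<phi>} \<lesssim> (UNIV :: 'm set)" and str: "is_struct L M"
    and t: "tp L M xs ys" "set xs \<subseteq> univ M" "set ys \<subseteq> univ M"
  obtains N :: "('f, 'p, 'm) struct" and j F where "is_struct L N" "elem L M N j" "automorphism L N F"
    "map (\<lambda>x. F (j x)) xs = map j ys"
proof -
  let ?h = "\<lambda>x :: 'm. (0 :: nat, x)"
  let ?M0 = "transport ?h M" and ?g0 = "map_prod ?h ?h ` set (zip xs ys)"
  have "inj_on ?h (univ M)" by (auto simp: inj_on_def)
  note T0 = transport[OF str this]
  have ne: "univ M \<noteq> {}" using str by (simp add: is_struct_def)
  \<comment> \<open>A state is a level bound, a structure and a graph. One step of the recursion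
    goes forth and back, which raises the bound by two.\<close>
  define ok where "ok = (\<lambda>(k :: nat, M :: ('f, 'p, nat \<times> 'm) struct, g).
      is_struct L M \<and> univ M \<subseteq> {..k} \<times> UNIV \<and> pel L M g)"
  define R where "R = (\<lambda>(k :: nat, M :: ('f, 'p, nat \<times> 'm) struct, g) (k' :: nat, M' :: ('f, 'p, nat \<times> 'm) struct, g').
      elem L M M' id \<and> g \<subseteq> g' \<and> univ M \<subseteq> Domain g' \<and> univ M \<subseteq> Range g')"
  have ok0: "ok (0, ?M0, ?g0)"
    using T0 pel_elem[OF tp_pel[OF t] T0(2) ne] by (auto simp: ok_def)
  have step: "\<exists>s'. ok s' \<and> R s s'" if "ok s" for s
  proof -
    obtain k M g where s: "s = (k, M, g)" by (cases s)
    with that have "is_struct L M" "univ M \<subseteq> {..k} \<times> UNIV" "pel L M g" by (auto simp: ok_def)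
    then obtain M1 g1 where 1: "is_struct L M1" "elem L M M1 id" "univ M1 \<subseteq> {..Suc k} \<times> UNIV" "pel L M1 g1"
      "g \<subseteq> g1" "univ M \<subseteq> Domain g1" by (rule pel_forth[OF large])
    from 1(1,3) pel_converse[OF 1(4)] obtain M2 g2 where 2: "is_struct L M2" "elem L M1 M2 id"
      "univ M2 \<subseteq> {..Suc (Suc k)} \<times> UNIV" "pel L M2 g2" "g1\<inverse> \<subseteq> g2" "univ M1 \<subseteq> Domain g2"
      by (rule pel_forth[OF large])
    have "ok (Suc (Suc k), M2, g2\<inverse>)" using 2 pel_converse[OF 2(4)] by (simp add: ok_def)
    moreover have "R s (Suc (Suc k), M2, g2\<inverse>)"
    proof -
      have "g1 \<subseteq> g2\<inverse>" "univ M \<subseteq> univ M1" using 2(5) elem_in[OF 1(2)] by auto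
      then have "g \<subseteq> g2\<inverse>" "univ M \<subseteq> Domain (g2\<inverse>)" "univ M \<subseteq> Range (g2\<inverse>)"
        using 1(5,6) 2(6) by (blast, blast, simp)
      then show ?thesis using elem_trans[OF 1(2) 2(2)] unfolding s R_def by simp
    qed
    ultimately show ?thesis by blast
  qed
  obtain c where c0: "c 0 = (0, ?M0, ?g0)" and c: "\<And>n. ok (c n)" "\<And>n. R (c n) (c (Suc n))"
  proof -
    have "\<exists>c. \<forall>n. (ok (c n) \<and> (n = 0 \<longrightarrow> c n = (0, ?M0, ?g0))) \<and> R (c n) (c (Suc n))"
      by (rule dependent_nat_choice[where Q = "\<lambda>_. R"]) (use ok0 step in auto)
    then show thesis using that by blast
  qed
  define C where "C n = fst (snd (c n))" for n
  define g where "g n = snd (snd (c n))" for n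
  have C: "is_struct L (C n)" "pel L (C n) (g n)" "elem L (C n) (C (Suc n)) id" "g n \<subseteq> g (Suc n)"
    "univ (C n) \<subseteq> Domain (g (Suc n))" "univ (C n) \<subseteq> Range (g (Suc n))" for n
    using c(1)[of n] c(2)[of n] by (auto simp: ok_def R_def C_def g_def split: prod.splits)
  obtain N where N: "univ N = (\<Union>n. univ (C n))" "is_struct L N" "\<And>n. elem L (C n) N id"
    using elementary_chain[where C = C, OF C(1,3)] by blast
  have gN: "pel L N (g n)" for n
    using pel_elem[OF C(2) N(3)] C(1)[of n] by (simp add: is_struct_def map_prod.id)
  have g_mono: "g m \<subseteq> g n" if "m \<le> n" for m n
    using that by (rule lift_Suc_mono_le[of g, rotated]) (rule C(4))
  have G: "pel L N (\<Union>n. g n)"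
    unfolding pel_def
  proof (intro conjI allI impI)
    show "(\<Union>n. g n) \<subseteq> univ N \<times> univ N" using gN unfolding pel_def by blast
    fix \<phi> e e' assume *: "wf_fm L \<phi> \<and> (\<forall>n\<in>fv \<phi>. (e n, e' n) \<in> (\<Union>n. g n))"
    have "\<exists>k. \<forall>n\<in>A. (e n, e' n) \<in> g k" if "finite A" "A \<subseteq> fv \<phi>" for A
      using that
    proof (induction A rule: finite_induct)
      case (insert x A)
      then obtain k l where "\<forall>n\<in>A. (e n, e' n) \<in> g k" "(e x, e' x) \<in> g l" using * by auto
      then have "\<forall>n\<in>insert x A. (e n, e' n) \<in> g (max k l)"
        using g_mono[of k "max k l"] g_mono[of l "max k l"] by auto
      then show ?case ..
    qed simp
    from this[OF finite_fv] obtain k where k: "\<forall>n\<in>fv \<phi>. (e n, e' n) \<in> g k" by blast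
    show "sat N e \<phi> = sat N e' \<phi>" by (rule pel_sat[OF gN[of k]]) (use * k in auto)
  qed
  have dom: "univ N \<subseteq> Domain (\<Union>n. g n)" "univ N \<subseteq> Range (\<Union>n. g n)"
  proof -
    have "univ (C n) \<subseteq> Domain (\<Union>n. g n)" for n using C(5)[of n] by blast
    then show "univ N \<subseteq> Domain (\<Union>n. g n)" unfolding N(1) by (rule UN_least)
    have "univ (C n) \<subseteq> Range (\<Union>n. g n)" for n using C(6)[of n] by blast
    then show "univ N \<subseteq> Range (\<Union>n. g n)" unfolding N(1) by (rule UN_least)
  qed
  have inf: "infinite (UNIV :: 'm set)" using large_infinite[OF large] .
  then have "(UNIV :: nat set) \<lesssim> (UNIV :: 'm set)" by (simp add: infinite_le_lepoll)
  then have "(UNIV :: (nat \<times> 'm) set) \<lesssim> (UNIV :: 'm set)"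
    using Times_lepoll_infinite[OF inf, of "UNIV :: nat set" "UNIV :: 'm set"] by simp
  \<comment> \<open>The limit occupies all levels. As \<open>'m\<close> is infinite, tagged elements
    can be coded in \<open>'m\<close> again, and the result lies on the type that (SLB) speaks
    about.\<close>
  then obtain p :: "nat \<times> 'm \<Rightarrow> 'm" where p: "inj p" unfolding lepoll_def by auto
  then have "inj_on p (univ N)" by (rule inj_on_subset) simp
  note T = transport[OF N(2) this]
  let ?N = "transport p N" and ?G = "map_prod p p ` (\<Union>n. g n)"
  have neN: "univ N \<noteq> {}" using N(2) by (simp add: is_struct_def)
  have GN: "pel L ?N ?G" by (rule pel_elem[OF G T(2) neN])
  have "(\<Union>n. g n) \<subseteq> univ N \<times> univ N" using G by (simp add: pel_def)
  then have "Domain (\<Union>n. g n) = univ N" "Range (\<Union>n. g n) = univ N"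
    using dom by (blast, blast)
  moreover have "Domain (map_prod p p ` H) = p ` Domain H" "Range (map_prod p p ` H) = p ` Range H" for H
    by force+
  ultimately have "Domain ?G = univ ?N" "Range ?G = univ ?N" by simp_all
  then obtain F where F: "automorphism L ?N F" "\<And>x y. (x, y) \<in> ?G \<Longrightarrow> F x = y"
    using pel_automorphism[OF T(1) GN] by blast
  have M0: "C 0 = ?M0" "g 0 = ?g0" by (simp_all add: C_def g_def c0)
  have "elem L M N (id \<circ> ?h)" using elem_trans[OF T0(2), of N id] N(3)[of 0] M0 by simp
  from elem_trans[OF this T(2)] have "elem L M ?N (\<lambda>x. p (?h x))" by (simp add: comp_def)
  moreover have "map (\<lambda>x. F (p (?h x))) xs = map (\<lambda>x. p (?h x)) ys"
  proof (rule nth_equalityI)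
    show "length (map (\<lambda>x. F (p (?h x))) xs) = length (map (\<lambda>x. p (?h x)) ys)" using t by (simp add: tp_def)
    fix i assume i: "i < length (map (\<lambda>x. F (p (?h x))) xs)"
    then have "(xs ! i, ys ! i) \<in> set (zip xs ys)" using t(1) by (auto simp: tp_def set_zip)
    then have "(?h (xs ! i), ?h (ys ! i)) \<in> g 0" unfolding M0 by force
    then have "(p (?h (xs ! i)), p (?h (ys ! i))) \<in> ?G" by force
    from F(2)[OF this] show "map (\<lambda>x. F (p (?h x))) xs ! i = map (\<lambda>x. p (?h x)) ys ! i"
      using i t(1) by (simp add: tp_def)
  qed
  ultimately show thesis using T(1) F(1) that by blast
qed

section \<open>Types of tuples\<close>

lemma tp_refl: "tp L M xs xs"
  by (simp add: tp_def)

lemma tp_sym: "tp L M xs ys \<Longrightarrow> tp L M ys xs"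
  unfolding tp_def by metis

lemma tp_trans: "tp L M xs ys \<Longrightarrow> tp L M ys zs \<Longrightarrow> tp L M xs zs"
  unfolding tp_def by metis

text \<open>Positions may be repeated and permuted, so restriction, reordering and duplication of
  entries are all covered.\<close>

lemma tp_sub:
  assumes "tp L M xs ys" "\<And>i. i \<in> set is \<Longrightarrow> i < length xs"
  shows "tp L M (map (nth xs) is) (map (nth ys) is)"
  unfolding tp_def
proof (intro conjI allI impI)
  fix \<phi> assume *: "wf_fm L \<phi> \<and> fv \<phi> \<subseteq> {..<length (map ((!) xs) is)}"
  let ?s = "\<lambda>n. is ! n"
  have "sat M (nth (map (nth zs) is)) \<phi> = sat M (nth zs) (ren ?s \<phi>)" for zs
    unfolding sat_ren by (rule sat_cong) (use * in auto)
  moreover have "fv (ren ?s \<phi>) \<subseteq> {..<length xs}" using * assms(2) by auto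
  then have "sat M (nth xs) (ren ?s \<phi>) = sat M (nth ys) (ren ?s \<phi>)"
    using assms(1) * unfolding tp_def by (metis wf_ren)
  ultimately show "sat M (nth (map (nth xs) is)) \<phi> = sat M (nth (map (nth ys) is)) \<phi>" by blast
qed simp

lemma elem_sat_nth:
  assumes "elem L M N j" "is_struct L M" "set xs \<subseteq> univ M" "wf_fm L \<phi>" "fv \<phi> \<subseteq> {..<length xs}"
  shows "sat N (nth (map j xs)) \<phi> = sat M (nth xs) \<phi>"
proof -
  have "sat N (nth (map j xs)) \<phi> = sat N (\<lambda>n. j (xs ! n)) \<phi>"
    by (rule sat_cong) (use assms(5) in auto)
  also have "\<dots> = sat M (nth xs) \<phi>"
  proof (rule elem_sat[symmetric, OF assms(1,4)])
    show "nth xs ` fv \<phi> \<subseteq> univ M" using assms(3,5) nth_mem by fastforce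
    show "univ M \<noteq> {}" using assms(2) by (simp add: is_struct_def)
  qed
  finally show ?thesis .
qed

lemma tp_elem:
  assumes "elem L M N j" "is_struct L M" "set xs \<subseteq> univ M" "set ys \<subseteq> univ M"
  shows "tp L N (map j xs) (map j ys) \<longleftrightarrow> tp L M xs ys"
  using elem_sat_nth[OF assms(1,2,3)] elem_sat_nth[OF assms(1,2,4)] unfolding tp_def
  by (auto simp: length_map)

section \<open>Automorphisms\<close>

lemma automorphism_in: "automorphism L M f \<Longrightarrow> x \<in> univ M \<Longrightarrow> f x \<in> univ M"
  by (auto simp: automorphism_def bij_betw_def)

lemma automorphism_eq_iff:
  "automorphism L M f \<Longrightarrow> x \<in> univ M \<Longrightarrow> y \<in> univ M \<Longrightarrow> f x = f y \<longleftrightarrow> x = y"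
  by (auto simp: automorphism_def bij_betw_def inj_on_eq_iff)

lemma automorphism_fint:
  "automorphism L M h \<Longrightarrow> (f, n) \<in> funs L \<Longrightarrow> xs \<in> tuples n (univ M) \<Longrightarrow> h (fint M f xs) = fint M f (map h xs)"
  by (fastforce simp: automorphism_def)

lemma automorphism_rint:
  "automorphism L M h \<Longrightarrow> (p, n) \<in> rels L \<Longrightarrow> xs \<in> tuples n (univ M) \<Longrightarrow> rint M p xs = rint M p (map h xs)"
  by (fastforce simp: automorphism_def)

lemma automorphism_elem:
  assumes "is_struct L M" "automorphism L M f"
  shows "elem L M M f"
proof (rule isomorphism_elem[OF assms(1)])
  show "inj_on f (univ M)" "f ` univ M = univ M"
    using assms(2) by (simp_all add: automorphism_def bij_betw_def)
qed (rule automorphism_fint[OF assms(2)] automorphism_rint[OF assms(2)]; assumption)+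

lemma automorphism_comp:
  assumes "automorphism L M f" "automorphism L M g"
  shows "automorphism L M (\<lambda>x. f (g x))"
proof -
  have t: "map g xs \<in> tuples n (univ M)" if "xs \<in> tuples n (univ M)" for xs n
    using that automorphism_in[OF assms(2)] by (auto simp: tuples_def)
  have "bij_betw (\<lambda>x. f (g x)) (univ M) (univ M)"
    using assms bij_betw_trans[of g "univ M" "univ M" f "univ M"]
    by (simp add: automorphism_def comp_def)
  moreover have "f (g (fint M k xs)) = fint M k (map (\<lambda>x. f (g x)) xs)"
    if "(k, n) \<in> funs L" "xs \<in> tuples n (univ M)" for k n xs
    using automorphism_fint[OF assms(2) that] automorphism_fint[OF assms(1) that(1) t[OF that(2)]]
    by (simp add: comp_def)
  moreover have "rint M p xs = rint M p (map (\<lambda>x. f (g x)) xs)"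
    if "(p, n) \<in> rels L" "xs \<in> tuples n (univ M)" for p n xs
    using automorphism_rint[OF assms(2) that] automorphism_rint[OF assms(1) that(1) t[OF that(2)]]
    by (simp add: comp_def)
  ultimately show ?thesis unfolding automorphism_def by blast
qed

lemma automorphism_inv:
  assumes str: "is_struct L M" and aut: "automorphism L M f"
  shows "automorphism L M (inv_into (univ M) f)" (is "automorphism L M ?g")
proof -
  have bij: "bij_betw f (univ M) (univ M)" using aut by (simp add: automorphism_def)
  then have gin: "?g x \<in> univ M" "f (?g x) = x" if "x \<in> univ M" for x
    using that by (auto simp: bij_betw_def f_inv_into_f intro: inv_into_into)
  have gf: "?g (f x) = x" if "x \<in> univ M" for x using that bij by (simp add: bij_betw_def)
  have t: "map ?g xs \<in> tuples n (univ M)" "map f (map ?g xs) = xs" if "xs \<in> tuples n (univ M)" for xs n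
    using that gin by (auto simp: tuples_def intro!: map_idI)
  have "?g (fint M k xs) = fint M k (map ?g xs)" if k: "(k, n) \<in> funs L" "xs \<in> tuples n (univ M)" for k n xs
  proof -
    have "f (fint M k (map ?g xs)) = fint M k xs"
      using automorphism_fint[OF aut k(1) t(1)[OF k(2)]] t(2)[OF k(2)] by simp
    moreover have "fint M k (map ?g xs) \<in> univ M"
      using str k(1) t(1)[OF k(2)] by (fastforce simp: is_struct_def)
    ultimately show ?thesis using gf by metis
  qed
  moreover have "rint M p xs = rint M p (map ?g xs)" if k: "(p, n) \<in> rels L" "xs \<in> tuples n (univ M)" for p n xs
    using automorphism_rint[OF aut k(1) t(1)[OF k(2)]] t(2)[OF k(2)] by simp
  moreover have "bij_betw ?g (univ M) (univ M)" using bij by (rule bij_betw_inv_into)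
  ultimately show ?thesis unfolding automorphism_def by blast
qed

lemma automorphism_tp:
  assumes "is_struct L M" "automorphism L M f" "set xs \<subseteq> univ M"
  shows "tp L M xs (map f xs)"
  using elem_sat_nth[OF automorphism_elem[OF assms(1,2)] assms(1,3)] by (auto simp: tp_def)

section \<open>Linearly ordered theories\<close>

text \<open>\<open>large\<close> makes room on \<open>'m\<close> for the elementary extensions, so
  that \<open>linear\<close>, and later (SLB), applies to them.\<close>

locale linear_theory =
  fixes L :: "('f, 'p) lang" and lt :: 'p and T :: "('f, 'p) fm set" and ty :: "'m itself"
  assumes lt_symbol: "(lt, 2) \<in> rels L"
    and large: "{\<phi>. wf_fm L \<phi>} \<lesssim> (UNIV :: 'm set)"
    and sentences: "\<And>\<sigma>. \<sigma> \<in> T \<Longrightarrow> sentence L \<sigma>"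
    and linear: "\<And>M :: ('f, 'p, 'm) struct. is_model L T M \<Longrightarrow> lin_ordered M lt"
begin

abbreviation model :: "('f, 'p, 'm) struct \<Rightarrow> bool" where
  "model \<equiv> is_model L T"

abbreviation less :: "('f, 'p, 'm) struct \<Rightarrow> 'm \<Rightarrow> 'm \<Rightarrow> bool" where
  "less M x y \<equiv> rint M lt [x, y]"

lemma model_struct: "model M \<Longrightarrow> is_struct L M"
  by (simp add: is_model_def)

lemma less_irrefl: "model M \<Longrightarrow> x \<in> univ M \<Longrightarrow> \<not> less M x x"
  using linear[of M] by (auto simp: lin_ordered_def strict_linear_order_on_def irrefl_def ord_rel_def)

lemma less_trans:
  "model M \<Longrightarrow> less M x y \<Longrightarrow> less M y z \<Longrightarrow> x \<in> univ M \<Longrightarrow> y \<in> univ M \<Longrightarrow> z \<in> univ M \<Longrightarrow> less M x z"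
  using linear[of M] unfolding lin_ordered_def strict_linear_order_on_def trans_def ord_rel_def by blast

lemma less_total: "model M \<Longrightarrow> x \<in> univ M \<Longrightarrow> y \<in> univ M \<Longrightarrow> x = y \<or> less M x y \<or> less M y x"
  using linear[of M] by (auto simp: lin_ordered_def strict_linear_order_on_def total_on_def ord_rel_def)

lemma model_elem: "model M \<Longrightarrow> is_struct L N \<Longrightarrow> elem L M N j \<Longrightarrow> model N"
  using elem_holds sentences unfolding is_model_def by blast

lemma less_elem: "elem L M N j \<Longrightarrow> is_struct L M \<Longrightarrow> x \<in> univ M \<Longrightarrow> y \<in> univ M \<Longrightarrow> less N (j x) (j y) = less M x y"
  using elem_rint[OF _ _ lt_symbol, of M N j "[x, y]"] by (simp add: tuples_def)

lemma less_automorphism: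
  "model M \<Longrightarrow> automorphism L M f \<Longrightarrow> x \<in> univ M \<Longrightarrow> y \<in> univ M \<Longrightarrow> less M (f x) (f y) = less M x y"
  using less_elem[OF automorphism_elem] model_struct by blast

lemma automorphism_image_eq:
  assumes "automorphism L M f" "C \<subseteq> univ M" "\<And>x. x \<in> univ M \<Longrightarrow> f x \<in> C \<longleftrightarrow> x \<in> C"
  shows "f ` C = C"
proof
  show "C \<subseteq> f ` C"
  proof
    fix y assume y: "y \<in> C"
    then have "y \<in> f ` univ M" using assms(1,2) by (auto simp: automorphism_def bij_betw_def)
    then obtain x where "x \<in> univ M" "y = f x" by auto
    with y assms(3) show "y \<in> f ` C" by auto
  qed
qed (use assms in auto)

end

section \<open>Consequences of (SLB) for types of pairs and tuples\<close>

locale slb_theory = linear_theory L lt T ty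
  for L :: "('f, 'p) lang" and lt T and ty :: "'m itself" +
  assumes slb: "SLB ty L lt T"
begin

lemma SLB_D:
  assumes "model M" "automorphism L M f" "C \<subseteq> univ M"
    and "\<And>c d. c \<in> C \<Longrightarrow> d \<in> univ M \<Longrightarrow> less M d c \<Longrightarrow> d \<in> C"
    and "\<And>x. x \<in> univ M \<Longrightarrow> f x \<in> C \<longleftrightarrow> x \<in> C"
  shows "automorphism L M (\<lambda>x. if x \<in> C then f x else x)"
proof -
  have "initial_part M lt C" using assms(3,4) by (auto simp: initial_part_def ord_rel_def)
  moreover have "f ` C = C" using assms(2,3,5) by (rule automorphism_image_eq)
  ultimately show ?thesis using slb assms(1,2) unfolding SLB_def by blast
qed

lemma glue_left:
  assumes "model M" "automorphism L M f" "C \<subseteq> univ M"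
    and "\<And>c d. c \<in> C \<Longrightarrow> d \<in> univ M \<Longrightarrow> less M d c \<Longrightarrow> d \<in> C"
    and "\<And>x. x \<in> univ M \<Longrightarrow> f x \<in> C \<longleftrightarrow> x \<in> C"
  obtains g where "automorphism L M g" "\<And>x. x \<in> C \<Longrightarrow> g x = f x" "\<And>x. x \<notin> C \<Longrightarrow> g x = x"
  using SLB_D[OF assms] by (rule that) auto

text \<open>Glue the inverse of \<open>f\<close> on \<open>C\<close> with the identity, then apply
  \<open>f\<close>: the composition is the identity on \<open>C\<close> and \<open>f\<close>
  elsewhere.\<close>

lemma glue_right:
  assumes "model M" "automorphism L M f" "C \<subseteq> univ M"
    and "\<And>c d. c \<in> C \<Longrightarrow> d \<in> univ M \<Longrightarrow> less M d c \<Longrightarrow> d \<in> C"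
    and "\<And>x. x \<in> univ M \<Longrightarrow> f x \<in> C \<longleftrightarrow> x \<in> C"
  obtains g where "automorphism L M g" "\<And>x. x \<in> C \<Longrightarrow> g x = x" "\<And>x. x \<notin> C \<Longrightarrow> g x = f x"
proof -
  let ?f' = "inv_into (univ M) f"
  have img: "f ` univ M = univ M" using assms(2) by (simp add: automorphism_def bij_betw_def)
  have ff': "f (?f' x) = x" "?f' x \<in> univ M" if "x \<in> univ M" for x
    using that by (auto simp: f_inv_into_f img inv_into_into)
  have "automorphism L M (\<lambda>x. if x \<in> C then ?f' x else x)"
  proof (rule SLB_D[OF assms(1) automorphism_inv assms(3,4)])
    fix x assume x: "x \<in> univ M"
    show "?f' x \<in> C \<longleftrightarrow> x \<in> C" using assms(5)[OF ff'(2)[OF x]] ff'(1)[OF x] by simp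
  qed (use assms model_struct in auto)
  from automorphism_comp[OF assms(2) this] show thesis
    by (rule that) (use ff' assms(3) in auto)
qed

text \<open>Glue the identity and an automorphism fixing \<open>c\<close> that takes \<open>b\<close> to \<open>b'\<close>.\<close>

lemma tp_extend_below:
  assumes M: "model M" and inM: "set as \<subseteq> univ M" "c \<in> univ M" "b \<in> univ M" "b' \<in> univ M"
    and below: "\<And>a. a \<in> set as \<Longrightarrow> a = c \<or> less M a c" and cb: "less M c b"
    and t: "tp L M [c, b] [c, b']"
  shows "tp L M (as @ [b]) (as @ [b'])"
proof -
  note str = model_struct[OF M]
  have "set [c, b] \<subseteq> univ M" "set [c, b'] \<subseteq> univ M" using inM by auto
  from extend_to_automorphism[OF large str t this]
  obtain N :: "('f, 'p, 'm) struct" and j F where N: "is_struct L N" "elem L M N j" "automorphism L N F"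
    and "map (\<lambda>x. F (j x)) [c, b] = map j [c, b']" .
  then have F: "F (j c) = j c" "F (j b) = j b'" by auto
  note mN = model_elem[OF M N(1,2)]
  note jin = elem_in[OF N(2)]
  \<comment> \<open>The closed segment up to \<open>c\<close> is invariant because \<open>F\<close>
    fixes \<open>c\<close>. It contains all of \<open>as\<close> and omits \<open>b\<close>.\<close>
  let ?C = "{x \<in> univ N. x = j c \<or> less N x (j c)}"
  have jc: "j c \<in> univ N" using jin inM by blast
  have Ci: "d \<in> ?C" if "x \<in> ?C" "d \<in> univ N" "less N d x" for x d
    using that less_trans[OF mN, of d x "j c"] jc by auto
  have CF: "F x \<in> ?C \<longleftrightarrow> x \<in> ?C" if x: "x \<in> univ N" for x
    using automorphism_eq_iff[OF N(3) x jc] less_automorphism[OF mN N(3) x jc] F(1) x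
      automorphism_in[OF N(3) x] by simp
  have "?C \<subseteq> univ N" by auto
  note C = mN N(3) this Ci CF
  obtain g where g: "automorphism L N g" "\<And>x. x \<in> ?C \<Longrightarrow> g x = x" "\<And>x. x \<notin> ?C \<Longrightarrow> g x = F x"
    by (rule glue_right[OF C]) auto
  have "g (j a) = j a" if "a \<in> set as" for a
  proof -
    have "less N (j a) (j c) = less M a c" using that inM less_elem[OF N(2) str] by auto
    then show ?thesis using that below[OF that] inM jin by (intro g(2)) auto
  qed
  moreover have "g (j b) = j b'"
  proof -
    have bc: "less N (j c) (j b)" using cb inM less_elem[OF N(2) str] by auto
    then have "j b \<noteq> j c" "\<not> less N (j b) (j c)"
      using less_irrefl[OF mN] less_trans[OF mN] jin inM by metis+
    then show ?thesis using g(3)[of "j b"] F by simp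
  qed
  ultimately have eq: "map g (map j (as @ [b])) = map j (as @ [b'])" by simp
  have "tp L N (map j (as @ [b])) (map g (map j (as @ [b])))"
    using jin inM by (intro automorphism_tp[OF N(1) g(1)]) auto
  then show ?thesis unfolding eq using tp_elem[OF N(2) str, of "as @ [b]" "as @ [b']"] inM by simp
qed

text \<open>
  For an automorphism \<open>F\<close> with \<open>a < F a\<close> and \<open>F b < b\<close>, the initial part generated by the
  orbit of \<open>a\<close> separates \<open>a\<close> and \<open>b\<close>.
\<close>

lemma tp_nested:
  assumes M: "model M" and inM: "a \<in> univ M" "a' \<in> univ M" "b' \<in> univ M" "b \<in> univ M"
    and ord: "less M a a'" "less M a' b'" "less M b' b"
    and t: "tp L M [a, b] [a', b']"
  shows "tp L M [a, b] [a', b]" "tp L M [a, b] [a, b']"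
proof -
  note str = model_struct[OF M]
  have "set [a, b] \<subseteq> univ M" "set [a', b'] \<subseteq> univ M" using inM by auto
  from extend_to_automorphism[OF large str t this]
  obtain N :: "('f, 'p, 'm) struct" and j F where N: "is_struct L N" "elem L M N j" "automorphism L N F"
    and "map (\<lambda>x. F (j x)) [a, b] = map j [a', b']" .
  then have F: "F (j a) = j a'" "F (j b) = j b'" by auto
  note mN = model_elem[OF M N(1,2)]
  note jin = elem_in[OF N(2)] and Fin = automorphism_in[OF N(3)]
  note less_j = less_elem[OF N(2) str]
  have pin: "(F ^^ k) (j x) \<in> univ N" if "x \<in> univ M" for k x
    using that jin Fin by (induction k) auto
  let ?le = "\<lambda>x y. x = y \<or> less N x y"
  have F_le: "?le (F x) (F y) \<longleftrightarrow> ?le x y" if "x \<in> univ N" "y \<in> univ N" for x y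
    using less_automorphism[OF mN N(3) that] automorphism_eq_iff[OF N(3) that] by simp
  \<comment> \<open>Nonnegative powers suffice: as \<open>a < F a\<close>, the orbit ascends, so
    \<open>C\<close> is invariant under \<open>F\<close> in both directions.\<close>
  define C where "C = {x \<in> univ N. \<exists>k. ?le x ((F ^^ k) (j a))}"
  have Ci: "d \<in> C" if cd: "c \<in> C" "d \<in> univ N" "less N d c" for c d
  proof -
    obtain k where "?le c ((F ^^ k) (j a))" "c \<in> univ N" using cd(1) by (auto simp: C_def)
    then have "less N d ((F ^^ k) (j a))" using cd less_trans[OF mN cd(3) _ cd(2) _ pin[OF inM(1)]] by auto
    then show ?thesis using cd(2) unfolding C_def by blast
  qed
  have CF: "F x \<in> C \<longleftrightarrow> x \<in> C" if x: "x \<in> univ N" for x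
  proof
    assume "x \<in> C"
    then obtain k where "?le x ((F ^^ k) (j a))" by (auto simp: C_def)
    then have "?le (F x) ((F ^^ Suc k) (j a))" using F_le[OF x pin[OF inM(1)]] by simp
    then show "F x \<in> C" unfolding C_def using Fin[OF x] by blast
  next
    assume "F x \<in> C"
    then obtain k where k: "?le (F x) ((F ^^ k) (j a))" by (auto simp: C_def)
    show "x \<in> C"
    proof (cases k)
      case 0
      with k have "?le (F x) (j a)" by simp
      moreover have "less N (j a) (F (j a))" using ord(1) less_j inM F by simp
      ultimately have "?le (F x) (F (j a))" using less_trans[OF mN] Fin[OF x] jin[OF inM(1)] Fin by metis
      then have "?le x ((F ^^ 0) (j a))" using F_le[OF x jin[OF inM(1)]] by simp
      then show ?thesis using x unfolding C_def by blast
    next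
      case (Suc m)
      with k have "?le x ((F ^^ m) (j a))" using F_le[OF x pin[OF inM(1)]] by simp
      then show ?thesis using x unfolding C_def by blast
    qed
  qed
  have aC: "j a \<in> C" using jin[OF inM(1)] unfolding C_def by (auto intro: exI[of _ 0])
  have ab: "less N (j a) (j b)" using ord less_trans[OF M] inM less_j by metis
  \<comment> \<open>The images of \<open>b\<close> never exceed \<open>b\<close>, and each lies
    above the corresponding image of \<open>a\<close>. Hence the whole orbit of \<open>a\<close>
    stays below \<open>b\<close>.\<close>
  have "?le ((F ^^ k) (j b)) (j b)" for k
  proof (induction k)
    case (Suc k)
    then have "?le ((F ^^ Suc k) (j b)) (F (j b))" using F_le[OF pin[OF inM(4)] jin[OF inM(4)]] by simp
    moreover have "less N (F (j b)) (j b)" using ord(3) less_j inM F by simp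
    ultimately show ?case using less_trans[OF mN] pin[OF inM(4)] jin[OF inM(4)] Fin by metis
  qed simp
  moreover have "less N ((F ^^ k) (j a)) ((F ^^ k) (j b))" for k
  proof (induction k)
    case (Suc k)
    then show ?case using less_automorphism[OF mN N(3) pin[OF inM(1)] pin[OF inM(4)]] by simp
  qed (simp add: ab)
  ultimately have lt_b: "less N ((F ^^ k) (j a)) (j b)" for k
    using less_trans[OF mN] pin inM jin by metis
  have bC: "j b \<notin> C"
  proof
    assume "j b \<in> C"
    then obtain k where "?le (j b) ((F ^^ k) (j a))" by (auto simp: C_def)
    then show False using lt_b[of k] less_irrefl[OF mN] less_trans[OF mN] pin inM jin by metis
  qed
  have "C \<subseteq> univ N" by (auto simp: C_def)
  note C = mN N(3) this Ci CF
  have S: "set [j a, j b] \<subseteq> univ N" using jin inM by auto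
  \<comment> \<open>Moving only the lower part takes \<open>(a, b)\<close> to
    \<open>(a', b)\<close>; moving only the upper part takes it to \<open>(a, b')\<close>.\<close>
  obtain g where g: "automorphism L N g" "\<And>x. x \<in> C \<Longrightarrow> g x = F x" "\<And>x. x \<notin> C \<Longrightarrow> g x = x"
    by (rule glue_left[OF C]) auto
  have "tp L N (map j [a, b]) (map j [a', b])"
    using automorphism_tp[OF N(1) g(1) S] g(2)[OF aC] g(3)[OF bC] F by simp
  then show "tp L M [a, b] [a', b]" using tp_elem[OF N(2) str, of "[a, b]" "[a', b]"] inM by simp
  obtain h where h: "automorphism L N h" "\<And>x. x \<in> C \<Longrightarrow> h x = x" "\<And>x. x \<notin> C \<Longrightarrow> h x = F x"
    by (rule glue_right[OF C]) auto
  have "tp L N (map j [a, b]) (map j [a, b'])"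
    using automorphism_tp[OF N(1) h(1) S] h(2)[OF aC] h(3)[OF bC] F by simp
  then show "tp L M [a, b] [a, b']" using tp_elem[OF N(2) str, of "[a, b]" "[a, b']"] inM by simp
qed

text \<open>Move \<open>b\<close> to \<open>b'\<close> by an automorphism \<open>F\<close> and
  compare \<open>F a\<close> with \<open>a\<close>. If \<open>F a\<close> is above \<open>a\<close>,
  then \<open>(F a, b')\<close> is nested in \<open>(a, b'')\<close>; if it is below, then
  \<open>(a, b)\<close> is nested in \<open>(F a, b')\<close>. Either way \<open>tp_nested\<close>
  lets \<open>a\<close> replace \<open>F a\<close>.\<close>

lemma tp_convex:
  assumes M: "model M" and inM: "a \<in> univ M" "b \<in> univ M" "b' \<in> univ M" "b'' \<in> univ M"
    and ord: "less M a b" "less M b b'" "less M b' b''"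
    and t: "tp L M [a, b] [a, b'']" "tp L M [b] [b']"
  shows "tp L M [a, b] [a, b']"
proof -
  note str = model_struct[OF M]
  have "set [b] \<subseteq> univ M" "set [b'] \<subseteq> univ M" using inM by auto
  from extend_to_automorphism[OF large str t(2) this]
  obtain N :: "('f, 'p, 'm) struct" and j F where N: "is_struct L N" "elem L M N j" "automorphism L N F"
    and "map (\<lambda>x. F (j x)) [b] = map j [b']" .
  then have F: "F (j b) = j b'" by auto
  note mN = model_elem[OF M N(1,2)]
  note jin = elem_in[OF N(2)] and Fin = automorphism_in[OF N(3)]
  note less_j = less_elem[OF N(2) str]
  have "set [j a, j b] \<subseteq> univ N" using jin inM by simp
  from automorphism_tp[OF N(1,3) this] have tF: "tp L N [j a, j b] [F (j a), j b']" using F by simp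
  have tj: "tp L N [j a, j b] [j a, j b'']" using t(1) tp_elem[OF N(2) str, of "[a, b]" "[a, b'']"] inM by simp
  have in': "j a \<in> univ N" "j b \<in> univ N" "j b' \<in> univ N" "j b'' \<in> univ N" "F (j a) \<in> univ N"
    using jin inM Fin by auto
  have o: "less N (j a) (j b)" "less N (j b) (j b')" "less N (j b') (j b'')"
    using ord inM less_j by auto
  have Fa: "less N (F (j a)) (j b')" using less_automorphism[OF mN N(3) in'(1,2)] o F by simp
  consider "F (j a) = j a" | "less N (j a) (F (j a))" | "less N (F (j a)) (j a)"
    using less_total[OF mN in'(1,5)] by auto
  then have "tp L N [j a, j b] [j a, j b']"
  proof cases
    case 1
    with tF show ?thesis by simp
  next
    case 2
    have "tp L N [j a, j b''] [j a, j b']"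
      by (rule tp_nested(2)[OF mN in'(1,5,3,4) 2 Fa o(3)])
        (rule tp_trans[OF tp_sym[OF tj] tF])
    then show ?thesis using tp_trans tj by blast
  next
    case 3
    have "tp L N [F (j a), j b'] [j a, j b']"
      by (rule tp_nested(1)[OF mN in'(5,1,2,3) 3 o(1,2)]) (rule tp_sym[OF tF])
    then show ?thesis using tp_trans tF by blast
  qed
  then show ?thesis using tp_elem[OF N(2) str, of "[a, b]" "[a, b']"] inM by simp
qed

end

section \<open>Cuts, convex equivalence relations and counts of classes\<close>

lemma tpI:
  assumes "length xs = length ys"
    and "\<And>\<phi>. wf_fm L \<phi> \<Longrightarrow> fv \<phi> \<subseteq> {..<length xs} \<Longrightarrow> sat M (nth xs) \<phi> \<Longrightarrow> sat M (nth ys) \<phi>"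
  shows "tp L M xs ys"
  unfolding tp_def
proof (intro conjI allI impI)
  fix \<phi> assume "wf_fm L \<phi> \<and> fv \<phi> \<subseteq> {..<length xs}"
  then show "sat M (nth xs) \<phi> = sat M (nth ys) \<phi>" using assms(2)[of \<phi>] assms(2)[of "Neg \<phi>"] by auto
qed (rule assms(1))

text \<open>Unlike \<open>nth [x]\<close>, the constant assignment has no junk values, so elementary
  maps apply without tracking free variables; \<open>sat2\<close> is chosen for the same
  reason.\<close>

definition sat1 :: "('f, 'p, 'a) struct \<Rightarrow> ('f, 'p) fm \<Rightarrow> 'a \<Rightarrow> bool" where
  "sat1 M \<phi> x = sat M (\<lambda>_. x) \<phi>"

definition sat2 :: "('f, 'p, 'a) struct \<Rightarrow> ('f, 'p) fm \<Rightarrow> 'a \<Rightarrow> 'a \<Rightarrow> bool" where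
  "sat2 M \<phi> x y = sat M (\<lambda>n. if n = 0 then x else y) \<phi>"

lemma sat_nth1: "fv \<phi> \<subseteq> {..<1} \<Longrightarrow> sat M (nth [x]) \<phi> = sat1 M \<phi> x"
  unfolding sat1_def by (rule sat_cong) auto

lemma sat_nth2: "fv \<phi> \<subseteq> {..<2} \<Longrightarrow> sat M (nth [x, y]) \<phi> = sat2 M \<phi> x y"
  unfolding sat2_def by (rule sat_cong) (auto simp: less_2_cases_iff)

lemma tp1_iff: "tp L M [x] [y] \<longleftrightarrow> (\<forall>\<phi>. wf_fm L \<phi> \<and> fv \<phi> \<subseteq> {..<1} \<longrightarrow> sat1 M \<phi> x = sat1 M \<phi> y)"
  unfolding tp_def by (auto simp: sat_nth1[symmetric])

lemma tp2_iff:
  "tp L M [x, y] [x', y'] \<longleftrightarrow> (\<forall>\<phi>. wf_fm L \<phi> \<and> fv \<phi> \<subseteq> {..<2} \<longrightarrow> sat2 M \<phi> x y = sat2 M \<phi> x' y')"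
proof -
  have "length [x, y] = 2" by simp
  then show ?thesis unfolding tp_def by (auto simp only: sat_nth2[symmetric] length_Cons)
qed

lemma sat2_elem:
  assumes "elem L M N j" "is_struct L M" "wf_fm L \<phi>" "x \<in> univ M" "y \<in> univ M"
  shows "sat2 N \<phi> (j x) (j y) = sat2 M \<phi> x y"
proof -
  have "sat M (\<lambda>n. if n = 0 then x else y) \<phi> = sat N (\<lambda>n. j (if n = 0 then x else y)) \<phi>"
    using assms by (intro elem_sat) (auto simp: is_struct_def)
  then show ?thesis by (simp add: sat2_def if_distrib)
qed

context linear_theory
begin

text \<open>The case of \<open>realize\<close> in which all conditions share one labelling: each
  variable is declared once to be a parameter from \<open>M\<close> or an unknown.\<close>

lemma realize_model:
  fixes M :: "('f, 'p, 'm) struct" and v :: "nat \<Rightarrow> 'm + nat"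
  assumes M: "model M" and v: "range v \<subseteq> Inl ` univ M \<union> range Inr"
    and wf: "\<And>\<phi>. \<phi> \<in> \<Gamma> \<Longrightarrow> wf_fm L \<phi>"
    and fin: "\<And>S. finite S \<Longrightarrow> S \<subseteq> \<Gamma> \<Longrightarrow>
       \<exists>\<nu>. range \<nu> \<subseteq> univ M \<and> (\<forall>\<phi>\<in>S. sat M (\<lambda>n. case_sum id \<nu> (v n)) \<phi>)"
  obtains N :: "('f, 'p, 'm) struct" and j \<nu> where "model N" "elem L M N j"
    "range \<nu> \<subseteq> univ N" "\<And>\<phi>. \<phi> \<in> \<Gamma> \<Longrightarrow> sat N (\<lambda>n. case_sum j \<nu> (v n)) \<phi>"
proof -
  let ?F = "\<lambda>\<phi> :: ('f, 'p) fm. (\<phi>, v)"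
  have small: "univ M \<lesssim> (UNIV :: 'm set)" "(UNIV :: nat set) \<lesssim> (UNIV :: 'm set)"
    using large_infinite[OF large] by (auto simp: subset_imp_lepoll infinite_le_lepoll)
  have wf': "wf_fm L \<phi> \<and> range u \<subseteq> Inl ` univ M \<union> range Inr" if "(\<phi>, u) \<in> ?F ` \<Gamma>" for \<phi> u
    using that wf v by auto
  have fin': "\<exists>\<nu>. range \<nu> \<subseteq> univ M \<and> (\<forall>(\<phi>, v)\<in>S. sat M (\<lambda>n. case_sum id \<nu> (v n)) \<phi>)"
    if S: "finite S" "S \<subseteq> ?F ` \<Gamma>" for S
  proof -
    from finite_subset_image[OF S] obtain S0 where S0: "S0 \<subseteq> \<Gamma>" "finite S0" "S = ?F ` S0" by auto
    from fin[OF S0(2,1)] show ?thesis by (simp add: S0(3))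
  qed
  obtain N :: "('f, 'p, 'm) struct" and j \<nu> where N: "is_struct L N" "elem L M N j" "range \<nu> \<subseteq> univ N"
    "\<And>\<phi> u. (\<phi>, u) \<in> ?F ` \<Gamma> \<Longrightarrow> sat N (\<lambda>n. case_sum j \<nu> (u n)) \<phi>"
    by (rule realize[OF model_struct[OF M] large small wf' fin']) auto
  show thesis
  proof (rule that)
    show "model N" by (rule model_elem[OF M N(1,2)])
    show "sat N (\<lambda>n. case_sum j \<nu> (v n)) \<phi>" if "\<phi> \<in> \<Gamma>" for \<phi> using that by (intro N(4)) auto
  qed (rule N)+
qed

abbreviation Lt :: "nat \<Rightarrow> nat \<Rightarrow> ('f, 'p) fm" where
  "Lt a b \<equiv> Rel lt [Var a, Var b]"

text \<open>The cut of \<open>x\<close>: the downward closure of the set of all \<open>z\<close>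
  with \<open>\<rho>(x, z)\<close>. The negated \<open>less\<close> plays the part of the weak
  order.\<close>

definition down :: "('f, 'p, 'm) struct \<Rightarrow> ('f, 'p) fm \<Rightarrow> 'm \<Rightarrow> 'm \<Rightarrow> bool" where
  "down M \<rho> x y \<longleftrightarrow> (\<exists>z\<in>univ M. sat2 M \<rho> x z \<and> \<not> less M z y)"

text \<open>The bound variable \<open>a + b + 1\<close> differs from both \<open>a\<close> and
  \<open>b\<close>.\<close>

definition down_fm :: "('f, 'p) fm \<Rightarrow> nat \<Rightarrow> nat \<Rightarrow> ('f, 'p) fm" where
  "down_fm \<rho> a b = Exists (a + b + 1)
     (And (ren (\<lambda>n. if n = 0 then a else a + b + 1) \<rho>) (Neg (Lt (a + b + 1) b)))"

lemma sat_down_fm: "sat M e (down_fm \<rho> a b) \<longleftrightarrow> down M \<rho> (e a) (e b)"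
proof -
  have eq: "sat M (\<lambda>n. (e(a + b + 1 := z)) (if n = 0 then a else a + b + 1)) \<rho> = sat2 M \<rho> (e a) z" for z
    unfolding sat2_def by (rule sat_cong) auto
  show ?thesis unfolding down_fm_def down_def sat.simps sat_ren eq by simp
qed

lemma wf_down_fm: "wf_fm L \<rho> \<Longrightarrow> wf_fm L (down_fm \<rho> a b)"
  using lt_symbol by (simp add: down_fm_def numeral_2_eq_2)

lemma fv_down_fm: "fv (down_fm \<rho> a b) \<subseteq> {a, b}"
  by (auto simp: down_fm_def)

text \<open>
  The elements \<open>x\<close> satisfying \<open>\<pi>\<close> define a family of cuts; two elements are equivalent if no
  cut separates them.
\<close>

definition same_cuts :: "('f, 'p, 'm) struct \<Rightarrow> ('f, 'p) fm \<Rightarrow> ('f, 'p) fm \<Rightarrow> 'm \<Rightarrow> 'm \<Rightarrow> bool" where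
  "same_cuts M \<rho> \<pi> y y' \<longleftrightarrow> (\<forall>x\<in>univ M. sat1 M \<pi> x \<longrightarrow> (down M \<rho> x y \<longleftrightarrow> down M \<rho> x y'))"

definition same_cuts_fm :: "('f, 'p) fm \<Rightarrow> ('f, 'p) fm \<Rightarrow> ('f, 'p) fm" where
  "same_cuts_fm \<rho> \<pi> = All 2 (Imp (ren (\<lambda>_. 2) \<pi>) (Iff (down_fm \<rho> 2 0) (down_fm \<rho> 2 1)))"

lemma sat_same_cuts_fm: "sat M e (same_cuts_fm \<rho> \<pi>) \<longleftrightarrow> same_cuts M \<rho> \<pi> (e 0) (e 1)"
  by (simp add: same_cuts_fm_def same_cuts_def sat_down_fm sat1_def)

lemma wf_same_cuts_fm: "wf_fm L \<rho> \<Longrightarrow> wf_fm L \<pi> \<Longrightarrow> wf_fm L (same_cuts_fm \<rho> \<pi>)"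
  by (simp add: same_cuts_fm_def wf_down_fm)

lemma fv_same_cuts_fm: "fv (same_cuts_fm \<rho> \<pi>) \<subseteq> {..<2}"
  using fv_down_fm[of \<rho> 2 0] fv_down_fm[of \<rho> 2 1] by (auto simp: same_cuts_fm_def)

lemma down_less:
  assumes M: "model M" and "down M \<rho> x y" "less M y' y" "y \<in> univ M" "y' \<in> univ M"
  shows "down M \<rho> x y'"
proof -
  obtain z where z: "z \<in> univ M" "sat2 M \<rho> x z" "\<not> less M z y" using assms(2) by (auto simp: down_def)
  then have "\<not> less M z y'" using less_trans[OF M, of z y' y] assms by blast
  with z show ?thesis by (auto simp: down_def)
qed

lemma same_cuts_convex:
  assumes M: "model M" and "same_cuts M \<rho> \<pi> x z" "less M x y" "less M y z"
    and "x \<in> univ M" "y \<in> univ M" "z \<in> univ M"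
  shows "same_cuts M \<rho> \<pi> x y" "same_cuts M \<rho> \<pi> y z"
  using assms(2) down_less[OF M _ assms(3)] down_less[OF M _ assms(4)] assms(5-7)
  unfolding same_cuts_def by meson+

definition separated :: "('f, 'p, 'm) struct \<Rightarrow> ('m \<Rightarrow> 'm \<Rightarrow> bool) \<Rightarrow> ('m \<times> 'm) set" where
  "separated M E = {(x, y). x \<in> univ M \<and> y \<in> univ M \<and> less M x y \<and> \<not> E x y}"

text \<open>
  For a convex equivalence relation \<open>E\<close>, a pair is in \<open>spread M E n\<close> iff the interval from its
  first (excluded) to its second (included) component meets more than \<open>n\<close> classes.
\<close>

definition spread :: "('f, 'p, 'm) struct \<Rightarrow> ('m \<Rightarrow> 'm \<Rightarrow> bool) \<Rightarrow> nat \<Rightarrow> ('m \<times> 'm) set" where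
  "spread M E n = {(x, y). x \<in> univ M \<and> y \<in> univ M \<and> less M x y} O separated M E ^^ n"

end

section \<open>Separating types over an element by counts of classes\<close>

context slb_theory
begin

text \<open>If the cut of \<open>a\<close> for every formula in the type of \<open>(a, b)\<close>
  reached \<open>b'\<close>, compactness would give a realisation \<open>z\<close> of the type of
  \<open>b\<close> over \<open>a\<close> at or above \<open>b'\<close>. Then \<open>b'\<close> is
  \<open>z\<close> or lies between two realisations, and \<open>tp_convex\<close> gives it the same
  type over \<open>a\<close>.\<close>

lemma separating_formula:
  assumes M: "model M" and inM: "a \<in> univ M" "b \<in> univ M" "b' \<in> univ M"
    and ord: "less M a b" "less M b b'" and t: "tp L M [b] [b']" "\<not> tp L M [a, b] [a, b']"
  obtains \<rho> where "wf_fm L \<rho>" "fv \<rho> \<subseteq> {..<2}" "sat2 M \<rho> a b" "\<not> down M \<rho> a b'"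
proof (rule ccontr)
  note obt = that
  assume "\<not> thesis"
  then have no: "down M \<rho> a b'" if "wf_fm L \<rho>" "fv \<rho> \<subseteq> {..<2}" "sat2 M \<rho> a b" for \<rho>
    using obt[OF that] by blast
  note str = model_struct[OF M]
  define v :: "nat \<Rightarrow> 'm + nat" where "v n = (if n = 0 then Inl a else if n = 1 then Inr 0 else Inl b')" for n
  let ?R = "{\<rho>. wf_fm L \<rho> \<and> fv \<rho> \<subseteq> {..<2} \<and> sat2 M \<rho> a b}"
  let ?\<Gamma> = "insert (Neg (Lt 1 2)) ?R"
  have cong: "sat K (\<lambda>n. case_sum k \<nu> (v n)) \<rho> = sat2 K \<rho> (k a) (\<nu> 0)"
    if "fv \<rho> \<subseteq> {..<2}" for K :: "('f, 'p, 'm) struct" and k \<nu> \<rho>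
    unfolding sat2_def by (rule sat_cong) (use that in \<open>auto simp: v_def\<close>)
  have fin: "\<exists>\<nu>. range \<nu> \<subseteq> univ M \<and> (\<forall>\<phi>\<in>S. sat M (\<lambda>n. case_sum id \<nu> (v n)) \<phi>)"
    if S: "finite S" "S \<subseteq> ?\<Gamma>" for S
  proof -
    obtain \<rho>s where \<rho>s: "set \<rho>s = S \<inter> ?R" using finite_list[of "S \<inter> ?R"] S(1) by auto
    \<comment> \<open>The type is closed under conjunction, so one element serves all formulas of
      \<open>S\<close> at once.\<close>
    have "down M (Conj \<rho>s) a b'" using \<rho>s by (intro no) (auto simp: sat2_def)
    then obtain z where z: "z \<in> univ M" "sat2 M (Conj \<rho>s) a z" "\<not> less M z b'" by (auto simp: down_def)
    have "sat M (\<lambda>n. case_sum id (\<lambda>_. z) (v n)) \<phi>" if "\<phi> \<in> S" for \<phi>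
    proof (cases "\<phi> \<in> ?R")
      case True
      then have "sat2 M \<phi> a z" using z(2) \<rho>s that by (auto simp: sat2_def)
      then show ?thesis using cong[of \<phi> M id "\<lambda>_. z"] True by simp
    next
      case False
      then have "\<phi> = Neg (Lt 1 2)" using that S(2) by blast
      then show ?thesis using z by (simp add: v_def)
    qed
    then show ?thesis using z(1) by (intro exI[of _ "\<lambda>_. z"]) auto
  qed
  have v: "range v \<subseteq> Inl ` univ M \<union> range Inr" using inM by (auto simp: v_def)
  have wf: "wf_fm L \<phi>" if "\<phi> \<in> ?\<Gamma>" for \<phi> using that lt_symbol by (auto simp: numeral_2_eq_2)
  obtain N :: "('f, 'p, 'm) struct" and j \<nu> where N: "model N" "elem L M N j"
    "range \<nu> \<subseteq> univ N" "\<And>\<phi>. \<phi> \<in> ?\<Gamma> \<Longrightarrow> sat N (\<lambda>n. case_sum j \<nu> (v n)) \<phi>"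
    by (rule realize_model[OF M v wf fin]) (assumption | blast)+
  define z where "z = \<nu> 0"
  have z: "z \<in> univ N" "\<not> less N z (j b')"
    using N(3) N(4)[of "Neg (Lt 1 2)"] by (auto simp: z_def v_def)
  have in': "j a \<in> univ N" "j b \<in> univ N" "j b' \<in> univ N" using elem_in[OF N(2)] inM by auto
  have o: "less N (j a) (j b)" "less N (j b) (j b')" using ord inM less_elem[OF N(2) str] by auto
  have tz: "tp L N [j a, j b] [j a, z]"
  proof (rule tpI)
    fix \<phi> assume "wf_fm L \<phi>" "fv \<phi> \<subseteq> {..<length [j a, j b]}" "sat N (nth [j a, j b]) \<phi>"
    then have \<phi>: "wf_fm L \<phi>" "fv \<phi> \<subseteq> {..<2}" "sat2 N \<phi> (j a) (j b)"
      using sat_nth2[of \<phi> N "j a" "j b"] by (simp_all add: numeral_2_eq_2)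
    then have "\<phi> \<in> ?\<Gamma>" using sat2_elem[OF N(2) str \<phi>(1) inM(1,2)] by simp
    then have "sat N (\<lambda>n. case_sum j \<nu> (v n)) \<phi>" by (rule N(4))
    then have "sat2 N \<phi> (j a) z" unfolding cong[OF \<phi>(2)] z_def .
    then show "sat N (nth [j a, z]) \<phi>" unfolding sat_nth2[OF \<phi>(2)] .
  qed simp
  have "tp L N [j a, j b] [j a, j b']"
  proof (cases "z = j b'")
    case False
    then have "less N (j b') z" using z less_total[OF N(1) in'(3) z(1)] by auto
    moreover have "tp L N [j b] [j b']" using t(1) tp_elem[OF N(2) str, of "[b]" "[b']"] inM by simp
    ultimately show ?thesis using tp_convex[OF N(1) in' z(1) o] tz by blast
  qed (use tz in simp)
  then show False using t(2) tp_elem[OF N(2) str, of "[a, b]" "[a, b']"] inM by simp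
qed

text \<open>Consecutive points of the chain are inequivalent by definition, and convexity extends
  this to any two of its points. The \<open>n\<close> steps give \<open>n + 1\<close>
  points.\<close>

lemma spread_chain:
  assumes M: "model M" and "(a, b) \<in> spread M (same_cuts M \<rho> \<pi>) n" "0 < n"
  obtains f where "\<And>i. i \<le> n \<Longrightarrow> f i \<in> univ M \<and> less M a (f i) \<and> (f i = b \<or> less M (f i) b)"
    "\<And>i k. i < k \<Longrightarrow> k \<le> n \<Longrightarrow> less M (f i) (f k) \<and> \<not> same_cuts M \<rho> \<pi> (f i) (f k)"
proof -
  let ?E = "same_cuts M \<rho> \<pi>"
  obtain z where z: "a \<in> univ M" "less M a z" "(z, b) \<in> separated M ?E ^^ n"
    using assms(2) by (auto simp: spread_def)
  obtain f where f: "f 0 = z" "f n = b" "\<And>i. i < n \<Longrightarrow> (f i, f (Suc i)) \<in> separated M ?E"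
    using z(3) by (auto simp: relpow_fun_conv)
  have fM: "f i \<in> univ M" if "i \<le> n" for i
  proof (cases "i = n")
    case True
    then show ?thesis using f(3)[of "n - 1"] assms(3) by (auto simp: separated_def)
  qed (use f(3)[of i] that in \<open>auto simp: separated_def\<close>)
  have step: "less M (f i) (f (Suc i))" "\<not> ?E (f i) (f (Suc i))" if "i < n" for i
    using f(3)[OF that] by (auto simp: separated_def)
  have mono: "less M (f i) (f k)" if "i < k" "k \<le> n" for i k
    using that
  proof (induction k)
    case (Suc k)
    show ?case
    proof (cases "i = k")
      case False
      then have "less M (f i) (f k)" using Suc by simp
      then show ?thesis
        using less_trans[OF M _ step(1)[of k] fM fM fM, of i] Suc.prems by simp
    qed (use step Suc.prems in simp)
  qed simp
  have sep: "\<not> ?E (f i) (f k)" if "i < k" "k \<le> n" for i k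
  proof -
    obtain m where m: "k = Suc m" "i \<le> m" using \<open>i < k\<close> by (cases k) auto
    show ?thesis
    proof (cases "i = m")
      case False
      have "?E (f m) (f k)" if "?E (f i) (f k)"
      proof (rule same_cuts_convex(2)[OF M that])
        show "less M (f i) (f m)" "less M (f m) (f k)" using mono m False \<open>k \<le> n\<close> by auto
      qed (use fM m \<open>k \<le> n\<close> in auto)
      then show ?thesis using step(2)[of m] m \<open>k \<le> n\<close> by auto
    qed (use step(2) m \<open>k \<le> n\<close> in auto)
  qed
  have "less M a (f i)" if "i \<le> n" for i
  proof (cases "i = 0")
    case False
    then show ?thesis using less_trans[OF M z(2)] mono[of 0 i] f(1) z(1) fM[of 0] fM[OF that] that by auto
  qed (use z f in simp)
  moreover have "f i = b \<or> less M (f i) b" if "i \<le> n" for i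
    using mono[of i n] f(2) that by (cases "i = n") auto
  ultimately show thesis using that[of f] fM mono sep by blast
qed

text \<open>Failure for every \<open>\<pi>\<close> and \<open>n\<close> produces, in an extension,
  \<open>y < y'\<close> above \<open>a\<close> and not beyond \<open>b\<close> with the same type
  over \<open>a\<close>, and an \<open>x\<close> of the type of \<open>a\<close> whose cut contains
  \<open>y\<close> but not \<open>y'\<close>. The position of \<open>x\<close> relative to
  \<open>a\<close> decides how this is refuted.\<close>

lemma few_cuts:
  assumes M: "model M" and inM: "a \<in> univ M" "b \<in> univ M" and ord: "less M a b"
    and \<rho>: "wf_fm L \<rho>" "fv \<rho> \<subseteq> {..<2}" "sat2 M \<rho> a b"
  obtains \<pi> n where "wf_fm L \<pi>" "fv \<pi> \<subseteq> {..<1}" "sat1 M \<pi> a" "(a, b) \<notin> spread M (same_cuts M \<rho> \<pi>) n"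
proof (rule ccontr)
  note obt = that
  assume "\<not> thesis"
  then have many: "(a, b) \<in> spread M (same_cuts M \<rho> \<pi>) n"
    if "wf_fm L \<pi>" "fv \<pi> \<subseteq> {..<1}" "sat1 M \<pi> a" for \<pi> n
    using obt[OF that] by blast
  note str = model_struct[OF M]
  \<comment> \<open>The variables 1, 2, 3 stand for \<open>y < y'\<close> and for \<open>x\<close>, which defines a cut between them.\<close>
  define v :: "nat \<Rightarrow> 'm + nat" where
    "v n = (if n = 0 then Inl a else if n = 4 then Inl b else Inr n)" for n
  define ty_eq where "ty_eq \<phi> = Iff \<phi> (ren (\<lambda>n. if n = 0 then 0 else 2) \<phi>)" for \<phi> :: "('f, 'p) fm"
  define cut where "cut \<pi> = And (ren (\<lambda>_. 3) \<pi>) (And (down_fm \<rho> 3 1) (Neg (down_fm \<rho> 3 2)))" for \<pi>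
  let ?P = "{\<phi>. wf_fm L \<phi> \<and> fv \<phi> \<subseteq> {..<2}}"
  let ?Q = "{\<pi>. wf_fm L \<pi> \<and> fv \<pi> \<subseteq> {..<1} \<and> sat1 M \<pi> a}"
  let ?O = "{Lt 0 1, Lt 1 2, Neg (Lt 4 2)}"
  let ?\<Gamma> = "ty_eq ` ?P \<union> ?O \<union> cut ` ?Q"
  have v: "range v \<subseteq> Inl ` univ M \<union> range Inr" using inM by (auto simp: v_def)
  have wf: "wf_fm L \<phi>" if "\<phi> \<in> ?\<Gamma>" for \<phi>
    using that lt_symbol \<rho>(1) by (auto simp: numeral_2_eq_2 ty_eq_def cut_def wf_down_fm)
  have ty_eq: "sat K (\<lambda>n. case_sum k \<nu> (v n)) (ty_eq \<phi>) \<longleftrightarrow> (sat2 K \<phi> (k a) (\<nu> 1) \<longleftrightarrow> sat2 K \<phi> (k a) (\<nu> 2))"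
    if "fv \<phi> \<subseteq> {..<2}" for K :: "('f, 'p, 'm) struct" and k \<nu> \<phi>
  proof -
    have "sat K (\<lambda>n. case_sum k \<nu> (v n)) \<phi> = sat2 K \<phi> (k a) (\<nu> 1)"
      unfolding sat2_def by (rule sat_cong) (use that in \<open>auto simp: v_def less_2_cases_iff\<close>)
    moreover have "sat K (\<lambda>n. case_sum k \<nu> (v (if n = 0 then 0 else 2))) \<phi> = sat2 K \<phi> (k a) (\<nu> 2)"
      unfolding sat2_def by (rule sat_cong) (use that in \<open>auto simp: v_def less_2_cases_iff\<close>)
    ultimately show ?thesis by (simp only: ty_eq_def sat_Iff sat_ren)
  qed
  have cut: "sat K (\<lambda>n. case_sum k \<nu> (v n)) (cut \<pi>) \<longleftrightarrow>
      sat1 K \<pi> (\<nu> 3) \<and> down K \<rho> (\<nu> 3) (\<nu> 1) \<and> \<not> down K \<rho> (\<nu> 3) (\<nu> 2)"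
    for K :: "('f, 'p, 'm) struct" and k \<nu> \<pi>
    by (simp add: cut_def sat_down_fm sat1_def v_def)
  have fin: "\<exists>\<nu>. range \<nu> \<subseteq> univ M \<and> (\<forall>\<phi>\<in>S. sat M (\<lambda>n. case_sum id \<nu> (v n)) \<phi>)"
    if S: "finite S" "S \<subseteq> ?\<Gamma>" for S
  proof -
    have "finite (S \<inter> ty_eq ` ?P)" "S \<inter> ty_eq ` ?P \<subseteq> ty_eq ` ?P" using S(1) by auto
    from finite_subset_image[OF this] obtain P where P: "P \<subseteq> ?P" "finite P" "S \<inter> ty_eq ` ?P = ty_eq ` P"
      by auto
    have "finite (S \<inter> cut ` ?Q)" "S \<inter> cut ` ?Q \<subseteq> cut ` ?Q" using S(1) by auto
    from finite_subset_image[OF this] obtain Q where Q: "Q \<subseteq> ?Q" "finite Q" "S \<inter> cut ` ?Q = cut ` Q"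
      by auto
    obtain \<pi>s where \<pi>s: "set \<pi>s = Q" using finite_list[OF Q(2)] by auto
    define \<pi> where "\<pi> = Conj \<pi>s"
    \<comment> \<open>The chain has one point more than there are truth patterns on
      \<open>P\<close>, so two of its points satisfy the same formulas of \<open>P\<close> over
      \<open>a\<close>.\<close>
    have "(a, b) \<in> spread M (same_cuts M \<rho> \<pi>) (card (Pow P))"
      using Q(1) by (intro many) (auto simp: \<pi>_def \<pi>s sat1_def)
    moreover have "0 < card (Pow P)" using P(2) by (auto simp: card_gt_0_iff)
    ultimately obtain f where f:
      "\<And>i. i \<le> card (Pow P) \<Longrightarrow> f i \<in> univ M \<and> less M a (f i) \<and> (f i = b \<or> less M (f i) b)"
      "\<And>i k. i < k \<Longrightarrow> k \<le> card (Pow P) \<Longrightarrow> less M (f i) (f k) \<and> \<not> same_cuts M \<rho> \<pi> (f i) (f k)"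
      by (rule spread_chain[OF M]) blast
    define pat where "pat i = {\<phi> \<in> P. sat2 M \<phi> a (f i)}" for i
    have "pat ` {..card (Pow P)} \<subseteq> Pow P" by (auto simp: pat_def)
    then have "card (pat ` {..card (Pow P)}) \<le> card (Pow P)" using P(2) by (intro card_mono) auto
    then have "\<not> inj_on pat {..card (Pow P)}" by (intro pigeonhole) simp
    then obtain i k where ik: "i < k" "k \<le> card (Pow P)" "pat i = pat k"
      unfolding inj_on_def by (metis atMost_iff linorder_neqE_nat)
    have fik: "f i \<in> univ M" "f k \<in> univ M" "less M a (f i)" "less M (f i) (f k)"
      "f k = b \<or> less M (f k) b" "\<not> same_cuts M \<rho> \<pi> (f i) (f k)"
      using f(1)[of i] f(1)[of k] f(2)[of i k] ik by auto
    then obtain x where x: "x \<in> univ M" "sat1 M \<pi> x" "down M \<rho> x (f i) \<noteq> down M \<rho> x (f k)"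
      by (auto simp: same_cuts_def)
    then have x': "down M \<rho> x (f i)" "\<not> down M \<rho> x (f k)"
      using down_less[OF M _ fik(4,2,1)] by blast+
    define \<nu> where "\<nu> n = (if n = 1 then f i else if n = 2 then f k else x)" for n :: nat
    have "sat M (\<lambda>n. case_sum id \<nu> (v n)) \<phi>" if \<phi>: "\<phi> \<in> S" for \<phi>
    proof -
      have "\<phi> \<in> ?\<Gamma>" using \<phi> S(2) by (rule subsetD[rotated])
      then have "\<phi> \<in> S \<inter> ty_eq ` ?P \<or> \<phi> \<in> S \<inter> cut ` ?Q \<or> \<phi> \<in> ?O"
        using \<phi> by (simp only: Un_iff Int_iff) argo
      then consider "\<phi> \<in> ty_eq ` P" | "\<phi> \<in> cut ` Q" | "\<phi> \<in> ?O" unfolding P(3) Q(3) by argo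
      then show ?thesis
      proof cases
        case 1
        then obtain \<psi> where 1: "\<phi> = ty_eq \<psi>" "\<psi> \<in> P" by (rule imageE)
        then have "fv \<psi> \<subseteq> {..<2}" using P(1) by auto
        moreover have "sat2 M \<psi> a (f i) \<longleftrightarrow> sat2 M \<psi> a (f k)" using ik(3) 1(2) by (auto simp: pat_def)
        ultimately show ?thesis using ty_eq by (simp add: 1(1) \<nu>_def)
      next
        case 2
        then obtain \<psi> where 2: "\<phi> = cut \<psi>" "\<psi> \<in> Q" by (rule imageE)
        then have "sat1 M \<psi> x" using x(2) by (simp add: \<pi>_def \<pi>s sat1_def)
        then show ?thesis using cut x' by (simp add: 2(1) \<nu>_def)
      next
        case 3
        have "\<not> less M b (f k)"
          using fik(2,5) inM less_irrefl[OF M] less_trans[OF M, of b "f k" b] by blast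
        then show ?thesis using 3 fik by (auto simp: v_def \<nu>_def)
      qed
    qed
    moreover have "range \<nu> \<subseteq> univ M" using fik x by (auto simp: \<nu>_def)
    ultimately show ?thesis by blast
  qed
  obtain N :: "('f, 'p, 'm) struct" and j \<nu> where N: "model N" "elem L M N j"
    "range \<nu> \<subseteq> univ N" "\<And>\<phi>. \<phi> \<in> ?\<Gamma> \<Longrightarrow> sat N (\<lambda>n. case_sum j \<nu> (v n)) \<phi>"
    by (rule realize_model[OF M v wf fin]) (assumption | blast)+
  note strN = model_struct[OF N(1)]
  define y y' x where yx: "y = \<nu> 1" "y' = \<nu> 2" "x = \<nu> 3"
  have inN: "y \<in> univ N" "y' \<in> univ N" "x \<in> univ N" "j a \<in> univ N" "j b \<in> univ N"
    using N(3) elem_in[OF N(2)] inM by (auto simp: yx)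
  have o: "less N (j a) y" "less N y y'" "\<not> less N (j b) y'"
    using N(4)[of "Lt 0 1"] N(4)[of "Lt 1 2"] N(4)[of "Neg (Lt 4 2)"] by (auto simp: yx v_def)
  have ab: "less N (j a) (j b)" using ord less_elem[OF N(2) str] inM by simp
  have \<rho>N: "sat2 N \<rho> (j a) (j b)" using \<rho> sat2_elem[OF N(2) str] inM by simp
  have ty_y: "tp L N [j a, y] [j a, y']"
    unfolding tp2_iff
  proof (intro allI impI)
    fix \<phi> assume \<phi>: "wf_fm L \<phi> \<and> fv \<phi> \<subseteq> {..<2}"
    then have "sat N (\<lambda>n. case_sum j \<nu> (v n)) (ty_eq \<phi>)" by (intro N(4)) simp
    then show "sat2 N \<phi> (j a) y = sat2 N \<phi> (j a) y'" using ty_eq \<phi> by (simp add: yx)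
  qed
  have cut_x: "sat1 N \<pi> x \<and> down N \<rho> x y \<and> \<not> down N \<rho> x y'" if "\<pi> \<in> ?Q" for \<pi>
  proof -
    have "sat N (\<lambda>n. case_sum j \<nu> (v n)) (cut \<pi>)" using that by (intro N(4)) simp
    then show ?thesis unfolding cut yx .
  qed
  have D: "down N \<rho> x y" "\<not> down N \<rho> x y'" using cut_x[of TT] by (simp_all add: sat1_def)
  have down_tp: "down K \<rho> z w = down K \<rho> z' w'" if "tp L K [z, w] [z', w']" for K z w z' w'
  proof -
    have "down_fm \<rho> 0 1 \<in> ?P" using wf_down_fm[OF \<rho>(1)] fv_down_fm[of \<rho> 0 1] by auto
    then have "sat2 K (down_fm \<rho> 0 1) z w = sat2 K (down_fm \<rho> 0 1) z' w'"
      using that unfolding tp2_iff by blast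
    then show ?thesis by (simp add: sat2_def sat_down_fm)
  qed
  have ty_x: "tp L N [j a] [x]"
  proof (rule tpI)
    fix \<phi> assume "wf_fm L \<phi>" "fv \<phi> \<subseteq> {..<length [j a]}" "sat N (nth [j a]) \<phi>"
    then have \<phi>: "wf_fm L \<phi>" "fv \<phi> \<subseteq> {..<1}" "sat1 N \<phi> (j a)"
      using sat_nth1[of \<phi> N "j a"] by simp_all
    then have "sat1 M \<phi> a"
      using elem_sat_nth[OF N(2) str, of "[a]" \<phi>] inM(1) \<phi>
        sat_nth1[OF \<phi>(2), of N "j a"] sat_nth1[OF \<phi>(2), of M a] by simp
    with \<phi> have "\<phi> \<in> ?Q" by simp
    then have "sat1 N \<phi> x" using cut_x by blast
    then show "sat N (nth [x]) \<phi>" unfolding sat_nth1[OF \<phi>(2)] .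
  qed simp
  \<comment> \<open>If \<open>x\<close> is \<open>a\<close>, the equality of types over
    \<open>a\<close> decides. If \<open>x\<close> is below \<open>a\<close>,
    \<open>tp_extend_below\<close> turns this into equality over \<open>x\<close>. If
    \<open>x\<close> is above \<open>a\<close>, its cut turns out to contain \<open>y'\<close> after
    all.\<close>
  consider "x = j a" | "less N x (j a)" | "less N (j a) x"
    using less_total[OF N(1) inN(3,4)] by auto
  then show False
  proof cases
    case 1
    then show False using D down_tp[OF ty_y] by simp
  next
    case 2
    have "tp L N ([x] @ [y]) ([x] @ [y'])"
      by (rule tp_extend_below[OF N(1) _ inN(4,1,2) _ o(1) ty_y]) (use 2 inN in auto)
    then show False using D down_tp[of N x y x y'] by simp
  next
    case 3
    have "set [j a] \<subseteq> univ N" "set [x] \<subseteq> univ N" using inN by auto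
    from extend_to_automorphism[OF large strN ty_x this]
    obtain K :: "('f, 'p, 'm) struct" and k F where K: "is_struct L K" "elem L N K k" "automorphism L K F"
      and "map (\<lambda>x. F (k x)) [j a] = map k [x]" .
    then have Fa: "F (k (j a)) = k x" by simp
    note mK = model_elem[OF N(1) K(1,2)]
    define w where "w = F (k (j b))"
    have inK: "k (j a) \<in> univ K" "k (j b) \<in> univ K" "k x \<in> univ K" "k y' \<in> univ K" "w \<in> univ K"
      using elem_in[OF K(2)] automorphism_in[OF K(3)] inN by (auto simp: w_def)
    note less_k = less_elem[OF K(2) strN]
    have \<rho>K: "sat2 K \<rho> (k (j a)) (k (j b))" using sat2_elem[OF K(2) strN \<rho>(1) inN(4,5)] \<rho>N by simp
    have "set [k (j a), k (j b)] \<subseteq> univ K" using inK by simp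
    from automorphism_tp[OF K(1,3) this] have ty_F: "tp L K [k (j a), k (j b)] [k x, w]"
      using Fa by (simp add: w_def)
    then have \<rho>w: "sat2 K \<rho> (k x) w" using \<rho>K \<rho> unfolding tp2_iff by blast
    have xw: "less K (k x) w"
      using less_automorphism[OF mK K(3) inK(1,2)] ab less_k[OF inN(4,5)] Fa by (simp add: w_def)
    \<comment> \<open>The image \<open>w\<close> of \<open>b\<close> satisfies
      \<open>\<rho>(x, w)\<close>. If \<open>w\<close> is not below \<open>b\<close>, it is itself
      not below \<open>y'\<close>. If it is, then \<open>(x, w)\<close> is nested in
      \<open>(a, b)\<close>, so \<open>\<rho>(x, b)\<close> holds by \<open>tp_nested\<close> and
      \<open>b\<close> is the witness.\<close>
    have "down K \<rho> (k x) (k y')"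
    proof (cases "less K w (k (j b))")
      case True
      have "tp L K [k (j a), k (j b)] [k x, k (j b)]"
        by (rule tp_nested(1)[OF mK inK(1,3,5,2) _ xw True ty_F]) (use 3 less_k inN in simp)
      then have "sat2 K \<rho> (k x) (k (j b))" using \<rho>K \<rho> unfolding tp2_iff by blast
      moreover have "\<not> less K (k (j b)) (k y')" using o(3) less_k inN by simp
      ultimately show ?thesis using inK unfolding down_def by blast
    next
      case False
      have "\<not> less K w (k y')"
      proof
        assume "less K w (k y')"
        moreover have "k y' = k (j b) \<or> less K (k y') (k (j b))"
          using o(3) less_total[OF N(1) inN(2,5)] less_k inN by auto
        ultimately show False using False less_trans[OF mK _ _ inK(5,4,2)] by auto
      qed
      then show ?thesis using \<rho>w inK unfolding down_def by blast
    qed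
    moreover have "down K \<rho> (k x) (k y') = down N \<rho> x y'"
      using sat2_elem[OF K(2) strN wf_down_fm[OF \<rho>(1)] inN(3,2), of 0 1] by (simp add: sat2_def sat_down_fm)
    ultimately show False using D by simp
  qed
qed

text \<open>Take the least bound that \<open>(a, b)\<close> does not exceed. Since \<open>a\<close>
  satisfies \<open>\<pi>\<close> and its own cut contains \<open>b\<close> but not
  \<open>b'\<close>, the point \<open>b'\<close> opens one more class and exceeds the bound.\<close>

theorem spread_distinguishes:
  assumes M: "model M" and inM: "a \<in> univ M" "b \<in> univ M" "b' \<in> univ M"
    and ord: "less M a b" "less M b b'" and t: "tp L M [b] [b']" "\<not> tp L M [a, b] [a, b']"
  obtains \<rho> \<pi> n where "wf_fm L \<rho>" "wf_fm L \<pi>"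
    "(a, b) \<notin> spread M (same_cuts M \<rho> \<pi>) n" "(a, b') \<in> spread M (same_cuts M \<rho> \<pi>) n"
proof -
  obtain \<rho> where \<rho>: "wf_fm L \<rho>" "fv \<rho> \<subseteq> {..<2}" "sat2 M \<rho> a b" "\<not> down M \<rho> a b'"
    by (rule separating_formula[OF assms])
  obtain \<pi> n where \<pi>: "wf_fm L \<pi>" "fv \<pi> \<subseteq> {..<1}" "sat1 M \<pi> a" "(a, b) \<notin> spread M (same_cuts M \<rho> \<pi>) n"
    by (rule few_cuts[OF M inM(1,2) ord(1) \<rho>(1-3)])
  let ?E = "same_cuts M \<rho> \<pi>"
  define n where "n = (LEAST n. (a, b) \<notin> spread M ?E n)"
  have n: "(a, b) \<notin> spread M ?E n" unfolding n_def by (rule LeastI) (rule \<pi>(4))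
  \<comment> \<open>So the least \<open>n\<close> is positive, and \<open>(a, b)\<close> attains the
    count of its predecessor.\<close>
  have "(a, b) \<in> spread M ?E 0" using inM ord by (auto simp: spread_def)
  with n obtain m where m: "n = Suc m" by (cases n) auto
  then have "\<not> (a, b) \<notin> spread M ?E m" unfolding n_def by (intro not_less_Least) simp
  then have "(a, b) \<in> spread M ?E m" by simp
  moreover have "down M \<rho> a b" using \<rho>(3) inM less_irrefl[OF M] unfolding down_def by blast
  then have "\<not> ?E b b'" using \<rho>(4) \<pi>(3) inM unfolding same_cuts_def by blast
  then have "(b, b') \<in> separated M ?E" using inM ord by (simp add: separated_def)
  ultimately have "(a, b') \<in> spread M ?E m O separated M ?E" by (rule relcompI)
  then have "(a, b') \<in> spread M ?E n" by (simp add: spread_def m O_assoc)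
  with \<rho>(1) \<pi>(1) n show thesis by (rule that)
qed

end

section \<open>Formulas of the ccel-reduct\<close>

text \<open>The pointwise form is first-order: it can be checked on elements and also written as a
  sentence. Convexity is stated from the lower end of an interval; symmetry and transitivity supply
  the rest.\<close>

lemma convex_equiv_iff:
  fixes K :: "('f, 'p, 'a) struct"
  assumes r: "r = {(x, y). x \<in> univ K \<and> y \<in> univ K \<and> P x y}"
  shows "convex_equiv K lt r \<longleftrightarrow> (\<forall>x\<in>univ K. \<forall>y\<in>univ K. \<forall>z\<in>univ K. P x x \<and> (P x y \<longrightarrow> P y x) \<and>
    (P x y \<and> P y z \<longrightarrow> P x z) \<and> (P x z \<and> rint K lt [x, y] \<and> rint K lt [y, z] \<longrightarrow> P x y))"
    (is "_ \<longleftrightarrow> ?R")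
proof
  assume c: "convex_equiv K lt r"
  then have eq: "equiv (univ K) r" and cx: "\<And>X. X \<in> univ K // r \<Longrightarrow> convex_in K lt X"
    by (auto simp: convex_equiv_def)
  show ?R
  proof (intro ballI conjI impI)
    fix x y z assume in': "x \<in> univ K" "y \<in> univ K" "z \<in> univ K"
    have "(x, x) \<in> r" using eq in'(1) by (meson equiv_class_self Image_singleton_iff)
    then show "P x x" by (simp add: r)
    show "P y x" if "P x y"
    proof -
      have "(x, y) \<in> r" using that in' by (simp add: r)
      then have "(y, x) \<in> r" using eq by (meson equiv_def symD)
      then show ?thesis by (simp add: r)
    qed
    show "P x z" if "P x y \<and> P y z"
    proof -
      have "(x, y) \<in> r" "(y, z) \<in> r" using that in' by (auto simp: r)
      then have "(x, z) \<in> r" using eq by (meson equiv_def transD)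
      then show ?thesis by (simp add: r)
    qed
    show "P x y" if *: "P x z \<and> rint K lt [x, y] \<and> rint K lt [y, z]"
    proof -
      have "r `` {x} \<in> univ K // r" using in' by (simp add: quotientI)
      then have "convex_in K lt (r `` {x})" by (rule cx)
      moreover have "x \<in> r `` {x}" "z \<in> r `` {x}" using \<open>(x, x) \<in> r\<close> * in' by (auto simp: r)
      moreover have "(x, y) \<in> ord_rel K lt" "(y, z) \<in> ord_rel K lt" using * in' by (auto simp: ord_rel_def)
      ultimately have "y \<in> r `` {x}" unfolding convex_in_def by blast
      then show ?thesis by (simp add: r)
    qed
  qed
next
  assume R: ?R
  have RR: "P x x \<and> (P x y \<longrightarrow> P y x) \<and> (P x y \<and> P y z \<longrightarrow> P x z) \<and>
      (P x z \<and> rint K lt [x, y] \<and> rint K lt [y, z] \<longrightarrow> P x y)"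
    if "x \<in> univ K" "y \<in> univ K" "z \<in> univ K" for x y z
    by (rule bspec[OF bspec[OF bspec[OF R that(1)] that(2)] that(3)])
  have "equiv (univ K) r"
  proof (intro equivI refl_onI symI transI)
    show "r \<subseteq> univ K \<times> univ K" by (auto simp: r)
    show "(x, x) \<in> r" if "x \<in> univ K" for x using RR[OF that that that] that by (simp add: r)
    show "(y, x) \<in> r" if "(x, y) \<in> r" for x y
    proof -
      have "x \<in> univ K" "y \<in> univ K" "P x y" using that by (auto simp: r)
      then show ?thesis using RR[of x y y] by (simp add: r)
    qed
    show "(x, z) \<in> r" if "(x, y) \<in> r" "(y, z) \<in> r" for x y z
    proof -
      have "x \<in> univ K" "y \<in> univ K" "z \<in> univ K" "P x y" "P y z" using that by (auto simp: r)
      then show ?thesis using RR[of x y z] by (simp add: r)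
    qed
  qed
  moreover have "convex_in K lt X" if X: "X \<in> univ K // r" for X
    unfolding convex_in_def
  proof (intro ballI allI impI)
    fix x z y assume *: "x \<in> X" "z \<in> X" "(x, y) \<in> ord_rel K lt \<and> (y, z) \<in> ord_rel K lt"
    obtain w where w: "w \<in> univ K" "X = r `` {w}" using X by (auto elim: quotientE)
    then have in': "x \<in> univ K" "y \<in> univ K" "z \<in> univ K" "P w x" "P w z"
      "rint K lt [x, y]" "rint K lt [y, z]"
      using * by (auto simp: r ord_rel_def)
    have "P x w" using RR[OF w(1) in'(1,1)] in'(4) by blast
    then have "P x z" using RR[OF in'(1) w(1) in'(3)] in'(5) by blast
    then have "P x y" using RR[OF in'(1-3)] in'(6,7) by blast
    then have "P w y" using RR[OF w(1) in'(1,2)] in'(4) by blast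
    then show "y \<in> X" using w in' by (simp add: r)
  qed
  ultimately show "convex_equiv K lt r" by (simp add: convex_equiv_def)
qed

text \<open>The ccel-language has no function symbols, so its well-formed terms are variables; the
  second clause is a default.\<close>

fun var_of :: "'f tm \<Rightarrow> nat" where
  "var_of (Var n) = n"
| "var_of (Fn f ts) = 0"

lemma nth_image_subset:
  assumes "set xs \<subseteq> A" "I \<subseteq> {..<length xs}"
  shows "nth xs ` I \<subseteq> A"
proof (rule image_subsetI)
  fix n assume "n \<in> I"
  then have "n < length xs" using assms(2) by auto
  then show "xs ! n \<in> A" using assms(1) nth_mem by blast
qed

lemma tp_sub2:
  assumes "tp L M xs ys" "i < length xs" "k < length xs"
  shows "tp L M [xs ! i, xs ! k] [ys ! i, ys ! k]"
proof -
  have "tp L M (map (nth xs) [i, k]) (map (nth ys) [i, k])"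
    by (rule tp_sub[OF assms(1)]) (use assms in auto)
  then show ?thesis by simp
qed

context linear_theory
begin

abbreviation CL :: "('f, ('f, 'p) ccel_sym) lang" where
  "CL \<equiv> ccel_lang ty L lt T"

abbreviation CR :: "('f, 'p, 'm) struct \<Rightarrow> ('f, ('f, 'p) ccel_sym, 'm) struct" where
  "CR \<equiv> ccel_reduct lt"

primrec tr :: "('f, ('f, 'p) ccel_sym) fm \<Rightarrow> ('f, 'p) fm" where
  "tr (Eq s t) = Eq s t"
| "tr (Rel s ts) = (case s of
     Less \<Rightarrow> Rel lt ts
   | PSet \<phi> \<Rightarrow> ren (\<lambda>n. var_of (ts ! n)) \<phi>
   | CEq \<psi> \<Rightarrow> ren (\<lambda>n. var_of (ts ! n)) \<psi>)"
| "tr (Neg \<chi>) = Neg (tr \<chi>)"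
| "tr (And \<chi> \<chi>') = And (tr \<chi>) (tr \<chi>')"
| "tr (Exists x \<chi>) = Exists x (tr \<chi>)"

lemma CL_simps:
  "funs CL = {}"
  "(Less, n) \<in> rels CL \<longleftrightarrow> n = 2"
  "(PSet \<phi>, n) \<in> rels CL \<longleftrightarrow> n = 1 \<and> wf_fm L \<phi> \<and> fv \<phi> \<subseteq> {..<1}"
  "(CEq \<psi>, n) \<in> rels CL \<longleftrightarrow> n = 2 \<and> wf_fm L \<psi> \<and> fv \<psi> \<subseteq> {..<2} \<and>
     (\<forall>M. model M \<longrightarrow> convex_equiv M lt {(x, y). [x, y] \<in> defined_set M 2 \<psi>})"
  by (auto simp: ccel_lang_def)

lemma CR_simps [simp]:
  "univ (CR M) = univ M"
  "rint (CR M) Less xs = rint M lt xs"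
  "rint (CR M) (PSet \<phi>) xs \<longleftrightarrow> xs \<in> defined_set M 1 \<phi>"
  "rint (CR M) (CEq \<psi>) xs \<longleftrightarrow> xs \<in> defined_set M 2 \<psi>"
  by (simp_all add: ccel_reduct_def)

lemma CL_tm: "wf_tm CL t \<longleftrightarrow> (\<exists>n. t = Var n)"
  by (cases t) (auto simp: CL_simps)

lemma CR_struct: "is_struct L M \<Longrightarrow> is_struct CL (CR M)"
  by (simp add: is_struct_def CL_simps)

lemma wf_tr: "wf_fm CL \<chi> \<Longrightarrow> wf_fm L (tr \<chi>)"
proof (induction \<chi>)
  case (Rel s ts)
  then show ?case using lt_symbol
    by (cases s) (auto simp: CL_simps CL_tm list_all_iff numeral_2_eq_2 length_Suc_conv)
qed (auto simp: CL_tm)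

text \<open>Equality can fail: the formula inside a name may have fewer free variables than the name
  has arguments.\<close>

lemma fv_tr: "wf_fm CL \<chi> \<Longrightarrow> fv (tr \<chi>) \<subseteq> fv \<chi>"
proof (induction \<chi>)
  case (Rel s ts)
  have "fv_tm (ts ! n) = {var_of (ts ! n)}" if "n < length ts" for n
  proof -
    have "wf_tm CL (ts ! n)" using Rel that by (auto simp: list_all_iff)
    then show ?thesis by (auto simp: CL_tm)
  qed
  then have *: "var_of (ts ! n) \<in> fv (Rel s ts)" if "n < length ts" for n
    using that nth_mem[OF that] by fastforce
  show ?case
  proof (cases s)
    case (PSet \<phi>)
    then have "fv \<phi> \<subseteq> {..<length ts}" using Rel by (auto simp: CL_simps)
    then show ?thesis using * by (auto simp: PSet)
  next
    case (CEq \<phi>)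
    then have "fv \<phi> \<subseteq> {..<length ts}" using Rel by (auto simp: CL_simps)
    then show ?thesis using * by (auto simp: CEq)
  qed simp
qed auto

lemma eval_CR: "wf_tm CL t \<Longrightarrow> eval_tm (CR M) e t = eval_tm M e t"
  by (auto simp: CL_tm)

lemma sat_tr:
  assumes "wf_fm CL \<chi>" "e ` fv \<chi> \<subseteq> univ M"
  shows "sat (CR M) e \<chi> = sat M e (tr \<chi>)"
  using assms
proof (induction \<chi> arbitrary: e)
  case (Rel s ts)
  have ts: "t = Var (var_of t)" if "t \<in> set ts" for t
    using that Rel by (auto simp: list_all_iff CL_tm)
  then have map: "map (eval_tm K e) ts = map (\<lambda>t. e (var_of t)) ts" for K :: "('f, 'q, 'm) struct"
    by (metis (mono_tags, lifting) eval_tm.simps(1) map_eq_conv)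
  have "e (var_of t) \<in> univ M" if "t \<in> set ts" for t
  proof -
    have "var_of t \<in> fv_tm t" by (subst (2) ts[OF that]) simp
    then show ?thesis using Rel.prems(2) that by auto
  qed
  then have tup: "map (\<lambda>t. e (var_of t)) ts \<in> tuples (length ts) (univ M)" by (auto simp: tuples_def)
  have named: "map (\<lambda>t. e (var_of t)) ts \<in> defined_set M (length ts) \<phi> \<longleftrightarrow>
      sat M (\<lambda>n. e (var_of (ts ! n))) \<phi>" if "fv \<phi> \<subseteq> {..<length ts}" for \<phi>
  proof -
    have "sat M (nth (map (\<lambda>t. e (var_of t)) ts)) \<phi> = sat M (\<lambda>n. e (var_of (ts ! n))) \<phi>"
      by (rule sat_cong) (use that in auto)
    then show ?thesis using tup by (simp add: defined_set_def)
  qed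
  show ?case
  proof (cases s)
    case Less
    show ?thesis unfolding Less sat.simps CR_simps map by (simp add: map)
  next
    case (PSet \<phi>)
    then have "length ts = 1" "fv \<phi> \<subseteq> {..<length ts}" using Rel by (auto simp: CL_simps)
    with named[of \<phi>] show ?thesis by (simp add: PSet map)
  next
    case (CEq \<phi>)
    then have "length ts = 2" "fv \<phi> \<subseteq> {..<length ts}" using Rel by (auto simp: CL_simps)
    with named[of \<phi>] show ?thesis by (simp add: CEq map)
  qed
next
  case (Exists x \<chi>)
  have "sat (CR M) (e(x := a)) \<chi> = sat M (e(x := a)) (tr \<chi>)" if "a \<in> univ M" for a
    using Exists.prems that by (intro Exists.IH) auto
  then show ?case by simp
qed (auto simp: eval_CR image_Un)

lemma defined_set_tr:
  assumes "wf_fm CL \<chi>" "fv \<chi> \<subseteq> {..<n}"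
  shows "defined_set (CR M) n \<chi> = defined_set M n (tr \<chi>)"
proof -
  have "sat (CR M) (nth xs) \<chi> = sat M (nth xs) (tr \<chi>)" if "xs \<in> tuples n (univ M)" for xs
    using assms that by (intro sat_tr nth_image_subset) (auto simp: tuples_def)
  then show ?thesis by (auto simp: defined_set_def)
qed

text \<open>Here the relation enters the reduct. Its classes are convex because cuts are downward
  closed: a point between two points on one side of a cut is on that side too.\<close>

lemma same_cuts_CEq:
  assumes "wf_fm L \<rho>" "wf_fm L \<pi>"
  shows "(CEq (same_cuts_fm \<rho> \<pi>), 2) \<in> rels CL"
proof -
  have "convex_equiv M lt {(x, y). [x, y] \<in> defined_set M 2 (same_cuts_fm \<rho> \<pi>)}" if M: "model M" for M
  proof -
    let ?E = "same_cuts M \<rho> \<pi>"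
    have r: "{(x, y). [x, y] \<in> defined_set M 2 (same_cuts_fm \<rho> \<pi>)} =
        {(x, y). x \<in> univ M \<and> y \<in> univ M \<and> ?E x y}" (is "_ = ?r")
      by (auto simp: defined_set_def tuples_def sat_same_cuts_fm)
    show ?thesis unfolding r convex_equiv_iff[OF refl]
    proof (intro ballI conjI impI)
      fix x y z assume in': "x \<in> univ M" "y \<in> univ M" "z \<in> univ M"
      show "?E x y" if "?E x z \<and> less M x y \<and> less M y z"
        by (rule same_cuts_convex(1)[OF M, where z = z]) (use that in' in simp_all)
      show "?E x x" by (simp add: same_cuts_def)
      show "?E y x" if "?E x y" using that unfolding same_cuts_def by simp
      show "?E x z" if "?E x y \<and> ?E y z" using that unfolding same_cuts_def by simp
    qed
  qed
  then show ?thesis using assms by (simp add: CL_simps wf_same_cuts_fm fv_same_cuts_fm)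
qed

text \<open>The chain is unrolled from its right end, as in the relation power. The bound variable
  \<open>Suc j\<close> differs from \<open>0\<close> and \<open>j\<close>, so the left end keeps the
  variable \<open>0\<close>.\<close>

primrec spread_fm :: "('f, 'p) fm \<Rightarrow> nat \<Rightarrow> nat \<Rightarrow> ('f, ('f, 'p) ccel_sym) fm" where
  "spread_fm \<psi> 0 j = Rel Less [Var 0, Var j]"
| "spread_fm \<psi> (Suc n) j = Exists (Suc j) (And (spread_fm \<psi> n (Suc j))
     (And (Rel Less [Var (Suc j), Var j]) (Neg (Rel (CEq \<psi>) [Var (Suc j), Var j]))))"

lemma wf_spread_fm: "(CEq \<psi>, 2) \<in> rels CL \<Longrightarrow> wf_fm CL (spread_fm \<psi> n j)"
  by (induction n arbitrary: j) (auto simp: CL_simps CL_tm)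

lemma fv_spread_fm: "fv (spread_fm \<psi> n j) \<subseteq> {0, j}"
  by (induction n arbitrary: j) auto

lemma sat_spread_fm:
  assumes "e 0 \<in> univ M" "e j \<in> univ M" "0 < j"
  shows "sat (CR M) e (spread_fm (same_cuts_fm \<rho> \<pi>) n j) \<longleftrightarrow> (e 0, e j) \<in> spread M (same_cuts M \<rho> \<pi>) n"
  using assms
proof (induction n arbitrary: e j)
  case 0
  then show ?case by (simp add: spread_def)
next
  case (Suc n)
  let ?E = "same_cuts M \<rho> \<pi>"
  have IH: "sat (CR M) (e(Suc j := a)) (spread_fm (same_cuts_fm \<rho> \<pi>) n (Suc j)) \<longleftrightarrow> (e 0, a) \<in> spread M ?E n"
    if "a \<in> univ M" for a
  proof -
    have eq: "(e(Suc j := a)) 0 = e 0" "(e(Suc j := a)) (Suc j) = a" by auto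
    show ?thesis using Suc.IH[of "e(Suc j := a)" "Suc j", unfolded eq] Suc.prems(1) that by blast
  qed
  have E: "[a, e j] \<in> defined_set M 2 (same_cuts_fm \<rho> \<pi>) \<longleftrightarrow> ?E a (e j)" if "a \<in> univ M" for a
    using that Suc.prems by (auto simp: defined_set_def tuples_def sat_same_cuts_fm)
  have "sat (CR M) e (spread_fm (same_cuts_fm \<rho> \<pi>) (Suc n) j) \<longleftrightarrow>
      (\<exists>a\<in>univ M. (e 0, a) \<in> spread M ?E n \<and> less M a (e j) \<and> \<not> ?E a (e j))"
    unfolding spread_fm.simps sat.simps CR_simps(1) using IH E by (auto simp del: spread_fm.simps)
  also have "\<dots> \<longleftrightarrow> (e 0, e j) \<in> spread M ?E n O separated M ?E"
    using Suc.prems by (auto simp: separated_def)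
  also have "spread M ?E n O separated M ?E = spread M ?E (Suc n)" by (simp add: spread_def O_assoc)
  finally show ?case .
qed

lemma spread_definable:
  assumes "wf_fm L \<rho>" "wf_fm L \<pi>"
  obtains \<chi> where "wf_fm CL \<chi>" "fv \<chi> \<subseteq> {..<2}"
    "\<And>M x y. x \<in> univ M \<Longrightarrow> y \<in> univ M \<Longrightarrow> sat2 (CR M) \<chi> x y \<longleftrightarrow> (x, y) \<in> spread M (same_cuts M \<rho> \<pi>) n"
proof (rule that)
  let ?\<chi> = "spread_fm (same_cuts_fm \<rho> \<pi>) n 1"
  show "wf_fm CL ?\<chi>" by (rule wf_spread_fm[OF same_cuts_CEq[OF assms]])
  show "fv ?\<chi> \<subseteq> {..<2}" using fv_spread_fm[of "same_cuts_fm \<rho> \<pi>" n 1] by auto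
  fix M :: "('f, 'p, 'm) struct" and x y assume "x \<in> univ M" "y \<in> univ M"
  then show "sat2 (CR M) ?\<chi> x y \<longleftrightarrow> (x, y) \<in> spread M (same_cuts M \<rho> \<pi>) n"
    unfolding sat2_def by (subst sat_spread_fm) auto
qed

lemma sat2_tr:
  assumes "wf_fm CL \<chi>" "x \<in> univ M" "y \<in> univ M"
  shows "sat2 (CR M) \<chi> x y = sat2 M (tr \<chi>) x y"
  unfolding sat2_def using assms by (intro sat_tr) auto

text \<open>\<open>tr\<close> translates formulas of the reduct in the same way in every model, so
  \<open>j\<close> preserves them as well.\<close>

lemma ccel_tp_elem:
  assumes "elem L M N j" "is_struct L M" "set xs \<subseteq> univ M" "set ys \<subseteq> univ M" "tp CL (CR M) xs ys"
  shows "tp CL (CR N) (map j xs) (map j ys)"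
proof -
  have "sat (CR N) (nth (map j zs)) \<chi> = sat (CR M) (nth zs) \<chi>"
    if \<chi>: "wf_fm CL \<chi>" "fv \<chi> \<subseteq> {..<length zs}" and zs: "set zs \<subseteq> univ M" for zs \<chi>
  proof -
    have "nth (map j zs) ` fv \<chi> \<subseteq> univ N" "nth zs ` fv \<chi> \<subseteq> univ M"
      by (rule nth_image_subset; use \<chi>(2) zs elem_in[OF assms(1)] in auto)+
    moreover have "sat N (nth (map j zs)) (tr \<chi>) = sat M (nth zs) (tr \<chi>)"
      using fv_tr[OF \<chi>(1)] \<chi>(2) by (intro elem_sat_nth[OF assms(1,2) zs wf_tr[OF \<chi>(1)]]) auto
    ultimately show ?thesis using sat_tr[OF \<chi>(1)] by simp
  qed
  then show ?thesis using assms(3-5) by (auto simp: tp_def)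
qed

text \<open>Every formula in one variable is named by a predicate \<open>PSet\<close>.\<close>

lemma ccel_tp_1:
  assumes "tp CL (CR M) [x] [y]" "x \<in> univ M" "y \<in> univ M"
  shows "tp L M [x] [y]"
  unfolding tp1_iff
proof (intro allI impI)
  fix \<phi> assume \<phi>: "wf_fm L \<phi> \<and> fv \<phi> \<subseteq> {..<1}"
  let ?\<chi> = "Rel (PSet \<phi>) [Var 0]"
  have "sat1 (CR M) ?\<chi> z = sat1 M \<phi> z" if "z \<in> univ M" for z
    using that \<phi> sat_nth1[of \<phi> M z] by (simp add: sat1_def defined_set_def tuples_def)
  moreover have "sat1 (CR M) ?\<chi> x = sat1 (CR M) ?\<chi> y"
    using assms(1) \<phi> unfolding tp1_iff by (auto simp: CL_simps CL_tm)
  ultimately show "sat1 M \<phi> x = sat1 M \<phi> y" using assms(2,3) by simp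
qed

lemma ccel_tp_order:
  assumes "tp CL (CR M) [x, y] [x', y']"
  shows "x = y \<longleftrightarrow> x' = y'" "less M x y \<longleftrightarrow> less M x' y'"
proof -
  have 1: "sat2 (CR M) \<chi> x y = sat2 (CR M) \<chi> x' y'" if "wf_fm CL \<chi>" "fv \<chi> \<subseteq> {..<2}" for \<chi>
    using assms that unfolding tp2_iff by blast
  show "x = y \<longleftrightarrow> x' = y'" using 1[of "Eq (Var 0) (Var 1)"] by (simp add: sat2_def)
  show "less M x y \<longleftrightarrow> less M x' y'" using 1[of "Rel Less [Var 0, Var 1]"] by (simp add: sat2_def CL_simps)
qed

lemma sorted_list_exists:
  assumes M: "model M" and "finite A" "A \<subseteq> univ M"
  shows "\<exists>xs. set xs = A \<and> sorted_wrt (less M) xs"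
  using assms(2,3)
proof (induction A rule: finite_induct)
  case (insert x A)
  then obtain xs where xs: "set xs = A" "sorted_wrt (less M) xs" by auto
  let ?ys = "filter (\<lambda>y. less M y x) xs @ [x] @ filter (\<lambda>y. less M x y) xs"
  have "set ?ys = insert x A"
    using xs(1) insert less_total[OF M, of x] by auto
  moreover have "sorted_wrt (less M) ?ys"
    using xs insert.prems less_trans[OF M]
    by (auto simp: sorted_wrt_append sorted_wrt_filter)
  ultimately show ?case by blast
qed simp

end

section \<open>From types in the reduct to types in the full language\<close>

context slb_theory
begin

text \<open>An automorphism taking \<open>a\<close> to \<open>a'\<close> and \<open>b\<close> to
  some \<open>c\<close> reduces the claim to pairs with equal first component,
  \<open>(a', c)\<close> and \<open>(a', b')\<close>. The former has the full type of
  \<open>(a, b)\<close> and the latter its type in the reduct, so all class counts agree, which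
  \<open>spread_distinguishes\<close> forbids for pairs of different types.\<close>

lemma ccel_pair_less:
  assumes M: "model M" and inM: "a \<in> univ M" "b \<in> univ M" "a' \<in> univ M" "b' \<in> univ M"
    and ord: "less M a b" and t: "tp CL (CR M) [a, b] [a', b']"
  shows "tp L M [a, b] [a', b']"
proof -
  note str = model_struct[OF M]
  have "tp CL (CR M) [a] [a']" "tp CL (CR M) [b] [b']"
    using tp_sub[OF t, of "[0]"] tp_sub[OF t, of "[1]"] by auto
  then have ta: "tp L M [a] [a']" and tb: "tp L M [b] [b']" using ccel_tp_1 inM by auto
  have ord': "less M a' b'" using ccel_tp_order(2)[OF t] ord by simp
  have "set [a] \<subseteq> univ M" "set [a'] \<subseteq> univ M" using inM by auto
  from extend_to_automorphism[OF large str ta this]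
  obtain N :: "('f, 'p, 'm) struct" and j F where N: "is_struct L N" "elem L M N j" "automorphism L N F"
    and "map (\<lambda>x. F (j x)) [a] = map j [a']" .
  then have Fa: "F (j a) = j a'" by simp
  note mN = model_elem[OF M N(1,2)]
  define c where "c = F (j b)"
  have inN: "j a \<in> univ N" "j b \<in> univ N" "j a' \<in> univ N" "j b' \<in> univ N" "c \<in> univ N"
    using elem_in[OF N(2)] inM automorphism_in[OF N(3)] by (auto simp: c_def)
  note less_j = less_elem[OF N(2) str]
  have "set [j a, j b] \<subseteq> univ N" "set [j b] \<subseteq> univ N" using inN by auto
  note aut = automorphism_tp[OF N(1,3) this(1)] automorphism_tp[OF N(1,3) this(2)]
  have tF: "tp L N [j a, j b] [j a', c]" using aut(1) Fa by (simp add: c_def)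
  have "tp L N [j b] [j b']" using tb tp_elem[OF N(2) str, of "[b]" "[b']"] inM by simp
  then have tc: "tp L N [c] [j b']" using aut(2) tp_trans[OF tp_sym] by (simp add: c_def) blast
  have ac: "less N (j a') c"
    using less_automorphism[OF mN N(3) inN(1,2)] ord less_j inM Fa by (simp add: c_def)
  have ab': "less N (j a') (j b')" using ord' less_j inM by simp
  have tN: "tp CL (CR N) [j a, j b] [j a', j b']"
    using ccel_tp_elem[OF N(2) str _ _ t] inM by simp
  have same: "(j a', c) \<in> spread N (same_cuts N \<rho> \<pi>) n \<longleftrightarrow> (j a', j b') \<in> spread N (same_cuts N \<rho> \<pi>) n"
    if wf: "wf_fm L \<rho>" "wf_fm L \<pi>" for \<rho> \<pi> n
  proof -
    obtain \<chi> where \<chi>: "wf_fm CL \<chi>" "fv \<chi> \<subseteq> {..<2}" and s: "\<And>M x y. x \<in> univ M \<Longrightarrow> y \<in> univ M \<Longrightarrow>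
        sat2 (CR M) \<chi> x y \<longleftrightarrow> (x, y) \<in> spread M (same_cuts M \<rho> \<pi>) n"
      by (rule spread_definable[OF wf, of n]) blast
    have "sat2 (CR N) \<chi> (j a) (j b) = sat2 (CR N) \<chi> (j a') (j b')"
      using tN \<chi> unfolding tp2_iff by blast
    moreover have "sat2 N (tr \<chi>) (j a) (j b) = sat2 N (tr \<chi>) (j a') c"
      using tF wf_tr[OF \<chi>(1)] fv_tr[OF \<chi>(1)] \<chi>(2) unfolding tp2_iff by blast
    ultimately show ?thesis using s inN sat2_tr[OF \<chi>(1)] by simp
  qed
  have "tp L N [j a', c] [j a', j b']"
  proof (rule ccontr)
    assume no: "\<not> tp L N [j a', c] [j a', j b']"
    then have "c \<noteq> j b'" using tp_refl by auto
    then consider "less N c (j b')" | "less N (j b') c" using less_total[OF mN inN(5,4)] by auto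
    then show False
    proof cases
      case 1
      show False
        by (rule spread_distinguishes[OF mN inN(3,5,4) ac 1 tc no]) (use same in blast)
    next
      case 2
      have "\<not> tp L N [j a', j b'] [j a', c]" using no tp_sym by blast
      then show False
        by (rule spread_distinguishes[OF mN inN(3,4,5) ab' 2 tp_sym[OF tc]]) (use same in blast)
    qed
  qed
  with tF have "tp L N [j a, j b] [j a', j b']" using tp_trans by blast
  then show ?thesis using tp_elem[OF N(2) str, of "[a, b]" "[a', b']"] inM by simp
qed

lemma ccel_pair:
  assumes M: "model M" and inM: "a \<in> univ M" "b \<in> univ M" "a' \<in> univ M" "b' \<in> univ M"
    and t: "tp CL (CR M) [a, b] [a', b']"
  shows "tp L M [a, b] [a', b']"
proof -
  consider "a = b" | "less M a b" | "less M b a" using less_total[OF M inM(1,2)] by auto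
  then show ?thesis
  proof cases
    case 1
    then have "a' = b'" using ccel_tp_order(1)[OF t] by simp
    have "tp L M [a] [a']" using ccel_tp_1 inM tp_sub[OF t, of "[0]"] by simp
    from tp_sub2[OF this, of 0 0] show ?thesis using 1 \<open>a' = b'\<close> by simp
  next
    case 2
    then show ?thesis using ccel_pair_less[OF M inM] t by blast
  next
    case 3
    have "tp CL (CR M) [b, a] [b', a']" using tp_sub2[OF t, of 1 0] by simp
    then have "tp L M [b, a] [b', a']" using ccel_pair_less[OF M inM(2,1,4,3) 3] by blast
    from tp_sub2[OF this, of 1 0] show ?thesis by simp
  qed
qed

text \<open>Induction on the largest entry. Once an automorphism has taken the earlier entries of
  \<open>xs\<close> to those of \<open>ys\<close>, the image of the last entry and the last entry of
  \<open>ys\<close> have the same type over the greatest earlier entry, hence over all earlier ones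
  by \<open>tp_extend_below\<close>.\<close>

lemma tp_sorted:
  assumes M: "model M" and "sorted_wrt (less M) xs" "length ys = length xs"
    and "set xs \<subseteq> univ M" "set ys \<subseteq> univ M"
    and "\<And>i k. i < length xs \<Longrightarrow> k < length xs \<Longrightarrow> tp L M [xs ! i, xs ! k] [ys ! i, ys ! k]"
  shows "tp L M xs ys"
  using assms(2-)
proof (induction xs arbitrary: ys rule: rev_induct)
  case Nil
  then show ?case using tp_refl[of L M "[]"] by simp
next
  case (snoc b xs)
  obtain ys' b' where ys: "ys = ys' @ [b']" "length ys' = length xs"
    using snoc.prems(2) by (metis length_append_singleton length_Suc_conv_rev)
  have pairs: "tp L M [xs ! i, xs ! k] [ys' ! i, ys' ! k]" if "i < length xs" "k < length xs" for i k
    using snoc.prems(5)[of i k] that ys by (simp add: nth_append)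
  have IH: "tp L M xs ys'" using snoc ys pairs by (intro snoc.IH) (auto simp: sorted_wrt_append)
  show ?case
  proof (cases "xs = []")
    case True
    then have "tp L M [b, b] [b', b']" using snoc.prems(5)[of 0 0] ys by simp
    from tp_sub[OF this, of "[0]"] show ?thesis using True ys by simp
  next
    case False
    note str = model_struct[OF M]
    let ?l = "length xs - 1"
    have l: "?l < length xs" using False by simp
    define c c' where cc: "c = xs ! ?l" "c' = ys' ! ?l"
    have inM: "set xs \<subseteq> univ M" "set ys' \<subseteq> univ M" "b \<in> univ M" "b' \<in> univ M" "c \<in> univ M" "c' \<in> univ M"
      using snoc.prems(3,4) ys l nth_mem[of ?l xs] nth_mem[of ?l ys'] by (auto simp: cc)
    have cb: "less M c b" using snoc.prems(1) l by (auto simp: sorted_wrt_append cc)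
    have tcb: "tp L M [c, b] [c', b']"
      using snoc.prems(5)[of ?l "length xs"] ys l by (simp add: nth_append cc)
    from extend_to_automorphism[OF large str IH inM(1,2)]
    obtain N :: "('f, 'p, 'm) struct" and j F where N: "is_struct L N" "elem L M N j" "automorphism L N F"
      and F: "map (\<lambda>x. F (j x)) xs = map j ys'" .
    note mN = model_elem[OF M N(1,2)] and jin = elem_in[OF N(2)] and less_j = less_elem[OF N(2) str]
    define d where "d = F (j b)"
    have inN: "set (map j ys') \<subseteq> univ N" "j c' \<in> univ N" "d \<in> univ N" "j b' \<in> univ N" "j c \<in> univ N" "j b \<in> univ N"
      using jin inM automorphism_in[OF N(3)] by (auto simp: d_def)
    have Fc: "F (j c) = j c'" using arg_cong[OF F, of "\<lambda>zs. zs ! ?l"] l ys(2) by (simp add: cc)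
    have tF: "tp L N [j c, j b] [j c', d]"
      using automorphism_tp[OF N(1,3), of "[j c, j b]"] inN Fc by (simp add: d_def)
    have "tp L N [j c, j b] [j c', j b']" using tcb tp_elem[OF N(2) str, of "[c, b]" "[c', b']"] inM by simp
    then have td: "tp L N [j c', d] [j c', j b']" using tp_trans[OF tp_sym[OF tF]] by blast
    have cd: "less N (j c') d"
      using less_automorphism[OF mN N(3) inN(5,6)] cb less_j inM Fc by (simp add: d_def)
    \<comment> \<open>\<open>ys'\<close> is increasing as well, because the order is part of the
      types of pairs.\<close>
    have below: "z = j c' \<or> less N z (j c')" if z: "z \<in> set (map j ys')" for z
    proof -
      obtain i where i: "i < length xs" "z = j (ys' ! i)" using z ys(2) by (auto simp: in_set_conv_nth)
      show ?thesis
      proof (cases "i = ?l")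
        case False
        then have "less M (xs ! i) c"
          using snoc.prems(1) i(1) sorted_wrt_nth_less[of "less M" xs i ?l] by (simp add: sorted_wrt_append cc)
        moreover have "sat2 M (Lt 0 1) (xs ! i) c = sat2 M (Lt 0 1) (ys' ! i) c'"
          using pairs[OF i(1) l] lt_symbol unfolding tp2_iff cc by (auto simp: numeral_2_eq_2)
        ultimately have "less M (ys' ! i) c'" by (simp add: sat2_def)
        moreover have "ys' ! i \<in> univ M" using inM(2) i(1) ys(2) by (metis nth_mem subsetD)
        ultimately show ?thesis using i less_j inM by simp
      qed (use i cc in simp)
    qed
    have "tp L N (map j ys' @ [d]) (map j ys' @ [j b'])"
      by (rule tp_extend_below[OF mN inN(1-4) below cd td])
    moreover have "tp L N (map j (xs @ [b])) (map F (map j (xs @ [b])))"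
      using jin inM by (intro automorphism_tp[OF N(1,3)]) auto
    moreover have "map F (map j (xs @ [b])) = map j ys' @ [d]" using F by (simp add: d_def comp_def)
    ultimately have "tp L N (map j (xs @ [b])) (map j (ys' @ [b']))" using tp_trans by fastforce
    then show ?thesis using tp_elem[OF N(2) str, of "xs @ [b]" "ys' @ [b']"] inM ys(1) by simp
  qed
qed

text \<open>The entries of \<open>xs\<close> are sorted without repetition into \<open>zs\<close>,
  and \<open>ys\<close> is rearranged accordingly, so that \<open>tp_sorted\<close> applies. The
  index maps \<open>s\<close> and \<open>r\<close> lead back and forth.\<close>

lemma ccel_tp:
  assumes M: "model M" and t: "tp CL (CR M) xs ys" and inM: "set xs \<subseteq> univ M" "set ys \<subseteq> univ M"
  shows "tp L M xs ys"
proof -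
  have len: "length ys = length xs" using t by (simp add: tp_def)
  have pairs: "tp CL (CR M) [xs ! i, xs ! k] [ys ! i, ys ! k]" if "i < length xs" "k < length xs" for i k
    using tp_sub2[OF t that] .
  obtain zs where zs: "set zs = set xs" "sorted_wrt (less M) zs"
    using sorted_list_exists[OF M _ inM(1)] by auto
  have "\<forall>i. \<exists>k. i < length xs \<longrightarrow> k < length zs \<and> zs ! k = xs ! i"
    using zs(1) by (metis in_set_conv_nth)
  then obtain s where s: "\<And>i. i < length xs \<Longrightarrow> s i < length zs \<and> zs ! s i = xs ! i" by metis
  have "\<forall>k. \<exists>i. k < length zs \<longrightarrow> i < length xs \<and> xs ! i = zs ! k"
    using zs(1) by (metis in_set_conv_nth)
  then obtain r where r: "\<And>k. k < length zs \<Longrightarrow> r k < length xs \<and> xs ! r k = zs ! k" by metis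
  let ?ws = "map (\<lambda>k. ys ! r k) [0..<length zs]"
  have xM: "xs ! i \<in> univ M" "ys ! i \<in> univ M" if "i < length xs" for i
    using that inM len nth_mem[of i xs] nth_mem[of i ys] by auto
  have "tp L M zs ?ws"
  proof (rule tp_sorted[OF M zs(2)])
    show "set ?ws \<subseteq> univ M" using r xM by auto
    fix i k assume "i < length zs" "k < length zs"
    then have "r i < length xs" "r k < length xs" using r by auto
    then have "tp L M [xs ! r i, xs ! r k] [ys ! r i, ys ! r k]"
      by (intro ccel_pair[OF M] xM pairs)
    then show "tp L M [zs ! i, zs ! k] [?ws ! i, ?ws ! k]"
      using r \<open>i < length zs\<close> \<open>k < length zs\<close> by simp
  qed (use zs inM in auto)
  then have "tp L M (map (nth zs) (map s [0..<length xs])) (map (nth ?ws) (map s [0..<length xs]))"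
    using s by (intro tp_sub) auto
  moreover have "map (nth zs) (map s [0..<length xs]) = xs"
    using s by (intro nth_equalityI) auto
  moreover have "map (nth ?ws) (map s [0..<length xs]) = ys"
  proof (rule nth_equalityI)
    fix i assume "i < length (map (nth ?ws) (map s [0..<length xs]))"
    then have i: "i < length xs" by simp
    \<comment> \<open>\<open>r (s i)\<close> may be another position of the same entry of
      \<open>xs\<close>. Equality is expressible in the reduct, so \<open>ys\<close> repeats its
      entry there too.\<close>
    have "r (s i) < length xs" "xs ! r (s i) = xs ! i" using s[OF i] r[of "s i"] by auto
    then have "ys ! r (s i) = ys ! i" using ccel_tp_order(1)[OF pairs[OF _ i, of "r (s i)"]] by simp
    then show "map (nth ?ws) (map s [0..<length xs]) ! i = ys ! i" using i s[OF i] by simp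
  qed (simp add: len)
  ultimately show ?thesis by simp
qed

end

section \<open>Definability in the ccel-reduct\<close>

text \<open>By \<open>det\<close>, \<open>D\<close> is a union of cells given by truth patterns on
  \<open>\<Delta>\<close>. There are finitely many patterns, and the disjunction of the cells met by
  \<open>D\<close> defines it.\<close>

lemma boolean_combination:
  fixes K :: "('g, 'q, 'a) struct"
  assumes "finite \<Delta>" "\<And>\<chi>. \<chi> \<in> \<Delta> \<Longrightarrow> wf_fm L' \<chi> \<and> fv \<chi> \<subseteq> {..<n}"
    and D: "D \<subseteq> tuples n (univ K)"
    and det: "\<And>xs ys. xs \<in> D \<Longrightarrow> ys \<in> tuples n (univ K) \<Longrightarrow>
       (\<And>\<chi>. \<chi> \<in> \<Delta> \<Longrightarrow> sat K (nth xs) \<chi> = sat K (nth ys) \<chi>) \<Longrightarrow> ys \<in> D"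
  shows "definable L' K n D"
proof -
  obtain \<chi>s where \<chi>s: "set \<chi>s = \<Delta>" using finite_list[OF assms(1)] by blast
  define pat where "pat xs = {\<chi> \<in> \<Delta>. sat K (nth xs) \<chi>}" for xs
  have "finite (pat ` D)" by (rule finite_subset[of _ "Pow \<Delta>"]) (auto simp: pat_def assms(1))
  from finite_list[OF this] obtain ps where ps: "set ps = pat ` D" ..
  define cell where "cell p = Conj (map (\<lambda>\<chi>. if \<chi> \<in> p then \<chi> else Neg \<chi>) \<chi>s)" for p
  have cell: "sat K (nth xs) (cell p) \<longleftrightarrow> (\<forall>\<chi>\<in>\<Delta>. sat K (nth xs) \<chi> \<longleftrightarrow> \<chi> \<in> p)" for xs p
  proof -
    have "sat K (nth xs) (cell p) \<longleftrightarrow> (\<forall>\<chi>\<in>\<Delta>. sat K (nth xs) (if \<chi> \<in> p then \<chi> else Neg \<chi>))"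
      unfolding cell_def sat_Conj set_map \<chi>s by (rule ball_simps(9))
    also have "\<dots> \<longleftrightarrow> (\<forall>\<chi>\<in>\<Delta>. sat K (nth xs) \<chi> \<longleftrightarrow> \<chi> \<in> p)"
      by (intro ball_cong refl) simp
    finally show ?thesis .
  qed
  define \<Psi> where "\<Psi> = Neg (Conj (map (\<lambda>p. Neg (cell p)) ps))"
  have "wf_fm L' (if \<chi> \<in> p then \<chi> else Neg \<chi>) \<and> fv (if \<chi> \<in> p then \<chi> else Neg \<chi>) \<subseteq> {..<n}"
    if "\<chi> \<in> \<Delta>" for \<chi> p
    using assms(2)[OF that] by simp
  then have "wf_fm L' (cell p)" "fv (cell p) \<subseteq> {..<n}" for p
    unfolding cell_def wf_Conj fv_Conj set_map \<chi>s by blast+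
  then have "wf_fm L' \<Psi>" "fv \<Psi> \<subseteq> {..<n}" unfolding \<Psi>_def by auto
  moreover have "D = defined_set K n \<Psi>"
  proof (intro set_eqI iffI)
    fix xs assume xs: "xs \<in> D"
    then have "pat xs \<in> set ps" by (simp add: ps)
    moreover have "sat K (nth xs) (cell (pat xs))" by (auto simp: cell pat_def)
    ultimately show "xs \<in> defined_set K n \<Psi>" using xs D by (auto simp: defined_set_def \<Psi>_def)
  next
    fix ys assume "ys \<in> defined_set K n \<Psi>"
    then obtain xs where "ys \<in> tuples n (univ K)" "xs \<in> D" "sat K (nth ys) (cell (pat xs))"
      by (auto simp: defined_set_def \<Psi>_def ps)
    then show "ys \<in> D" by (intro det[of xs ys]) (auto simp: cell pat_def)
  qed
  ultimately show ?thesis unfolding definable_def by blast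
qed

context linear_theory
begin

lemma definable_CR_imp: "definable CL (CR M) n D \<Longrightarrow> definable L M n D"
  unfolding definable_def using defined_set_tr wf_tr fv_tr by (metis order_trans)

lemma def_equiv_CR_iff:
  "def_equiv L M CL (CR M) \<longleftrightarrow> (\<forall>n D. definable L M n D \<longrightarrow> definable CL (CR M) n D)"
  using definable_CR_imp by (auto simp: def_equiv_def)

end

context slb_theory
begin

text \<open>Otherwise compactness yields two tuples in some model that agree on all formulas of the
  reduct but not on \<open>\<phi>\<close>, contrary to \<open>ccel_tp\<close>.\<close>

lemma finitely_determined:
  assumes M: "model M" and \<phi>: "wf_fm L \<phi>" "fv \<phi> \<subseteq> {..<n}"
  obtains \<Delta> where "finite \<Delta>" "\<And>\<chi>. \<chi> \<in> \<Delta> \<Longrightarrow> wf_fm CL \<chi> \<and> fv \<chi> \<subseteq> {..<n}"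
    "\<And>xs ys. xs \<in> tuples n (univ M) \<Longrightarrow> ys \<in> tuples n (univ M) \<Longrightarrow>
       (\<And>\<chi>. \<chi> \<in> \<Delta> \<Longrightarrow> sat (CR M) (nth xs) \<chi> = sat (CR M) (nth ys) \<chi>) \<Longrightarrow>
       sat M (nth xs) \<phi> \<Longrightarrow> sat M (nth ys) \<phi>"
proof (rule ccontr)
  note obt = that
  assume no: "\<not> thesis"
  let ?X = "{\<chi>. wf_fm CL \<chi> \<and> fv \<chi> \<subseteq> {..<n}}"
  have counter: "\<exists>xs\<in>tuples n (univ M). \<exists>ys\<in>tuples n (univ M).
      (\<forall>\<chi>\<in>\<Delta>. sat (CR M) (nth xs) \<chi> = sat (CR M) (nth ys) \<chi>) \<and> sat M (nth xs) \<phi> \<and> \<not> sat M (nth ys) \<phi>"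
    if \<Delta>: "finite \<Delta>" "\<Delta> \<subseteq> ?X" for \<Delta>
  proof (rule ccontr)
    assume "\<not> ?thesis"
    then have "thesis" using \<Delta> by (intro obt[of \<Delta>]) blast+
    with no show False ..
  qed
  obtain a where a: "a \<in> univ M" using model_struct[OF M] by (auto simp: is_struct_def)
  \<comment> \<open>The second tuple lives in the variables \<open>n, \<dots>, 2n - 1\<close>.\<close>
  let ?sh = "\<lambda>i. i + n"
  define same where "same \<chi> = Iff (tr \<chi>) (ren ?sh (tr \<chi>))" for \<chi>
  let ?\<Gamma> = "same ` ?X \<union> {\<phi>, Neg (ren ?sh \<phi>)}"
  let ?v = "Inr :: nat \<Rightarrow> 'm + nat"
  have wf: "wf_fm L \<psi>" if "\<psi> \<in> ?\<Gamma>" for \<psi> using that \<phi> wf_tr by (auto simp: same_def)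
  have fin: "\<exists>\<nu>. range \<nu> \<subseteq> univ M \<and> (\<forall>\<psi>\<in>S. sat M (\<lambda>i. case_sum id \<nu> (?v i)) \<psi>)"
    if S: "finite S" "S \<subseteq> ?\<Gamma>" for S
  proof -
    have "finite (S \<inter> same ` ?X)" "S \<inter> same ` ?X \<subseteq> same ` ?X" using S(1) by auto
    from finite_subset_image[OF this] obtain \<Delta> where \<Delta>: "\<Delta> \<subseteq> ?X" "finite \<Delta>" "S \<inter> same ` ?X = same ` \<Delta>"
      by auto
    from counter[OF \<Delta>(2,1)] obtain xs ys where xy: "xs \<in> tuples n (univ M)" "ys \<in> tuples n (univ M)"
      "\<forall>\<chi>\<in>\<Delta>. sat (CR M) (nth xs) \<chi> = sat (CR M) (nth ys) \<chi>" "sat M (nth xs) \<phi>" "\<not> sat M (nth ys) \<phi>"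
      by blast
    define \<nu> where "\<nu> i = (if i < n then xs ! i else if i < 2 * n then ys ! (i - n) else a)" for i
    have \<nu>: "range \<nu> \<subseteq> univ M"
    proof (rule image_subsetI)
      fix i
      have "xs ! i \<in> univ M" if "i < n" using xy(1) that nth_mem[of i xs] by (auto simp: tuples_def)
      moreover have "ys ! (i - n) \<in> univ M" if "\<not> i < n" "i < 2 * n"
        using xy(2) that nth_mem[of "i - n" ys] by (auto simp: tuples_def)
      ultimately show "\<nu> i \<in> univ M" using a by (simp add: \<nu>_def)
    qed
    have 1: "sat M \<nu> \<psi> = sat M (nth xs) \<psi>" "sat M (\<lambda>i. \<nu> (i + n)) \<psi> = sat M (nth ys) \<psi>"
      if "fv \<psi> \<subseteq> {..<n}" for \<psi>
      by (rule sat_cong; use that in \<open>auto simp: \<nu>_def\<close>)+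
    have "sat M \<nu> \<psi>" if \<psi>: "\<psi> \<in> S" for \<psi>
    proof -
      have "\<psi> \<in> ?\<Gamma>" using \<psi> S(2) by (rule subsetD[rotated])
      then have "\<psi> \<in> S \<inter> same ` ?X \<or> \<psi> = \<phi> \<or> \<psi> = Neg (ren ?sh \<phi>)" using \<psi> by auto
      then consider "\<psi> \<in> same ` \<Delta>" | "\<psi> = \<phi>" | "\<psi> = Neg (ren ?sh \<phi>)" unfolding \<Delta>(3) by argo
      then show ?thesis
      proof cases
        case 1: 1
        then obtain \<chi> where \<chi>: "\<psi> = same \<chi>" "\<chi> \<in> \<Delta>" by (rule imageE)
        then have X: "wf_fm CL \<chi>" "fv \<chi> \<subseteq> {..<n}" using \<Delta>(1) by auto
        have tr: "sat (CR M) (nth zs) \<chi> = sat M (nth zs) (tr \<chi>)" if "zs \<in> tuples n (univ M)" for zs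
          using that X by (intro sat_tr nth_image_subset) (auto simp: tuples_def)
        have "fv (tr \<chi>) \<subseteq> {..<n}" using fv_tr[OF X(1)] X(2) by blast
        note eqs = \<open>\<And>\<psi>. fv \<psi> \<subseteq> {..<n} \<Longrightarrow> sat M \<nu> \<psi> = sat M (nth xs) \<psi>\<close>[OF this]
          \<open>\<And>\<psi>. fv \<psi> \<subseteq> {..<n} \<Longrightarrow> sat M (\<lambda>i. \<nu> (i + n)) \<psi> = sat M (nth ys) \<psi>\<close>[OF this]
        have "sat M (nth xs) (tr \<chi>) = sat M (nth ys) (tr \<chi>)"
          using xy(3) \<chi>(2) tr[OF xy(1)] tr[OF xy(2)] by simp
        then show ?thesis unfolding \<chi>(1) same_def sat_Iff sat_ren eqs .
      next
        case 2
        then show ?thesis using 1(1)[OF \<phi>(2)] xy(4) by simp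
      next
        case 3
        then show ?thesis using 1(2)[OF \<phi>(2)] xy(5) by simp
      qed
    qed
    with \<nu> show ?thesis by (intro exI[of _ \<nu>]) simp
  qed
  have v: "range ?v \<subseteq> Inl ` univ M \<union> range Inr" by auto
  obtain N :: "('f, 'p, 'm) struct" and j \<nu> where N: "model N" "elem L M N j"
    "range \<nu> \<subseteq> univ N" "\<And>\<psi>. \<psi> \<in> ?\<Gamma> \<Longrightarrow> sat N (\<lambda>i. case_sum j \<nu> (?v i)) \<psi>"
    by (rule realize_model[OF M v wf fin]) (assumption | blast)+
  then have sat: "sat N \<nu> \<psi>" if "\<psi> \<in> ?\<Gamma>" for \<psi> using that by simp
  define xs ys where xy: "xs = map \<nu> [0..<n]" "ys = map (\<lambda>i. \<nu> (i + n)) [0..<n]"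
  have in': "set xs \<subseteq> univ N" "set ys \<subseteq> univ N" "length xs = n" "length ys = n" using N(3) by (auto simp: xy)
  have eqs: "sat N (nth xs) \<psi> = sat N \<nu> \<psi>" "sat N (nth ys) \<psi> = sat N (\<lambda>i. \<nu> (i + n)) \<psi>"
    if "fv \<psi> \<subseteq> {..<n}" for \<psi>
    by (rule sat_cong; use that in \<open>auto simp: xy\<close>)+
  have "tp CL (CR N) xs ys"
    unfolding tp_def
  proof (intro conjI allI impI)
    fix \<chi> assume "wf_fm CL \<chi> \<and> fv \<chi> \<subseteq> {..<length xs}"
    then have \<chi>: "wf_fm CL \<chi>" "fv \<chi> \<subseteq> {..<n}" using in' by auto
    then have "sat N \<nu> (same \<chi>)" by (intro sat) auto
    moreover have "fv (tr \<chi>) \<subseteq> {..<n}" using fv_tr[OF \<chi>(1)] \<chi>(2) by blast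
    ultimately have "sat N (nth xs) (tr \<chi>) = sat N (nth ys) (tr \<chi>)" using eqs by (simp add: same_def)
    moreover have "sat (CR N) (nth xs) \<chi> = sat N (nth xs) (tr \<chi>)" "sat (CR N) (nth ys) \<chi> = sat N (nth ys) (tr \<chi>)"
      using \<chi> in' by (intro sat_tr nth_image_subset; simp)+
    ultimately show "sat (CR N) (nth xs) \<chi> = sat (CR N) (nth ys) \<chi>" by simp
  qed (simp add: in')
  then have "tp L N xs ys" by (rule ccel_tp[OF N(1) _ in'(1,2)])
  then have "sat N (nth xs) \<phi> = sat N (nth ys) \<phi>" using \<phi> in' by (simp add: tp_def)
  moreover have "sat N \<nu> \<phi>" "sat N \<nu> (Neg (ren ?sh \<phi>))" by (rule sat; simp)+
  ultimately show False using eqs[OF \<phi>(2)] by simp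
qed

theorem def_equiv_CR:
  assumes M: "model M"
  shows "def_equiv L M CL (CR M)"
  unfolding def_equiv_CR_iff
proof (intro allI impI)
  fix n D assume "definable L M n D"
  then obtain \<phi> where \<phi>: "wf_fm L \<phi>" "fv \<phi> \<subseteq> {..<n}" and D: "D = defined_set M n \<phi>"
    by (auto simp: definable_def)
  obtain \<Delta> where \<Delta>: "finite \<Delta>" "\<And>\<chi>. \<chi> \<in> \<Delta> \<Longrightarrow> wf_fm CL \<chi> \<and> fv \<chi> \<subseteq> {..<n}"
    "\<And>xs ys. xs \<in> tuples n (univ M) \<Longrightarrow> ys \<in> tuples n (univ M) \<Longrightarrow>
       (\<And>\<chi>. \<chi> \<in> \<Delta> \<Longrightarrow> sat (CR M) (nth xs) \<chi> = sat (CR M) (nth ys) \<chi>) \<Longrightarrow>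
       sat M (nth xs) \<phi> \<Longrightarrow> sat M (nth ys) \<phi>"
    by (rule finitely_determined[OF M \<phi>]) blast
  show "definable CL (CR M) n D"
  proof (rule boolean_combination[OF \<Delta>(1,2)])
    show "D \<subseteq> tuples n (univ (CR M))" by (auto simp: D defined_set_def)
    fix xs ys assume "xs \<in> D" "ys \<in> tuples n (univ (CR M))"
      "\<And>\<chi>. \<chi> \<in> \<Delta> \<Longrightarrow> sat (CR M) (nth xs) \<chi> = sat (CR M) (nth ys) \<chi>"
    then show "ys \<in> D" using \<Delta>(3)[of xs ys] by (auto simp: D defined_set_def)
  qed
qed

end

section \<open>Transfer along complete theories\<close>

text \<open>Turns a statement about all \<open>n\<close>-tuples into a sentence, which completeness
  can carry from model to model.\<close>

definition closure :: "nat \<Rightarrow> ('f, 'p) fm \<Rightarrow> ('f, 'p) fm" where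
  "closure n \<theta> = Neg (Exs [0..<n] (Neg \<theta>))"

lemma sentence_closure: "wf_fm L \<theta> \<Longrightarrow> fv \<theta> \<subseteq> {..<n} \<Longrightarrow> sentence L (closure n \<theta>)"
  by (auto simp: sentence_def closure_def)

lemma holds_closure:
  assumes ne: "univ K \<noteq> {}" and fv: "fv \<theta> \<subseteq> {..<n}"
  shows "holds K (closure n \<theta>) \<longleftrightarrow> (\<forall>xs\<in>tuples n (univ K). sat K (nth xs) \<theta>)"
proof (intro iffI ballI)
  fix xs assume h: "holds K (closure n \<theta>)" and xs: "xs \<in> tuples n (univ K)"
  obtain a where a: "a \<in> univ K" using ne by auto
  let ?e = "\<lambda>i. if i < n then xs ! i else a"
  have e: "?e i \<in> univ K" for i using xs a nth_mem[of i xs] by (auto simp: tuples_def)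
  then have "range ?e \<subseteq> univ K" by (rule image_subsetI)
  then have "\<not> sat K ?e (Exs [0..<n] (Neg \<theta>))" using h by (simp add: holds_def closure_def)
  moreover have "sat K ?e (Exs [0..<n] (Neg \<theta>))" if "\<not> sat K ?e \<theta>"
    unfolding sat_Exs by (intro exI[of _ ?e] conjI allI impI ballI e) (use that in simp_all)
  ultimately have "sat K ?e \<theta>" by blast
  then show "sat K (nth xs) \<theta>" using fv sat_cong[of \<theta> ?e "nth xs" K] by fastforce
next
  assume h: "\<forall>xs\<in>tuples n (univ K). sat K (nth xs) \<theta>"
  have "sat K e' \<theta>" if "\<forall>i\<in>set [0..<n]. e' i \<in> univ K" for e'
  proof -
    have "map e' [0..<n] \<in> tuples n (univ K)" using that by (auto simp: tuples_def)
    then have "sat K (nth (map e' [0..<n])) \<theta>" using h by blast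
    moreover have "sat K (nth (map e' [0..<n])) \<theta> = sat K e' \<theta>"
      by (rule sat_cong) (use fv in auto)
    ultimately show ?thesis by blast
  qed
  then show "holds K (closure n \<theta>)" unfolding holds_def closure_def by (auto simp: sat_Exs)
qed

text \<open>The four conditions of \<open>convex_equiv_iff\<close> in the variables
  \<open>0\<close>, \<open>1\<close>, \<open>2\<close>: reflexivity, symmetry, transitivity,
  convexity.\<close>

definition convex_equiv_fm :: "'p \<Rightarrow> ('f, 'p) fm \<Rightarrow> ('f, 'p) fm" where
  "convex_equiv_fm lt \<psi> = Conj
     [ren (\<lambda>_. 0) \<psi>,
      Imp \<psi> (ren (\<lambda>n. if n = 0 then 1 else 0) \<psi>),
      Imp (And \<psi> (ren Suc \<psi>)) (ren (\<lambda>n. if n = 0 then 0 else 2) \<psi>),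
      Imp (And (ren (\<lambda>n. if n = 0 then 0 else 2) \<psi>) (And (Rel lt [Var 0, Var 1]) (Rel lt [Var 1, Var 2]))) \<psi>]"

lemma fv_convex_equiv_fm:
  assumes "fv \<psi> \<subseteq> {..<2}"
  shows "fv (convex_equiv_fm lt \<psi>) \<subseteq> {..<3}"
proof -
  have "n = 0 \<or> n = 1" if "n \<in> fv \<psi>" for n
    using assms that by (auto simp: less_2_cases_iff)
  then show ?thesis by (fastforce simp: convex_equiv_fm_def)
qed

lemma convex_equiv_holds:
  fixes K :: "('f, 'p, 'a) struct"
  assumes "univ K \<noteq> {}" "fv \<psi> \<subseteq> {..<2}"
  shows "convex_equiv K lt {(x, y). [x, y] \<in> defined_set K 2 \<psi>} \<longleftrightarrow> holds K (closure 3 (convex_equiv_fm lt \<psi>))"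
proof -
  let ?P = "sat2 K \<psi>"
  have r: "{(x, y). [x, y] \<in> defined_set K 2 \<psi>} = {(x, y). x \<in> univ K \<and> y \<in> univ K \<and> ?P x y}"
    using sat_nth2[OF assms(2), of K] by (auto simp: defined_set_def tuples_def)
  have "fv (convex_equiv_fm lt \<psi>) \<subseteq> {..<3}" by (rule fv_convex_equiv_fm[OF assms(2)])
  then have "holds K (closure 3 (convex_equiv_fm lt \<psi>)) \<longleftrightarrow>
      (\<forall>xs\<in>tuples 3 (univ K). sat K (nth xs) (convex_equiv_fm lt \<psi>))"
    by (rule holds_closure[OF assms(1)])
  also have "\<dots> \<longleftrightarrow> (\<forall>x\<in>univ K. \<forall>y\<in>univ K. \<forall>z\<in>univ K. sat K (nth [x, y, z]) (convex_equiv_fm lt \<psi>))"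
  proof (intro iffI ballI)
    fix xs assume *: "\<forall>x\<in>univ K. \<forall>y\<in>univ K. \<forall>z\<in>univ K. sat K (nth [x, y, z]) (convex_equiv_fm lt \<psi>)"
      and "xs \<in> tuples 3 (univ K)"
    then obtain x y z where "xs = [x, y, z]" "x \<in> univ K" "y \<in> univ K" "z \<in> univ K"
      by (auto simp: tuples_def length_Suc_conv numeral_3_eq_3)
    with * show "sat K (nth xs) (convex_equiv_fm lt \<psi>)" by blast
  qed (auto simp: tuples_def)
  also have "\<dots> \<longleftrightarrow> (\<forall>x\<in>univ K. \<forall>y\<in>univ K. \<forall>z\<in>univ K. ?P x x \<and> (?P x y \<longrightarrow> ?P y x) \<and>
      (?P x y \<and> ?P y z \<longrightarrow> ?P x z) \<and> (?P x z \<and> rint K lt [x, y] \<and> rint K lt [y, z] \<longrightarrow> ?P x y))"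
  proof (intro ball_cong refl)
    fix x y z :: 'a
    let ?e = "nth [x, y, z]"
    have c: "sat K (\<lambda>n. ?e (s n)) \<psi> = ?P (?e (s 0)) (?e (s 1))" for s :: "nat \<Rightarrow> nat"
      unfolding sat2_def by (rule sat_cong) (use assms(2) in \<open>auto simp: less_2_cases_iff dest!: subsetD\<close>)
    have e: "sat K ?e \<psi> = ?P x y" using c[of "\<lambda>n. n"] by simp
    have s: "sat K ?e (ren (\<lambda>_. 0) \<psi>) = ?P x x" "sat K ?e (ren (\<lambda>n. if n = 0 then 1 else 0) \<psi>) = ?P y x"
      "sat K ?e (ren Suc \<psi>) = ?P y z" "sat K ?e (ren (\<lambda>n. if n = 0 then 0 else 2) \<psi>) = ?P x z"
      unfolding sat_ren c by simp_all
    show "sat K ?e (convex_equiv_fm lt \<psi>) = (?P x x \<and> (?P x y \<longrightarrow> ?P y x) \<and>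
      (?P x y \<and> ?P y z \<longrightarrow> ?P x z) \<and> (?P x z \<and> rint K lt [x, y] \<and> rint K lt [y, z] \<longrightarrow> ?P x y))"
      by (simp add: convex_equiv_fm_def e s del: sat_ren)
  qed
  also have "\<dots> \<longleftrightarrow> convex_equiv K lt {(x, y). [x, y] \<in> defined_set K 2 \<psi>}"
    by (rule convex_equiv_iff[OF r, symmetric])
  finally show ?thesis by blast
qed

lemma sentence_convex_equiv:
  assumes "wf_fm L \<psi>" "fv \<psi> \<subseteq> {..<2}" "(lt, 2) \<in> rels L"
  shows "sentence L (closure 3 (convex_equiv_fm lt \<psi>))"
proof (rule sentence_closure)
  show "wf_fm L (convex_equiv_fm lt \<psi>)" using assms by (simp add: convex_equiv_fm_def numeral_2_eq_2)
  show "fv (convex_equiv_fm lt \<psi>) \<subseteq> {..<3}" by (rule fv_convex_equiv_fm[OF assms(2)])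
qed

section \<open>Complete theories: from definitional equivalence to (SLB), and the passage between
  models and theories\<close>

locale complete_linear_theory = linear_theory L lt T ty
  for L :: "('f, 'p) lang" and lt T and ty :: "'m itself" +
  assumes complete: "\<And>\<sigma> (M :: ('f, 'p, 'm) struct) (N :: ('f, 'p, 'm) struct).
    sentence L \<sigma> \<Longrightarrow> is_model L T M \<Longrightarrow> is_model L T N \<Longrightarrow> holds M \<sigma> \<Longrightarrow> holds N \<sigma>"
begin

lemma univ_nonempty: "model M \<Longrightarrow> univ M \<noteq> {}"
  using model_struct by (auto simp: is_struct_def)

lemma transfer_formula:
  assumes "model M" "model N" "wf_fm L \<theta>" "fv \<theta> \<subseteq> {..<n}"
    and "\<And>xs. xs \<in> tuples n (univ M) \<Longrightarrow> sat M (nth xs) \<theta>" and "xs \<in> tuples n (univ N)"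
  shows "sat N (nth xs) \<theta>"
  using complete[OF sentence_closure[OF assms(3,4)] assms(1,2)] assms(5,6)
    holds_closure[OF univ_nonempty[OF assms(1)] assms(4)]
    holds_closure[OF univ_nonempty[OF assms(2)] assms(4)] by blast

text \<open>Only pairs with one element on each side of \<open>C\<close> need an argument, and their
  order never changes. If \<open>u\<close> in \<open>C\<close> is equivalent to \<open>v\<close>
  outside, then \<open>f u\<close> is equivalent to \<open>f v\<close>. The smaller of
  \<open>v\<close> and \<open>f v\<close> lies between \<open>C\<close> and the larger, so convexity
  puts all four into one class.\<close>

lemma glue_CR:
  assumes N: "model N" and C: "initial_part N lt C" and f: "automorphism L N f" "f ` C = C"
  shows "automorphism CL (CR N) (\<lambda>x. if x \<in> C then f x else x)" (is "automorphism _ _ ?g")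
proof -
  note str = model_struct[OF N]
  have CN: "C \<subseteq> univ N" using C by (simp add: initial_part_def)
  have down: "d \<in> C" if "c \<in> C" "d \<in> univ N" "less N d c" for c d
    using C that CN by (auto simp: initial_part_def ord_rel_def)
  have fC: "f x \<in> C \<longleftrightarrow> x \<in> C" if "x \<in> univ N" for x
  proof
    assume "f x \<in> C"
    then have "f x \<in> f ` C" using f(2) by simp
    then obtain y where y: "f x = f y" "y \<in> C" by (rule imageE)
    then have "x = y" using automorphism_eq_iff[OF f(1) that, of y] CN by auto
    with y show "x \<in> C" by simp
  qed (use f(2) in auto)
  have fN: "f x \<in> univ N" if "x \<in> univ N" for x using automorphism_in[OF f(1) that] .
  have below: "less N x y" "\<not> less N y x" if "x \<in> C" "y \<in> univ N" "y \<notin> C" for x y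
  proof -
    have xN: "x \<in> univ N" "x \<noteq> y" using that CN by auto
    show no: "\<not> less N y x" using down[OF that(1,2)] that(3) by blast
    show "less N x y" using less_total[OF N xN(1) that(2)] xN(2) no by blast
  qed
  have bij: "bij_betw ?g (univ N) (univ N)"
  proof -
    have "inj_on f (univ N)" using f(1) by (simp add: automorphism_def bij_betw_def)
    then have "inj_on f C" using CN by (rule inj_on_subset)
    then have "bij_betw f C C" by (simp add: bij_betw_def f(2))
    moreover have "bij_betw ?g C C \<longleftrightarrow> bij_betw f C C" by (rule bij_betw_cong) simp
    ultimately have "bij_betw ?g C C" by blast
    moreover have "bij_betw ?g (univ N - C) (univ N - C) \<longleftrightarrow> bij_betw id (univ N - C) (univ N - C)"
      by (rule bij_betw_cong) simp
    then have "bij_betw ?g (univ N - C) (univ N - C)" by simp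
    ultimately have "bij_betw ?g (C \<union> (univ N - C)) (C \<union> (univ N - C))"
      by (rule bij_betw_combine) auto
    moreover have "C \<union> (univ N - C) = univ N" using CN by auto
    ultimately show ?thesis by simp
  qed
  have less: "less N (?g x) (?g y) = less N x y" if "x \<in> univ N" "y \<in> univ N" for x y
    using less_automorphism[OF N f(1) that] below[of "f x" y] below[of x y] below[of "f y" x] below[of y x]
      fC that by auto
  have pset: "[?g x] \<in> defined_set N 1 \<phi> \<longleftrightarrow> [x] \<in> defined_set N 1 \<phi>"
    if "wf_fm L \<phi>" "fv \<phi> \<subseteq> {..<1}" "x \<in> univ N" for \<phi> x
    using elem_sat_nth[OF automorphism_elem[OF str f(1)] str, of "[x]" \<phi>] that fN
    by (auto simp: defined_set_def tuples_def)
  have ceq: "[?g x, ?g y] \<in> defined_set N 2 \<psi> \<longleftrightarrow> [x, y] \<in> defined_set N 2 \<psi>"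
    if \<psi>: "(CEq \<psi>, 2) \<in> rels CL" and xy: "x \<in> univ N" "y \<in> univ N" for \<psi> x y
  proof -
    let ?P = "\<lambda>x y. [x, y] \<in> defined_set N 2 \<psi>"
    have \<psi>': "wf_fm L \<psi>" "fv \<psi> \<subseteq> {..<2}" "convex_equiv N lt {(x, y). ?P x y}"
      using \<psi> N by (auto simp: CL_simps)
    have r: "{(x, y). ?P x y} = {(x, y). x \<in> univ N \<and> y \<in> univ N \<and> ?P x y}"
      by (auto simp: defined_set_def tuples_def)
    have R: "?P u u \<and> (?P u v \<longrightarrow> ?P v u) \<and> (?P u v \<and> ?P v w \<longrightarrow> ?P u w) \<and>
        (?P u w \<and> less N u v \<and> less N v w \<longrightarrow> ?P u v)"
      if "u \<in> univ N" "v \<in> univ N" "w \<in> univ N" for u v w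
      using \<psi>'(3) that unfolding convex_equiv_iff[OF r] by blast
    have inv: "?P (f u) (f v) \<longleftrightarrow> ?P u v" if "u \<in> univ N" "v \<in> univ N" for u v
    proof -
      have "set [u, v] \<subseteq> univ N" "fv \<psi> \<subseteq> {..<length [u, v]}" using that \<psi>'(2) by (simp_all add: numeral_2_eq_2)
      from elem_sat_nth[OF automorphism_elem[OF str f(1)] str this(1) \<psi>'(1) this(2)]
      have "sat N (nth [f u, f v]) \<psi> = sat N (nth [u, v]) \<psi>" by simp
      then show ?thesis using that fN by (simp add: defined_set_def tuples_def)
    qed
    have cross: "?P (f u) v \<longleftrightarrow> ?P u v" if u: "u \<in> C" and v: "v \<in> univ N" "v \<notin> C" for u v
    proof
      have uN: "u \<in> univ N" "f u \<in> univ N" "f u \<in> C" using u CN fC fN by auto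
      have vN: "f v \<in> univ N" "f v \<notin> C" using v fC fN by auto
      show "?P (f u) v" if P: "?P u v"
      proof -
        have fP: "?P (f u) (f v)" using inv uN v P by blast
        consider "f v = v" | "less N v (f v)" | "less N (f v) v" using less_total[OF N v(1) vN(1)] by auto
        then show ?thesis
        proof cases
          case 2
          then show ?thesis using R[OF uN(2) v(1) vN(1)] fP below(1)[OF uN(3) v] by argo
        next
          case 3
          then have "?P u (f v)" using R[OF uN(1) vN(1) v(1)] P below(1)[OF u vN] by argo
          then have "?P (f v) v" using R[OF uN(1) vN(1) v(1)] R[OF vN(1) uN(1) v(1)] P by argo
          then show ?thesis using R[OF uN(2) vN(1) v(1)] fP by argo
        qed (use fP in simp)
      qed
      show "?P u v" if P: "?P (f u) v"
      proof -
        \<comment> \<open>For the reverse direction the preimage \<open>w\<close> of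
          \<open>v\<close> takes the place of \<open>f v\<close>.\<close>
        have "v \<in> f ` univ N" using f(1) v(1) by (simp add: automorphism_def bij_betw_def)
        then obtain w where w: "v = f w" "w \<in> univ N" by (rule imageE)
        then have w: "w \<in> univ N" "f w = v" by simp_all
        have wC: "w \<notin> C" using w v fC by auto
        have Pw: "?P u w" using inv[OF uN(1) w(1)] P w(2) by simp
        consider "w = v" | "less N v w" | "less N w v" using less_total[OF N v(1) w(1)] by auto
        then show ?thesis
        proof cases
          case 2
          then show ?thesis using R[OF uN(1) v(1) w(1)] Pw below(1)[OF u v] by argo
        next
          case 3
          then have "?P (f u) w" using R[OF uN(2) w(1) v(1)] P below(1)[OF uN(3) w(1) wC] by argo
          then have "?P w v" using R[OF uN(2) w(1) v(1)] R[OF w(1) uN(2) v(1)] P by argo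
          then show ?thesis using R[OF uN(1) w(1) v(1)] Pw by argo
        qed (use Pw in simp)
      qed
    qed
    have sym: "?P u v \<longleftrightarrow> ?P v u" if "u \<in> univ N" "v \<in> univ N" for u v
      using R[OF that that(1)] R[OF that(2,1,1)] by argo
    consider "x \<in> C" "y \<in> C" | "x \<in> C" "y \<notin> C" | "x \<notin> C" "y \<in> C" | "x \<notin> C" "y \<notin> C" by blast
    then show ?thesis
    proof cases
      case 1
      then show ?thesis using inv[OF xy] by simp
    next
      case 2
      then show ?thesis using cross[OF 2(1) xy(2) 2(2)] by simp
    next
      case 3
      then show ?thesis
        using cross[OF 3(2) xy(1) 3(1)] sym[OF xy(1) fN[OF xy(2)]] sym[OF xy] by simp
    qed simp
  qed
  show ?thesis
    unfolding automorphism_def CR_simps(1)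
  proof (intro conjI ballI)
    show "bij_betw ?g (univ N) (univ N)" by (rule bij)
  next
    fix s assume s: "s \<in> rels CL"
    obtain p n where pn: "s = (p, n)" by (cases s)
    have "rint (CR N) p xs = rint (CR N) p (map ?g xs)" if xs: "xs \<in> tuples n (univ N)" for xs
    proof (cases p)
      case Less
      then have "n = 2" using s pn by (simp add: CL_simps)
      then obtain x y where "xs = [x, y]" "x \<in> univ N" "y \<in> univ N"
        using xs by (auto simp: tuples_def length_Suc_conv numeral_2_eq_2)
      then show ?thesis using less by (simp add: Less)
    next
      case (PSet \<phi>)
      then have "n = 1" and \<phi>: "wf_fm L \<phi>" "fv \<phi> \<subseteq> {..<1}" using s pn by (auto simp: CL_simps)
      then obtain x where "xs = [x]" "x \<in> univ N"
        using xs by (auto simp: tuples_def length_Suc_conv)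
      then show ?thesis using pset[OF \<phi>] by (simp add: PSet)
    next
      case (CEq \<psi>)
      then have n: "n = 2" using s pn by (simp add: CL_simps)
      then have \<psi>: "(CEq \<psi>, 2) \<in> rels CL" using s pn CEq by simp
      obtain x y where "xs = [x, y]" "x \<in> univ N" "y \<in> univ N"
        using xs n by (auto simp: tuples_def length_Suc_conv numeral_2_eq_2)
      then show ?thesis using ceq[OF \<psi>] by (simp add: CEq)
    qed
    then show "case s of (p, n) \<Rightarrow> \<forall>xs\<in>tuples n (univ N). rint (CR N) p xs = rint (CR N) p (map ?g xs)"
      by (simp add: pn)
  qed (simp add: CL_simps)
qed

text \<open>The hypothesis concerns the single model \<open>M\<close>, (SLB) all models. That a
  formula is equivalent to its counterpart from the reduct can be stated as a sentence, so
  completeness carries it to \<open>N\<close>, where the glued map respects the reduct by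
  \<open>glue_CR\<close>.\<close>

theorem def_equiv_imp_SLB:
  assumes M: "model M" and eq: "def_equiv L M CL (CR M)"
  shows "SLB ty L lt T"
  unfolding SLB_def
proof (intro allI impI, elim conjE)
  fix N :: "('f, 'p, 'm) struct" and C f
  assume N: "model N" and C: "initial_part N lt C" and f: "automorphism L N f" "f ` C = C"
  let ?g = "\<lambda>x. if x \<in> C then f x else x"
  note str = model_struct[OF N]
  note g = glue_CR[OF N C f]
  have gN: "?g x \<in> univ N" if "x \<in> univ N" for x using automorphism_in[OF g, of x] that by simp
  have pres: "sat N (nth xs) \<theta> = sat N (nth (map ?g xs)) \<theta>"
    if \<theta>: "wf_fm L \<theta>" "fv \<theta> \<subseteq> {..<n}" and xs: "xs \<in> tuples n (univ N)" for \<theta> n xs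
  proof -
    have "definable CL (CR M) n (defined_set M n \<theta>)" using eq \<theta> unfolding def_equiv_def definable_def by blast
    then obtain \<chi> where \<chi>: "wf_fm CL \<chi>" "fv \<chi> \<subseteq> {..<n}" "defined_set M n \<theta> = defined_set (CR M) n \<chi>"
      by (auto simp: definable_def)
    then have "defined_set M n \<theta> = defined_set M n (tr \<chi>)" using defined_set_tr[OF \<chi>(1,2)] by simp
    then have "sat M (nth zs) (Iff \<theta> (tr \<chi>))" if "zs \<in> tuples n (univ M)" for zs
      using that by (auto simp: defined_set_def)
    moreover have "wf_fm L (Iff \<theta> (tr \<chi>))" "fv (Iff \<theta> (tr \<chi>)) \<subseteq> {..<n}"
      using \<theta> wf_tr[OF \<chi>(1)] fv_tr[OF \<chi>(1)] \<chi>(2) by auto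
    ultimately have "sat N (nth zs) (Iff \<theta> (tr \<chi>))" if "zs \<in> tuples n (univ N)" for zs
      using transfer_formula[OF M N] that by blast
    then have *: "sat N (nth zs) \<theta> = sat (CR N) (nth zs) \<chi>" if "zs \<in> tuples n (univ N)" for zs
      using that \<chi>(1,2) sat_tr[OF \<chi>(1), of "nth zs" N] nth_image_subset[of zs "univ N" "fv \<chi>"]
      by (simp add: tuples_def)
    have gxs: "map ?g xs \<in> tuples n (univ N)" using xs automorphism_in[OF f(1)] by (auto simp: tuples_def)
    have "sat (CR N) (nth (map ?g xs)) \<chi> = sat (CR N) (nth xs) \<chi>"
      using elem_sat_nth[OF automorphism_elem[OF CR_struct[OF str] g] CR_struct[OF str], of xs \<chi>] xs \<chi>
      by (simp add: tuples_def)
    then show ?thesis unfolding *[OF xs] *[OF gxs] by simp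
  qed
  show "automorphism L N ?g"
    unfolding automorphism_def
  proof (intro conjI ballI)
    show "bij_betw ?g (univ N) (univ N)" using g by (simp add: automorphism_def)
  next
    fix s assume s: "s \<in> funs L"
    obtain k n where kn: "s = (k, n)" by (cases s)
    have "?g (fint N k xs) = fint N k (map ?g xs)" if xs: "xs \<in> tuples n (univ N)" for xs
    proof -
      \<comment> \<open>A function is handled through its graph, a definable set in
        \<open>n + 1\<close> variables.\<close>
      let ?\<theta> = "Eq (Fn k (map Var [0..<n])) (Var n) :: ('f, 'p) fm"
      let ?ys = "xs @ [fint N k xs]"
      have len: "length xs = n" using xs by (simp add: tuples_def)
      have val: "fint N k xs \<in> univ N" using str s kn xs by (fastforce simp: is_struct_def)
      have "sat N (nth zs) ?\<theta> \<longleftrightarrow> fint N k (take n zs) = zs ! n" if "length zs = Suc n" for zs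
      proof -
        have "map (nth zs) [0..<n] = take n zs" using that by (intro nth_equalityI) auto
        then show ?thesis by (simp add: comp_def)
      qed
      note graph = this
      have "sat N (nth ?ys) ?\<theta> = sat N (nth (map ?g ?ys)) ?\<theta>"
        using xs val s kn by (intro pres[of _ "Suc n"]) (auto simp: tuples_def list_all_iff)
      moreover have "sat N (nth ?ys) ?\<theta>" using graph[of ?ys] len by (simp add: nth_append)
      ultimately have "sat N (nth (map ?g ?ys)) ?\<theta>" by blast
      then show ?thesis using graph[of "map ?g ?ys"] len by (simp add: nth_append)
    qed
    then show "case s of (k, n) \<Rightarrow> \<forall>xs\<in>tuples n (univ N). ?g (fint N k xs) = fint N k (map ?g xs)"
      by (simp add: kn)
  next
    fix s assume s: "s \<in> rels L"
    obtain p n where pn: "s = (p, n)" by (cases s)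
    have "rint N p xs = rint N p (map ?g xs)" if xs: "xs \<in> tuples n (univ N)" for xs
    proof -
      let ?\<theta> = "Rel p (map Var [0..<n]) :: ('f, 'p) fm"
      have *: "sat N (nth zs) ?\<theta> \<longleftrightarrow> rint N p zs" if "length zs = n" for zs
      proof -
        have "map (nth zs) [0..<n] = zs" using that by (intro nth_equalityI) auto
        then show ?thesis by (simp add: comp_def)
      qed
      have "sat N (nth xs) ?\<theta> = sat N (nth (map ?g xs)) ?\<theta>"
        using xs s pn by (intro pres[of _ n]) (auto simp: list_all_iff)
      moreover have "length xs = n" "length (map ?g xs) = n" using xs by (simp_all add: tuples_def)
      ultimately show ?thesis using *[of xs] *[of "map ?g xs"] by blast
    qed
    then show "case s of (p, n) \<Rightarrow> \<forall>xs\<in>tuples n (univ N). rint N p xs = rint N p (map ?g xs)"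
      by (simp add: pn)
  qed
qed

primrec relabel :: "('q \<Rightarrow> 'r) \<Rightarrow> ('g, 'q) fm \<Rightarrow> ('g, 'r) fm" where
  "relabel m (Eq s t) = Eq s t"
| "relabel m (Rel p ts) = Rel (m p) ts"
| "relabel m (Neg \<chi>) = Neg (relabel m \<chi>)"
| "relabel m (And \<chi> \<chi>') = And (relabel m \<chi>) (relabel m \<chi>')"
| "relabel m (Exists x \<chi>) = Exists x (relabel m \<chi>)"

lemma fv_relabel: "fv (relabel m \<chi>) = fv \<chi>"
  by (induction \<chi>) auto

text \<open>In \<open>N\<close>, a symbol naming \<open>\<psi>\<close> may denote a set other than
  the one that \<open>\<psi>\<close> defines in \<open>M\<close>. Each relation of \<open>N\<close>
  is still definable in \<open>M\<close> and therefore carries some name in the reduct of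
  \<open>M\<close>; \<open>relabel\<close> exchanges the names.\<close>

theorem def_equiv_theories_imp:
  assumes "def_equiv_theories ty L lt T CL Less (ccel_theory ty L lt T)"
  shows "\<exists>M. model M \<and> def_equiv L M CL (CR M)"
proof -
  obtain M :: "('f, 'p, 'm) struct" and N :: "('f, ('f, 'p) ccel_sym, 'm) struct"
    where M: "model M" and N: "is_model CL (ccel_theory ty L lt T) N"
      and ord: "ord_rel M lt = ord_rel N Less" and eq: "def_equiv L M CL N"
    using assms unfolding def_equiv_theories_def by blast
  have U: "univ M = univ N" and dfn: "\<And>n D. definable L M n D \<longleftrightarrow> definable CL N n D"
    using eq by (auto simp: def_equiv_def)
  define M0 :: "('f, 'p, 'm) struct" where "M0 = (SOME M. model M)"
  have M0: "model M0" unfolding M0_def using M by (rule someI)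
  have th: "holds N \<sigma>" if "sentence CL \<sigma>" "holds (CR M0) \<sigma>" for \<sigma>
    using N that by (simp add: is_model_def ccel_theory_def theory_of_def M0_def)
  have conv_cong: "convex_equiv K l r = convex_equiv K' l' r"
    if "univ K = univ K'" "ord_rel K l = ord_rel K' l'"
    for K :: "('g, 'q, 'm) struct" and l and K' :: "('g', 'q', 'm) struct" and l' r
    using that by (simp add: convex_equiv_def convex_in_def)
  have ordC: "ord_rel (CR K) Less = ord_rel K lt" for K by (simp add: ord_rel_def)
  have "\<exists>s'. \<forall>k. (s, k) \<in> rels CL \<longrightarrow> (s', k) \<in> rels CL \<and>
      (\<forall>xs\<in>tuples k (univ M). rint (CR M) s' xs = rint N s xs)" for s
  proof (cases "\<exists>k. (s, k) \<in> rels CL")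
    case True
    then obtain k where k: "(s, k) \<in> rels CL" by blast
    have uniq: "k' = k" if "(s, k') \<in> rels CL" for k' using that k by (cases s) (auto simp: CL_simps)
    let ?\<theta> = "Rel s (map Var [0..<k])"
    have \<theta>: "wf_fm CL ?\<theta>" "fv ?\<theta> \<subseteq> {..<k}" using k by (auto simp: list_all_iff)
    have s\<theta>: "sat K (nth xs) ?\<theta> \<longleftrightarrow> rint K s xs" if "length xs = k"
      for K :: "('f, ('f, 'p) ccel_sym, 'm) struct" and xs
    proof -
      have "map (nth xs) [0..<k] = xs" using that by (intro nth_equalityI) auto
      then show ?thesis by (simp add: comp_def)
    qed
    have "definable CL N k (defined_set N k ?\<theta>)" unfolding definable_def using \<theta> by blast
    then have "definable L M k (defined_set N k ?\<theta>)" by (simp only: dfn)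
    then obtain \<phi> where \<phi>: "wf_fm L \<phi>" "fv \<phi> \<subseteq> {..<k}" "defined_set N k ?\<theta> = defined_set M k \<phi>"
      by (auto simp: definable_def)
    have mem: "xs \<in> defined_set M k \<phi> \<longleftrightarrow> rint N s xs" if "xs \<in> tuples k (univ M)" for xs
      unfolding \<phi>(3)[symmetric] using that s\<theta>[of xs N] by (auto simp: defined_set_def U tuples_def)
    have "\<exists>s'. (s', k) \<in> rels CL \<and> (\<forall>xs\<in>tuples k (univ M). rint (CR M) s' xs = rint N s xs)"
    proof (cases s)
      case Less
      then have k2: "k = 2" using k by (simp add: CL_simps)
      have "rint M lt xs = rint N Less xs" if xs: "xs \<in> tuples 2 (univ M)" for xs
      proof -
        obtain x y where xy: "xs = [x, y]" "x \<in> univ M" "y \<in> univ M"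
          using xs by (auto simp: tuples_def length_Suc_conv numeral_2_eq_2)
        have "(x, y) \<in> ord_rel M lt \<longleftrightarrow> (x, y) \<in> ord_rel N Less" using ord by simp
        then show ?thesis using xy U by (simp add: ord_rel_def)
      qed
      then show ?thesis using k2 by (intro exI[of _ Less]) (simp add: CL_simps Less)
    next
      case (PSet \<psi>)
      then have "k = 1" using k by (simp add: CL_simps)
      then show ?thesis using \<phi> mem by (intro exI[of _ "PSet \<phi>"]) (simp add: CL_simps)
    next
      case (CEq \<psi>)
      then have k2: "k = 2" using k by (simp add: CL_simps)
      \<comment> \<open>The new name has to belong to the language. That the relation is a convex
        equivalence is a sentence of the ccel-theory, hence true in \<open>N\<close>; the common
        order carries it to \<open>M\<close>, and completeness from \<open>M\<close> to all
        models.\<close>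
      have "convex_equiv M0 lt {(x, y). [x, y] \<in> defined_set M0 2 \<psi>}"
        using k M0 by (auto simp: CEq CL_simps)
      also have "{(x, y). [x, y] \<in> defined_set M0 2 \<psi>} = {(x, y). [x, y] \<in> defined_set (CR M0) 2 ?\<theta>}"
        using s\<theta>[of _ "CR M0"] k2 by (auto simp: CEq defined_set_def tuples_def)
      also have "convex_equiv M0 lt \<dots> = convex_equiv (CR M0) Less \<dots>" by (rule conv_cong) (simp_all add: ordC)
      also have "\<dots> = holds (CR M0) (closure 3 (convex_equiv_fm Less ?\<theta>))"
        using \<theta>(2) univ_nonempty[OF M0] k2 by (intro convex_equiv_holds) auto
      finally have "holds (CR M0) (closure 3 (convex_equiv_fm Less ?\<theta>))" .
      then have "holds N (closure 3 (convex_equiv_fm Less ?\<theta>))"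
        using \<theta> k2 by (intro th sentence_convex_equiv) (auto simp: CL_simps)
      then have "convex_equiv N Less {(x, y). [x, y] \<in> defined_set N 2 ?\<theta>}"
        using \<theta>(2) univ_nonempty[OF M] k2 U by (subst convex_equiv_holds) auto
      also have "{(x, y). [x, y] \<in> defined_set N 2 ?\<theta>} = {(x, y). [x, y] \<in> defined_set M 2 \<phi>}"
        using \<phi>(3) k2 by simp
      also have "convex_equiv N Less \<dots> = convex_equiv M lt \<dots>" by (rule conv_cong) (simp_all add: U ord)
      also have "\<dots> = holds M (closure 3 (convex_equiv_fm lt \<phi>))"
        using \<phi>(2) univ_nonempty[OF M] k2 by (intro convex_equiv_holds) auto
      finally have hM: "holds M (closure 3 (convex_equiv_fm lt \<phi>))" .
      have "convex_equiv K lt {(x, y). [x, y] \<in> defined_set K 2 \<phi>}" if K: "model K" for K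
      proof -
        have "holds K (closure 3 (convex_equiv_fm lt \<phi>))"
          using \<phi> k2 lt_symbol by (intro complete[OF _ M K hM] sentence_convex_equiv) auto
        then show ?thesis using \<phi>(2) univ_nonempty[OF K] k2 by (subst convex_equiv_holds) auto
      qed
      then have "(CEq \<phi>, 2) \<in> rels CL" using \<phi> k2 by (simp add: CL_simps)
      then show ?thesis using mem k2 by (intro exI[of _ "CEq \<phi>"]) simp
    qed
    then show ?thesis using uniq by blast
  qed blast
  then obtain m where m: "\<And>s k. (s, k) \<in> rels CL \<Longrightarrow> (m s, k) \<in> rels CL"
    "\<And>s k xs. (s, k) \<in> rels CL \<Longrightarrow> xs \<in> tuples k (univ M) \<Longrightarrow> rint (CR M) (m s) xs = rint N s xs"
    by metis
  have wf: "wf_fm CL (relabel m \<chi>)" if "wf_fm CL \<chi>" for \<chi>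
    using that m(1) by (induction \<chi>) auto
  have sat: "sat (CR M) e (relabel m \<chi>) = sat N e \<chi>" if "wf_fm CL \<chi>" "e ` fv \<chi> \<subseteq> univ M" for \<chi> e
    using that
  proof (induction \<chi> arbitrary: e)
    case (Eq s t)
    then show ?case by (auto simp: CL_tm)
  next
    case (Rel s ts)
    have ev: "eval_tm (CR M) e t = eval_tm N e t" "eval_tm N e t \<in> univ M" if t: "t \<in> set ts" for t
    proof -
      obtain i where "t = Var i" using t Rel.prems(1) by (auto simp: list_all_iff CL_tm)
      then show "eval_tm (CR M) e t = eval_tm N e t" "eval_tm N e t \<in> univ M"
        using t Rel.prems(2) by force+
    qed
    then have "map (eval_tm (CR M) e) ts = map (eval_tm N e) ts" by simp
    moreover have "map (eval_tm N e) ts \<in> tuples (length ts) (univ M)" using ev by (auto simp: tuples_def)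
    ultimately show ?case using m(2)[of s "length ts"] Rel.prems(1) by (simp del: map_eq_conv)
  next
    case (Exists x \<chi>)
    have "sat (CR M) (e(x := a)) (relabel m \<chi>) = sat N (e(x := a)) \<chi>" if "a \<in> univ M" for a
      using Exists.prems that by (intro Exists.IH) auto
    then show ?case by (simp add: U)
  qed (auto simp: image_Un)
  have "def_equiv L M CL (CR M)"
    unfolding def_equiv_CR_iff
  proof (intro allI impI)
    fix n D assume "definable L M n D"
    then obtain \<chi> where \<chi>: "wf_fm CL \<chi>" "fv \<chi> \<subseteq> {..<n}" "D = defined_set N n \<chi>"
      unfolding dfn by (auto simp: definable_def)
    have "sat (CR M) (nth xs) (relabel m \<chi>) = sat N (nth xs) \<chi>" if "xs \<in> tuples n (univ M)" for xs
      using that \<chi> by (intro sat nth_image_subset) (auto simp: tuples_def)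
    then have "D = defined_set (CR M) n (relabel m \<chi>)" by (auto simp: \<chi>(3) defined_set_def U)
    then show "definable CL (CR M) n D"
      unfolding definable_def using wf[OF \<chi>(1)] \<chi>(2) by (intro exI[of _ "relabel m \<chi>"]) (simp add: fv_relabel)
  qed
  with M show ?thesis by blast
qed

text \<open>The reduct of the model chosen in the definition of \<open>ccel_theory\<close> satisfies
  that theory by construction, with the order unchanged.\<close>

theorem def_equiv_imp_theories:
  assumes "model M" "\<And>M. model M \<Longrightarrow> def_equiv L M CL (CR M)"
  shows "def_equiv_theories ty L lt T CL Less (ccel_theory ty L lt T)"
proof -
  define M0 :: "('f, 'p, 'm) struct" where "M0 = (SOME M. model M)"
  have M0: "model M0" unfolding M0_def using assms(1) by (rule someI)
  have "is_model CL (ccel_theory ty L lt T) (CR M0)"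
    using CR_struct[OF model_struct[OF M0]]
    by (auto simp: is_model_def ccel_theory_def theory_of_def M0_def)
  moreover have "ord_rel M0 lt = ord_rel (CR M0) Less" by (simp add: ord_rel_def)
  ultimately show ?thesis using M0 assms(2) unfolding def_equiv_theories_def by blast
qed

end

theorem theorem1:
  fixes L :: "('f, 'p) lang" and lt :: 'p and T :: "('f, 'p) fm set"
  assumes lt_symbol: "(lt, 2) \<in> rels L"
    and large: "{\<phi>. wf_fm L \<phi>} \<lesssim> (UNIV :: 'm set)"
    and complete: "complete_theory TYPE('m) L T"
    and inf_model: "\<exists>M :: ('f, 'p, 'm) struct. is_model L T M \<and> infinite (univ M)"
    and linear: "\<And>M :: ('f, 'p, 'm) struct. is_model L T M \<Longrightarrow> lin_ordered M lt"
  shows "(SLB TYPE('m) L lt T \<longleftrightarrow>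
            def_equiv_theories TYPE('m) L lt T
              (ccel_lang TYPE('m) L lt T) Less (ccel_theory TYPE('m) L lt T)) \<and>
         (SLB TYPE('m) L lt T \<longleftrightarrow>
            (\<exists>M :: ('f, 'p, 'm) struct. is_model L T M \<and>
               def_equiv L M (ccel_lang TYPE('m) L lt T) (ccel_reduct lt M))) \<and>
         (SLB TYPE('m) L lt T \<longleftrightarrow>
            (\<forall>M :: ('f, 'p, 'm) struct. is_model L T M \<longrightarrow>
               def_equiv L M (ccel_lang TYPE('m) L lt T) (ccel_reduct lt M)))"
proof -
  have sentences: "sentence L \<sigma>" if "\<sigma> \<in> T" for \<sigma> using complete that by (simp add: complete_theory_def)
  have transfer: "holds N \<sigma>" if h: "sentence L \<sigma>" "is_model L T M" "is_model L T N" "holds M \<sigma>"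
    for \<sigma> and M N :: "('f, 'p, 'm) struct"
  proof -
    \<comment> \<open>On a nonempty universe a sentence and its negation cannot both hold, so
      \<open>complete\<close> must decide in favour of \<open>\<sigma>\<close>.\<close>
    have "\<not> holds M (Neg \<sigma>)"
    proof
      assume "holds M (Neg \<sigma>)"
      moreover obtain a where "a \<in> univ M" using h(2) by (auto simp: is_model_def is_struct_def)
      then have "range (\<lambda>_ :: nat. a) \<subseteq> univ M" by auto
      ultimately show False using h(4) unfolding holds_def by fastforce
    qed
    then show ?thesis using complete h(1-3) unfolding complete_theory_def by blast
  qed
  interpret complete_linear_theory L lt T "TYPE('m)"
  proof unfold_locales
    show "(lt, 2) \<in> rels L" by (rule lt_symbol)
    show "{\<phi>. wf_fm L \<phi>} \<lesssim> (UNIV :: 'm set)" by (rule large)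
    show "sentence L \<sigma>" if "\<sigma> \<in> T" for \<sigma> using that by (rule sentences)
    show "lin_ordered M lt" if "is_model L T M" for M :: "('f, 'p, 'm) struct" using that by (rule linear)
    show "holds N \<sigma>" if "sentence L \<sigma>" "is_model L T M" "is_model L T N" "holds M \<sigma>"
      for \<sigma> and M N :: "('f, 'p, 'm) struct" using that by (rule transfer)
  qed
  from inf_model obtain M :: "('f, 'p, 'm) struct" where M: "model M" by auto
  let ?S = "SLB TYPE('m) L lt T"
  let ?th = "def_equiv_theories TYPE('m) L lt T CL Less (ccel_theory TYPE('m) L lt T)"
  let ?ex = "\<exists>M. model M \<and> def_equiv L M CL (CR M)" and ?all = "\<forall>M. model M \<longrightarrow> def_equiv L M CL (CR M)"
  \<comment> \<open>The implications run in a circle: from (SLB) to all models, to the theories, to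
    some model, and back to (SLB).\<close>
  have "?S \<Longrightarrow> ?all"
  proof -
    assume ?S
    then interpret slb_theory L lt T "TYPE('m)" by unfold_locales
    show ?all using def_equiv_CR by simp
  qed
  moreover have "?all \<Longrightarrow> ?th" using def_equiv_imp_theories[OF M] by simp
  moreover have "?th \<Longrightarrow> ?ex" by (rule def_equiv_theories_imp)
  moreover have "?ex \<Longrightarrow> ?S" by (elim exE conjE) (rule def_equiv_imp_SLB)
  ultimately show ?thesis by argo
qed

end
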